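(* Let $P$ be a non-trivial subgroup of the multiplicative group $\mathbb{R}^\times_{>0}$ and let $A$ be a non-zero subgroup of the additive group $\mathbb{R}$ such that $p\cdot A\subseteq A$ for every $p\in P$. Let $I$ be one of the intervals $[0,b]$ with $b\in A$, $b>0$; or $[0,\infty[$; or $\mathbb{R}$. Then there exists a surjective homomorphism $\psi\colon G(I;A,P)\to P$ such that $\psi\circ\alpha=\psi$ for every automorphism $\alpha$ of $G(I;A,P)$. The group $G(I;A,P)$ therefore has property $R_\infty$.
   Context: $\mathrm{PL}_o(\mathbb{R})$ denotes the group (under composition) of all orientation preserving piecewise linear homeomorphisms of $\mathbb{R}$ (with finitely many break points, i.e. points where left and right derivative differ). $G(I;A,P)$ is the subgroup of all $g\in \mathrm{PL}_o(\mathbb{R})$ such that: (a) the support $\{t\in\mathbb{R}\mid g(t)\neq t\}$ is contained in $I$; (b) the slopes of the finitely many line segments forming the graph of $g$ lie in $P$; (c) the break points of $g$ lie in $A$; (d) $g$ maps $A$ onto $A$. For an automorphism $\alpha$ of a group $G$, the $\alpha$-twisted conjugacy classes are the orbits of the action of $G$ on its underlying set given by $(g,x)\mapsto g\cdot x\cdot \alpha(g)^{-1}$. A group $G$ has property $R_\infty$ if for every automorphism $\alpha$ of $G$ there are infinitely many $\alpha$-twisted conjugacy classes. *)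

theory Defs
  imports "HOL-Analysis.Analysis" "HOL-Algebra.Group"
begin

definition positive_real_group :: "real monoid" where
  "positive_real_group = \<lparr>carrier = {0<..}, mult = (*), one = 1\<rparr>"

definition additive_real_group :: "real monoid" where
  "additive_real_group = \<lparr>carrier = UNIV, mult = (+), one = 0\<rparr>"

definition affine_on :: "real set \<Rightarrow> real \<Rightarrow> (real \<Rightarrow> real) \<Rightarrow> bool" where
  "affine_on J m g \<longleftrightarrow> (\<exists>c. \<forall>t\<in>J. g t = m * t + c)"

(* S is a finite set containing the break points; the segments over the unbounded
   components of the complement of S are covered because u < v are arbitrary. *)
definition piecewise_linear :: "(real \<Rightarrow> real) \<Rightarrow> bool" where
  "piecewise_linear g \<longleftrightarrow>
     (\<exists>S. finite S \<and> (\<forall>u v. u < v \<and> {u<..<v} \<inter> S = {} \<longrightarrow> (\<exists>m. affine_on {u<..<v} m g)))"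

definition PL_o :: "(real \<Rightarrow> real) set" where
  "PL_o = {g. (\<exists>h. homeomorphism UNIV UNIV g h) \<and> strict_mono g \<and> piecewise_linear g}"

definition PL_o_group :: "(real \<Rightarrow> real) monoid" where
  "PL_o_group = \<lparr>carrier = PL_o, mult = (\<circ>), one = id\<rparr>"

definition support :: "(real \<Rightarrow> real) \<Rightarrow> real set" where
  "support g = {t. g t \<noteq> t}"

definition break_points :: "(real \<Rightarrow> real) \<Rightarrow> real set" where
  "break_points g =
     {t. \<exists>l r. (g has_real_derivative l) (at_left t) \<and>
               (g has_real_derivative r) (at_right t) \<and> l \<noteq> r}"

definition slopes :: "(real \<Rightarrow> real) \<Rightarrow> real set" where
  "slopes g = {m. \<exists>u v. u < v \<and> affine_on {u<..<v} m g}"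

definition G_PL :: "real set \<Rightarrow> real set \<Rightarrow> real set \<Rightarrow> (real \<Rightarrow> real) monoid" where
  "G_PL I A P = PL_o_group\<lparr>carrier :=
     {g \<in> PL_o. support g \<subseteq> I \<and> slopes g \<subseteq> P \<and> break_points g \<subseteq> A \<and> g ` A = A}\<rparr>"

definition twisted_conjugacy_class :: "('a, 'b) monoid_scheme \<Rightarrow> ('a \<Rightarrow> 'a) \<Rightarrow> 'a \<Rightarrow> 'a set" where
  "twisted_conjugacy_class G \<alpha> x =
     {g \<otimes>\<^bsub>G\<^esub> x \<otimes>\<^bsub>G\<^esub> inv\<^bsub>G\<^esub> (\<alpha> g) | g. g \<in> carrier G}"

definition property_R_infinity :: "('a, 'b) monoid_scheme \<Rightarrow> bool" where
  "property_R_infinity G \<longleftrightarrow>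
     group G \<and> (\<forall>\<alpha> \<in> iso G G. infinite (twisted_conjugacy_class G \<alpha> ` carrier G))"

end

theory Submission
  imports Defs
begin

text \<open>An element \<open>g\<close> of \<open>G = G(I;A,P)\<close> is affine near the left end of \<open>I\<close>, and its slope there is a
  homomorphism \<open>\<sigma>\<close> from \<open>G\<close> onto \<open>P\<close>; so is the slope \<open>\<sigma>'\<close> at the right end. The character is
  \<open>\<psi> g = \<sigma> g * \<sigma>' g\<close> for \<open>I = [0,b]\<close> and \<open>I = \<real>\<close>, and \<open>\<psi> = \<sigma>\<close> for \<open>I = [0,\<infinity>[\<close>. If
  \<open>\<psi>\<close> is invariant under an automorphism \<open>\<alpha>\<close>, then it is constant on \<open>\<alpha>\<close>-twisted conjugacy classes;
  as \<open>P\<close> is infinite, property \<open>R\<^sub>\<infinity>\<close> follows. Invariance is shown in three steps.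

  \<^item> \<^emph>\<open>Automorphisms permute the ends\<close> (\<open>auto_permutes_ends\<close>). Let \<open>left_kernel\<close> and \<open>right_kernel\<close> be the
    subgroups of elements that are the identity near the left and near the right end. If \<open>f\<close> moves
    points arbitrarily close to an end, then the centralizer of \<open>f\<close> acts near that end as an abelian
    group. Hence, if \<open>f\<close> moves points near both ends, some conjugate \<open>f'\<close> of \<open>f\<close> has the property
    that \<open>f\<close> and \<open>f'\<close> together have an abelian centralizer; if \<open>f\<close> is the identity near one end, no
    conjugate has it. This describes the union of the two subgroups in terms of the multiplication
    alone (\<open>fixes_end_iff\<close>). As a subgroup inside a union of two subgroups lies in one of them, \<open>\<alpha>\<close>
    preserves or swaps \<open>left_kernel\<close> and \<open>right_kernel\<close>. A swap is undone by a reflection of \<open>I\<close> if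
    \<open>I\<close> is symmetric, and it is impossible for \<open>[0,\<infinity>[\<close>, where only one of the two quotients of \<open>G\<close>
    is abelian.

  \<^item> \<^emph>\<open>Automorphisms act on points\<close> (\<open>increasing_semiconjugacy\<close>). If \<open>\<alpha>\<close> preserves \<open>left_kernel\<close>, let
    \<open>\<phi> y\<close> be the infimum of the supports of the elements \<open>\<alpha> u\<close>, where \<open>u\<close> runs through the elements
    that are the identity to the left of \<open>y\<close>. Then \<open>\<phi>\<close> is a strictly increasing map of the interior
    of \<open>I\<close> into itself with \<open>\<phi> (f t) = \<alpha> f (\<phi> t)\<close>, so it transports order relations between images
    of points under \<open>f\<close> to relations between images under \<open>\<alpha> f\<close>.

  \<^item> \<^emph>\<open>The left slope cannot change\<close>. Suppose that \<open>f\<close> scales by \<open>q\<close> near the left end, and \<open>\<alpha> f\<close> by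
    \<open>q'\<close>. A translation by \<open>x\<close> is conjugated by \<open>f\<close> into a translation by \<open>q * x\<close>, and its image
    under \<open>\<alpha>\<close>, if this is a translation by \<open>k\<close>, into a translation by \<open>q' * k\<close>. Comparing \<open>n\<close> steps
    of length \<open>q * x\<close> with \<open>m\<close> steps of length \<open>x\<close> by means of \<open>\<phi>\<close> shows that \<open>q\<close> and \<open>q'\<close> have the
    same rational upper and lower bounds. For \<open>I = \<real>\<close> (\<open>left_slope_rigid_UNIV\<close>) the translations are
    commutators, and so are their images. For an end at \<open>0\<close> (\<open>left_slope_rigid_zero\<close>) translations
    exist only locally, on an interval away from \<open>0\<close>, and \<open>\<alpha>\<close> turns them merely into affine maps.
    However, conjugating such a translation by a scaling with \<open>p\<close> and dividing by the original gives
    a pair of maps in which the unknown slope has cancelled; these are the required translations if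
    \<open>p\<close> is close to \<open>1\<close>. If \<open>P\<close> has no elements close to \<open>1\<close>, then \<open>P\<close> is cyclic, and the
    order preserving automorphism that \<open>\<alpha>\<close> induces on it is the identity.\<close>

section \<open>Affine pieces of real functions\<close>

text \<open>The notation \<open>inv\<close> denotes inversion in abstract groups here, so the inverse of a map of the line
  gets a name of its own.\<close>
abbreviation finv :: "(real \<Rightarrow> real) \<Rightarrow> real \<Rightarrow> real" where
  "finv \<equiv> inv_into UNIV"

lemma affine_on_interval_unique:
  assumes "u < v" "u' < v'" "{u<..<v} \<subseteq> {u'<..<v'}"
    and "\<forall>t\<in>{u<..<v}. g t = m * t + c" "\<forall>t\<in>{u'<..<v'}. g t = m' * t + (c'::real)"
  shows "m = m' \<and> c = c'"
proof -
  define s where "s = u + (v - u) / 3"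
  define t where "t = u + 2 * (v - u) / 3"
  have st: "s < t" "s \<in> {u<..<v}" "t \<in> {u<..<v}" using assms(1) by (auto simp: s_def t_def field_simps)
  have e: "m * s + c = m' * s + c'" "m * t + c = m' * t + c'"
    using assms(3-) st by (metis subsetD)+
  then have "(m - m') * (t - s) = 0" by (simp add: algebra_simps)
  then show ?thesis using st e by auto
qed

lemma subinterval_avoiding_finite:
  fixes u v :: real
  assumes "finite S" "u < v"
  obtains w where "u < w" "w \<le> v" "{u<..<w} \<inter> S = {}"
proof -
  have fin: "finite (insert v (S \<inter> {u<..<v}))" using assms by simp
  define w where "w = Min (insert v (S \<inter> {u<..<v}))"
  have "w \<in> insert v (S \<inter> {u<..<v})" unfolding w_def by (rule Min_in[OF fin]) simp
  moreover have "{u<..<w} \<inter> S = {}"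
  proof (rule ccontr)
    assume "{u<..<w} \<inter> S \<noteq> {}"
    then obtain s where s: "s \<in> S" "u < s" "s < w" by auto
    have "w \<le> v" unfolding w_def by (rule Min_le[OF fin]) simp
    then have "s \<in> insert v (S \<inter> {u<..<v})" using s by simp
    then have "w \<le> s" unfolding w_def by (rule Min_le[OF fin])
    then show False using s by simp
  qed
  ultimately show ?thesis using that assms(2) by auto
qed

lemma affine_left_of_point:
  assumes "u < t" "\<forall>x\<in>{u<..<t}. g x = m * x + c" "isCont g t"
  shows "g t = m * t + c" "(g has_real_derivative m) (at_left t)"
proof -
  have ev: "eventually (\<lambda>x. g x = m * x + c) (at_left t)"
    using assms(1,2) by (auto simp: eventually_at_left intro!: exI[of _ u])
  have "(g \<longlongrightarrow> g t) (at_left t)" using assms(3)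
    by (simp add: continuous_at filterlim_at_split)
  then have "((\<lambda>x. m * x + c) \<longlongrightarrow> g t) (at_left t)" by (rule iffD1[OF tendsto_cong[OF ev]])
  moreover have "((\<lambda>x. m * x + c) \<longlongrightarrow> m * t + c) (at_left t)" by (intro tendsto_intros)
  ultimately show 1: "g t = m * t + c" by (rule tendsto_unique[OF trivial_limit_at_left_real])
  have "((\<lambda>x. m * x + c) has_real_derivative m) (at_left t)"
    by (auto intro!: derivative_eq_intros)
  then show "(g has_real_derivative m) (at_left t)"
    by (rule iffD2[OF has_field_derivative_cong_eventually[OF ev 1]])
qed

lemma affine_right_of_point:
  assumes "t < v" "\<forall>x\<in>{t<..<v}. g x = m * x + c" "isCont g t"
  shows "g t = m * t + c" "(g has_real_derivative m) (at_right t)"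
proof -
  have ev: "eventually (\<lambda>x. g x = m * x + c) (at_right t)"
    using assms(1,2) by (auto simp: eventually_at_right intro!: exI[of _ v])
  have "(g \<longlongrightarrow> g t) (at_right t)" using assms(3)
    by (simp add: continuous_at filterlim_at_split)
  then have "((\<lambda>x. m * x + c) \<longlongrightarrow> g t) (at_right t)" by (rule iffD1[OF tendsto_cong[OF ev]])
  moreover have "((\<lambda>x. m * x + c) \<longlongrightarrow> m * t + c) (at_right t)" by (intro tendsto_intros)
  ultimately show 1: "g t = m * t + c" by (rule tendsto_unique[OF trivial_limit_at_right_real])
  have "((\<lambda>x. m * x + c) has_real_derivative m) (at_right t)"
    by (auto intro!: derivative_eq_intros)
  then show "(g has_real_derivative m) (at_right t)"
    by (rule iffD2[OF has_field_derivative_cong_eventually[OF ev 1]])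
qed

lemma no_break_off_exceptional_set:
  assumes S: "finite S" and affine: "\<And>u v. u < v \<Longrightarrow> {u<..<v} \<inter> S = {} \<Longrightarrow> \<exists>m. affine_on {u<..<v} m g"
    and cont: "continuous_on UNIV g" and notin: "t \<notin> S"
  shows "t \<notin> break_points g"
proof -
  have "open (- S)" using S by (simp add: finite_imp_closed open_Compl)
  then obtain e where e: "e > 0" "ball t e \<subseteq> - S"
    using notin open_contains_ball by blast
  then have disj: "{t - e<..<t + e} \<inter> S = {}"
    by (simp add: ball_eq_greaterThanLessThan disjoint_eq_subset_Compl)
  have "t - e < t + e" using e(1) by simp
  from affine[OF this disj] obtain m c where m: "\<forall>x\<in>{t - e<..<t + e}. g x = m * x + c"
    unfolding affine_on_def by blast
  have c: "isCont g t" using cont by (simp add: continuous_on_eq_continuous_at)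
  have L: "(g has_real_derivative m) (at_left t)"
    by (rule affine_left_of_point(2)[OF _ _ c, of "t - e" m c]) (use e(1) m in \<open>auto\<close>)
  have R: "(g has_real_derivative m) (at_right t)"
    by (rule affine_right_of_point(2)[OF _ _ c, of "t + e" m c]) (use e(1) m in \<open>auto\<close>)
  show ?thesis using L R
    unfolding break_points_def mem_Collect_eq
    by (metis has_field_derivative_unique trivial_limit_at_left_real trivial_limit_at_right_real)
qed

text \<open>The exceptional set of a piecewise linear map may contain points where nothing happens. Such points
  can be crossed one at a time: continuity and equality of the one-sided derivatives match the
  affine maps on the two sides.\<close>
lemma piecewise_linear_affine_without_breaks:
  assumes "finite S" "\<And>u v. u < v \<Longrightarrow> {u<..<v} \<inter> S = {} \<Longrightarrow> \<exists>m. affine_on {u<..<v} m g"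
    and "continuous_on UNIV g" "u < v" "{u<..<v} \<inter> break_points g = {}"
  shows "\<exists>m. affine_on {u<..<v} m g"
  using assms(4,5)
proof (induction "card (S \<inter> {u<..<v})" arbitrary: u v rule: less_induct)
  case less
  show ?case
  proof (cases "{u<..<v} \<inter> S = {}")
    case True then show ?thesis using assms(2) less.prems by blast
  next
    case False
    then obtain s where s: "s \<in> S" "u < s" "s < v" by auto
    have disj: "{u<..<s} \<inter> break_points g = {}" "{s<..<v} \<inter> break_points g = {}"
    proof -
      have "{u<..<s} \<subseteq> {u<..<v}" "{s<..<v} \<subseteq> {u<..<v}" using s by auto
      then show "{u<..<s} \<inter> break_points g = {}" "{s<..<v} \<inter> break_points g = {}"
        using less.prems(2) by blast+
    qed
    have "card (S \<inter> {u<..<s}) < card (S \<inter> {u<..<v})"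
      using s assms(1) by (intro psubset_card_mono) auto
    from less.hyps[OF this s(2) disj(1)]
    obtain m c where m: "\<forall>t\<in>{u<..<s}. g t = m * t + c" unfolding affine_on_def by blast
    have "card (S \<inter> {s<..<v}) < card (S \<inter> {u<..<v})"
      using s assms(1) by (intro psubset_card_mono) auto
    from less.hyps[OF this s(3) disj(2)]
    obtain n d where n: "\<forall>t\<in>{s<..<v}. g t = n * t + d" unfolding affine_on_def by blast
    have cont: "isCont g s" using assms(3) by (simp add: continuous_on_eq_continuous_at)
    note l = affine_left_of_point[OF s(2) m cont]
    note r = affine_right_of_point[OF s(3) n cont]
    have "s \<notin> break_points g" using s less.prems(2) by (metis IntI emptyE greaterThanLessThan_iff)
    then have "m = n" using l r by (auto simp: break_points_def)
    then have "c = d" using l r by simp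
    have "\<forall>t\<in>{u<..<v}. g t = m * t + c"
    proof
      fix t assume t: "t \<in> {u<..<v}"
      consider "t < s" | "t = s" | "s < t" by linarith
      then show "g t = m * t + c"
        using m n l(1) t \<open>m = n\<close> \<open>c = d\<close> by cases auto
    qed
    then show ?thesis by (auto simp: affine_on_def)
  qed
qed

section \<open>Slopes and break points\<close>
locale pl_setting =
  fixes A P :: "real set"
  assumes A_subgroup: "subgroup A additive_real_group" and A_nonzero: "A \<noteq> {0}"
    and P_subgroup: "subgroup P positive_real_group" and P_nontrivial: "P \<noteq> {1}"
    and P_acts: "\<And>p. p \<in> P \<Longrightarrow> (\<lambda>a. p * a) ` A \<subseteq> A"
begin

lemma A_zero: "0 \<in> A"
  using subgroup.one_closed[OF A_subgroup] by (simp add: additive_real_group_def)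

lemma A_add: "a \<in> A \<Longrightarrow> b \<in> A \<Longrightarrow> a + b \<in> A"
  using subgroup.m_closed[OF A_subgroup] by (simp add: additive_real_group_def)

lemma A_uminus:
  assumes "a \<in> A" shows "- a \<in> A"
proof -
  have "group additive_real_group"
    by (rule groupI) (auto simp: additive_real_group_def intro: exI[of _ "- x" for x])
  then have "inv\<^bsub>additive_real_group\<^esub> a = - a"
    by (intro group.inv_equality) (auto simp: additive_real_group_def)
  then show ?thesis
    using subgroup.m_inv_closed[OF A_subgroup assms] by simp
qed

lemma A_diff: "a \<in> A \<Longrightarrow> b \<in> A \<Longrightarrow> a - b \<in> A"
  using A_add[of a "- b"] A_uminus[of b] by simp

lemma P_pos: "p \<in> P \<Longrightarrow> 0 < p"
  using subgroup.subset[OF P_subgroup] by (auto simp: positive_real_group_def)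

lemma P_one: "1 \<in> P"
  using subgroup.one_closed[OF P_subgroup] by (simp add: positive_real_group_def)

lemma P_mult: "p \<in> P \<Longrightarrow> q \<in> P \<Longrightarrow> p * q \<in> P"
  using subgroup.m_closed[OF P_subgroup] by (simp add: positive_real_group_def)

lemma group_positive_real: "group positive_real_group"
proof (rule groupI)
  fix x assume "x \<in> carrier positive_real_group"
  then show "\<exists>y\<in>carrier positive_real_group. y \<otimes>\<^bsub>positive_real_group\<^esub> x = \<one>\<^bsub>positive_real_group\<^esub>"
    by (intro bexI[of _ "1 / x"]) (auto simp: positive_real_group_def)
qed (auto simp: positive_real_group_def)

lemma P_inverse:
  assumes "p \<in> P" shows "1 / p \<in> P"
proof -
  have "inv\<^bsub>positive_real_group\<^esub> p = 1 / p"
    using P_pos[OF assms]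
    by (intro group.inv_equality[OF group_positive_real]) (auto simp: positive_real_group_def)
  then show ?thesis
    using subgroup.m_inv_closed[OF P_subgroup assms] by simp
qed

lemma P_power: "p \<in> P \<Longrightarrow> p ^ n \<in> P"
  by (induction n) (auto intro: P_one P_mult)

lemma PA_mult: "p \<in> P \<Longrightarrow> a \<in> A \<Longrightarrow> p * a \<in> A"
  using P_acts by blast

lemma P_gt_one: obtains p where "p \<in> P" "1 < p"
proof -
  obtain q where q: "q \<in> P" "q \<noteq> 1"
    using P_nontrivial P_one by blast
  show ?thesis
  proof (cases "1 < q")
    case False
    then have "1 < 1 / q"
      using q P_pos[OF q(1)] by (simp add: field_simps)
    then show ?thesis using that P_inverse[OF q(1)] by blast
  qed (use q that in blast)
qed

lemma A_of_nat_mult: "a \<in> A \<Longrightarrow> real n * a \<in> A"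
  by (induction n) (auto simp: A_zero distrib_right intro: A_add)

lemma A_of_int_mult:
  assumes "a \<in> A" shows "real_of_int k * a \<in> A"
proof (cases k rule: int_cases2)
  case (nonneg n) then show ?thesis using A_of_nat_mult[OF assms] by simp
next
  case (nonpos n) then show ?thesis using A_uminus[OF A_of_nat_mult[OF assms, of n]] by simp
qed

text \<open>Multiplying a fixed element of \<open>A\<close> by high powers of a small slope gives arbitrarily short steps
  in \<open>A\<close>.\<close>
lemma A_dense:
  assumes "x < y" obtains a where "a \<in> A" "x < a" "a < y"
proof -
  obtain a0 where "a0 \<in> A" "a0 \<noteq> 0" using A_nonzero A_zero by blast
  then have a0: "\<bar>a0\<bar> \<in> A" "0 < \<bar>a0\<bar>"
    using A_uminus[of a0] by (auto simp: abs_if)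
  obtain p where p: "p \<in> P" "1 < p" by (rule P_gt_one)
  obtain n where n: "\<bar>a0\<bar> / (y - x) < p ^ n"
    using real_arch_pow[OF p(2)] by blast
  define d where "d = (1 / p ^ n) * \<bar>a0\<bar>"
  have "d \<in> A" unfolding d_def by (intro PA_mult P_inverse P_power p a0)
  have "0 < d" using a0 p by (simp add: d_def)
  have "d < y - x" using n assms p by (simp add: d_def field_simps)
  define k where "k = \<lfloor>x / d\<rfloor> + 1"
  have "x / d < real_of_int k" "real_of_int k \<le> x / d + 1" unfolding k_def by linarith+
  then have "x < real_of_int k * d" "real_of_int k * d \<le> x + d"
    using \<open>0 < d\<close> by (simp_all add: field_simps)
  then show ?thesis
    using that[of "real_of_int k * d"] \<open>d < y - x\<close> A_of_int_mult[OF \<open>d \<in> A\<close>] by auto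
qed

section \<open>The groups as groups of bijections\<close>

text \<open>The group \<open>G(I;A,P)\<close> in a form suited to computations: \<open>J\<close> is the interior of \<open>I\<close>, and a single
  finite set \<open>S\<close> in \<open>A\<close> carries the conditions on slopes and on break points. It agrees with the
  original definition by \<open>carrier_G_PL\<close>.\<close>
definition PLG :: "real set \<Rightarrow> (real \<Rightarrow> real) set" where
  "PLG J = {g. strict_mono g \<and> surj g \<and> g ` A = A \<and> (\<forall>t. t \<notin> J \<longrightarrow> g t = t) \<and>
     (\<exists>S. finite S \<and> S \<subseteq> A \<and>
        (\<forall>u v. u < v \<and> {u<..<v} \<inter> S = {} \<longrightarrow> (\<exists>m\<in>P. affine_on {u<..<v} m g)))}"

lemma PLG_I:
  assumes "strict_mono g" "surj g" "g ` A = A" "\<And>t. t \<notin> J \<Longrightarrow> g t = t" "finite S" "S \<subseteq> A"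
    and "\<And>u v. u < v \<Longrightarrow> {u<..<v} \<inter> S = {} \<Longrightarrow> \<exists>m\<in>P. affine_on {u<..<v} m g"
  shows "g \<in> PLG J"
  unfolding PLG_def
  by (intro CollectI conjI exI[of _ S] allI impI; (elim conjE)?; rule assms; assumption)

lemma PLG_strict_mono: "g \<in> PLG J \<Longrightarrow> strict_mono g"
  and PLG_surj: "g \<in> PLG J \<Longrightarrow> surj g"
  and PLG_image: "g \<in> PLG J \<Longrightarrow> g ` A = A"
  and PLG_outside: "g \<in> PLG J \<Longrightarrow> t \<notin> J \<Longrightarrow> g t = t"
  by (auto simp: PLG_def)

lemma PLG_less: "g \<in> PLG J \<Longrightarrow> g x < g y \<longleftrightarrow> x < y"
  and PLG_le: "g \<in> PLG J \<Longrightarrow> g x \<le> g y \<longleftrightarrow> x \<le> y"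
  and PLG_eq: "g \<in> PLG J \<Longrightarrow> g x = g y \<longleftrightarrow> x = y"
  using PLG_strict_mono strict_mono_less strict_mono_less_eq strict_mono_eq by blast+

lemma PLG_inj: "g \<in> PLG J \<Longrightarrow> inj g"
  by (simp add: PLG_eq inj_def)

lemma PLG_inv_apply: "g \<in> PLG J \<Longrightarrow> finv g (g t) = t"
  and PLG_apply_inv: "g \<in> PLG J \<Longrightarrow> g (finv g t) = t"
  using PLG_inj PLG_surj surj_f_inv_f inv_f_f by metis+

lemma PLG_comp_inv: "g \<in> PLG J \<Longrightarrow> g \<circ> finv g = id"
  and PLG_inv_comp: "g \<in> PLG J \<Longrightarrow> finv g \<circ> g = id"
  by (auto simp: fun_eq_iff PLG_inv_apply PLG_apply_inv)

lemma PLG_mem: "g \<in> PLG J \<Longrightarrow> g t \<in> J \<longleftrightarrow> t \<in> J"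
  using PLG_eq[of g J "g t" t] PLG_outside[of g J t] PLG_outside[of g J "g t"] by auto

lemma PLG_pieces:
  assumes "g \<in> PLG J"
  obtains S where "finite S" "S \<subseteq> A"
    "\<And>u v. u < v \<Longrightarrow> {u<..<v} \<inter> S = {} \<Longrightarrow> \<exists>m\<in>P. affine_on {u<..<v} m g"
proof -
  obtain S where "finite S \<and> S \<subseteq> A \<and>
      (\<forall>u v. u < v \<and> {u<..<v} \<inter> S = {} \<longrightarrow> (\<exists>m\<in>P. affine_on {u<..<v} m g))"
    using assms unfolding PLG_def mem_Collect_eq by (elim conjE exE) simp
  then show ?thesis by (intro that[of S]) simp_all
qed

lemma PLG_mono: "J \<subseteq> J' \<Longrightarrow> PLG J \<subseteq> PLG J'"
  by (auto simp: PLG_def)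

lemma PLG_id: "id \<in> PLG J"
proof -
  have "affine_on {u<..<v} 1 id" for u v by (auto simp: affine_on_def intro: exI[of _ 0])
  then show ?thesis
    by (auto simp: PLG_def strict_mono_def intro!: exI[of _ "{}"] bexI[OF _ P_one])
qed

lemma PLG_comp:
  assumes g: "g \<in> PLG J" and h: "h \<in> PLG J" shows "g \<circ> h \<in> PLG J"
proof -
  obtain S where S: "finite S" "S \<subseteq> A"
    "\<And>u v. u < v \<Longrightarrow> {u<..<v} \<inter> S = {} \<Longrightarrow> \<exists>m\<in>P. affine_on {u<..<v} m g"
    using PLG_pieces[OF g] by blast
  obtain T where T: "finite T" "T \<subseteq> A"
    "\<And>u v. u < v \<Longrightarrow> {u<..<v} \<inter> T = {} \<Longrightarrow> \<exists>m\<in>P. affine_on {u<..<v} m h"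
    using PLG_pieces[OF h] by blast
  define U where "U = T \<union> finv h ` S"
  have "finv h s \<in> A" if "s \<in> S" for s
    using that S(2) PLG_image[OF h] PLG_inv_apply[OF h] by (metis image_iff subsetD)
  then have U: "finite U" "U \<subseteq> A" using S T by (auto simp: U_def)
  have aff: "\<exists>m\<in>P. affine_on {u<..<v} m (g \<circ> h)" if uv: "u < v" "{u<..<v} \<inter> U = {}" for u v
  proof -
    obtain m c where m: "m \<in> P" "\<forall>t\<in>{u<..<v}. h t = m * t + c"
      using T(3)[of u v] uv unfolding U_def affine_on_def by blast
    have "{h u<..<h v} \<inter> S = {}"
    proof (rule ccontr)
      assume "{h u<..<h v} \<inter> S \<noteq> {}"
      then obtain s where "s \<in> S" "h u < s" "s < h v" by auto
      then have "finv h s \<in> {u<..<v} \<inter> U"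
        using PLG_less[OF h, of u "finv h s"] PLG_less[OF h, of "finv h s" v]
        by (auto simp: PLG_apply_inv[OF h] U_def)
      then show False using uv by blast
    qed
    then obtain n d where n: "n \<in> P" "\<forall>t\<in>{h u<..<h v}. g t = n * t + d"
      using S(3)[of "h u" "h v"] uv PLG_less[OF h] by (auto simp: affine_on_def)
    have "\<forall>t\<in>{u<..<v}. (g \<circ> h) t = (n * m) * t + (n * c + d)"
    proof
      fix t assume t: "t \<in> {u<..<v}"
      then have "h t \<in> {h u<..<h v}" by (simp add: PLG_less[OF h])
      then show "(g \<circ> h) t = (n * m) * t + (n * c + d)"
        using m n t by (simp add: algebra_simps)
    qed
    then show ?thesis
      unfolding affine_on_def using P_mult[OF n(1) m(1)] by blast
  qed
  have sm: "strict_mono (g \<circ> h)"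
    using PLG_less[OF g] PLG_less[OF h] by (simp add: strict_mono_def)
  have sj: "surj (g \<circ> h)" by (intro comp_surj PLG_surj[OF g] PLG_surj[OF h])
  have im: "(g \<circ> h) ` A = A" by (metis PLG_image g h image_comp)
  have out: "\<And>t. t \<notin> J \<Longrightarrow> (g \<circ> h) t = t" by (simp add: PLG_outside[OF g] PLG_outside[OF h])
  show ?thesis by (rule PLG_I[OF sm sj im out U aff])
qed

lemma PLG_inv:
  assumes g: "g \<in> PLG J" shows "finv g \<in> PLG J"
proof -
  obtain S where S: "finite S" "S \<subseteq> A"
    "\<And>u v. u < v \<Longrightarrow> {u<..<v} \<inter> S = {} \<Longrightarrow> \<exists>m\<in>P. affine_on {u<..<v} m g"
    using PLG_pieces[OF g] by blast
  have less: "finv g x < finv g y \<longleftrightarrow> x < y" for x y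
    using PLG_less[OF g, of "finv g x" "finv g y"] by (simp add: PLG_apply_inv[OF g])
  have U: "finite (g ` S)" "g ` S \<subseteq> A" using S(1) image_mono[OF S(2), of g] PLG_image[OF g] by auto
  have aff: "\<exists>m\<in>P. affine_on {u<..<v} m (finv g)" if uv: "u < v" "{u<..<v} \<inter> g ` S = {}" for u v
  proof -
    have "{finv g u<..<finv g v} \<inter> S = {}"
    proof (rule ccontr)
      assume "{finv g u<..<finv g v} \<inter> S \<noteq> {}"
      then obtain s where "s \<in> S" "finv g u < s" "s < finv g v" by auto
      then have "g s \<in> {u<..<v} \<inter> g ` S"
        using PLG_less[OF g, of "finv g u" s] PLG_less[OF g, of s "finv g v"]
        by (auto simp: PLG_apply_inv[OF g])
      then show False using uv by blast
    qed
    then obtain m c where m: "m \<in> P" "\<forall>t\<in>{finv g u<..<finv g v}. g t = m * t + c"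
      using S(3)[of "finv g u" "finv g v"] uv less by (auto simp: affine_on_def)
    have "\<forall>t\<in>{u<..<v}. finv g t = (1 / m) * t + (- c / m)"
    proof
      fix t assume "t \<in> {u<..<v}"
      then have "finv g t \<in> {finv g u<..<finv g v}" by (simp add: less)
      then have "t = m * finv g t + c" using m PLG_apply_inv[OF g] by metis
      then show "finv g t = (1 / m) * t + (- c / m)"
        using P_pos[OF m(1)] by (simp add: field_simps)
    qed
    then show ?thesis
      unfolding affine_on_def using P_inverse[OF m(1)] by blast
  qed
  have sm: "strict_mono (finv g)" using less by (simp add: strict_mono_def)
  have sj: "surj (finv g)" using PLG_inj[OF g] by (rule inj_imp_surj_inv)
  have im: "finv g ` A = A"
    by (metis PLG_image[OF g] PLG_inj[OF g] image_inv_f_f)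
  have out: "\<And>t. t \<notin> J \<Longrightarrow> finv g t = t"
    by (metis PLG_inv_apply[OF g] PLG_outside[OF g])
  show ?thesis by (rule PLG_I[OF sm sj im out U aff])
qed

lemma PLG_continuous:
  assumes "g \<in> PLG J" shows "continuous_on UNIV g"
  by (rule continuous_onI_mono) (auto simp: PLG_surj[OF assms] PLG_le[OF assms])

text \<open>The support of a homeomorphism is open, so it lies in \<open>I\<close> exactly if it lies in the interior of \<open>I\<close>;
  and the set of all break points can serve as the exceptional set.\<close>
lemma carrier_G_PL: "carrier (G_PL I A P) = PLG (interior I)"
proof (intro Set.set_eqI iffI)
  fix g assume "g \<in> carrier (G_PL I A P)"
  then have g: "g \<in> PL_o" "support g \<subseteq> I" "slopes g \<subseteq> P" "break_points g \<subseteq> A" "g ` A = A"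
    by (auto simp: G_PL_def PL_o_group_def)
  obtain h where h: "homeomorphism UNIV UNIV g h" and mono: "strict_mono g"
    and pl: "piecewise_linear g" using g(1) by (auto simp: PL_o_def)
  have cont: "continuous_on UNIV g" and surj: "surj g"
    using h by (auto simp: homeomorphism_def)
  have "open (support g)"
  proof -
    have "support g = {t. g t \<noteq> id t}" by (simp add: support_def)
    then show ?thesis using cont by (metis continuous_on_id' id_def open_Collect_neq)
  qed
  then have supp: "support g \<subseteq> interior I" using g(2) interior_maximal by blast
  obtain S where S: "finite S" "\<And>u v. u < v \<Longrightarrow> {u<..<v} \<inter> S = {} \<Longrightarrow> \<exists>m. affine_on {u<..<v} m g"
    using pl unfolding piecewise_linear_def by blast
  have bp: "break_points g \<subseteq> S"
  proof
    fix t assume t: "t \<in> break_points g"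
    then show "t \<in> S" using no_break_off_exceptional_set[OF S cont] by blast
  qed
  have "\<exists>m\<in>P. affine_on {u<..<v} m g" if uv: "u < v" "{u<..<v} \<inter> break_points g = {}" for u v
  proof -
    obtain m where "affine_on {u<..<v} m g"
      using piecewise_linear_affine_without_breaks[OF S cont uv] by blast
    moreover from this have "m \<in> slopes g" using uv by (auto simp: slopes_def)
    ultimately show ?thesis using g(3) by blast
  qed
  then show "g \<in> PLG (interior I)"
    using mono surj g(4,5) supp finite_subset[OF bp S(1)]
    by (intro PLG_I[of g _ "break_points g"]) (auto simp: support_def)
next
  fix g assume g: "g \<in> PLG (interior I)"
  obtain S where S: "finite S" "S \<subseteq> A"
    "\<And>u v. u < v \<Longrightarrow> {u<..<v} \<inter> S = {} \<Longrightarrow> \<exists>m\<in>P. affine_on {u<..<v} m g"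
    using PLG_pieces[OF g] by blast
  have homeo: "homeomorphism UNIV UNIV g (finv g)"
    using PLG_continuous[OF g] PLG_continuous[OF PLG_inv[OF g]] PLG_surj[OF g]
      PLG_surj[OF PLG_inv[OF g]] PLG_apply_inv[OF g] PLG_inv_apply[OF g]
    by (auto simp: homeomorphism_def)
  have aff: "\<exists>m. affine_on {u<..<v} m g" if "u < v" "{u<..<v} \<inter> S = {}" for u v
    using S(3)[OF that] by (elim bexE) (rule exI)
  have "piecewise_linear g"
    unfolding piecewise_linear_def by (intro exI[of _ S] conjI S(1) allI impI) (use aff in \<open>elim conjE, assumption\<close>)
  with homeo have "g \<in> PL_o" using PLG_strict_mono[OF g] by (auto simp: PL_o_def)
  moreover have "support g \<subseteq> I"
    using PLG_outside[OF g] interior_subset[of I] by (auto simp: support_def)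
  moreover have "slopes g \<subseteq> P"
  proof
    fix m assume "m \<in> slopes g"
    then obtain u v c where uv: "u < v" "\<forall>t\<in>{u<..<v}. g t = m * t + c"
      unfolding slopes_def affine_on_def by blast
    obtain w where w: "u < w" "w \<le> v" "{u<..<w} \<inter> S = {}"
      using subinterval_avoiding_finite[OF S(1) uv(1)] by blast
    obtain n d where n: "n \<in> P" "\<forall>t\<in>{u<..<w}. g t = n * t + d"
      using S(3)[OF w(1,3)] unfolding affine_on_def by (elim bexE exE) (rule that)
    have "{u<..<w} \<subseteq> {u<..<v}" using w(2) by auto
    from affine_on_interval_unique[OF w(1) uv(1) this n(2) uv(2)] have "n = m" ..
    then show "m \<in> P" using n by simp
  qed
  moreover have "break_points g \<subseteq> A"
  proof
    fix t assume t: "t \<in> break_points g"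
    have "t \<in> S"
    proof (rule ccontr)
      assume "t \<notin> S"
      have "t \<notin> break_points g"
        by (rule no_break_off_exceptional_set[OF S(1) _ PLG_continuous[OF g] \<open>t \<notin> S\<close>]) (rule aff)
      then show False using t ..
    qed
    then show "t \<in> A" using S(2) by (rule rev_subsetD)
  qed
  ultimately show "g \<in> carrier (G_PL I A P)"
    using PLG_image[OF g] by (simp add: G_PL_def PL_o_group_def)
qed


section \<open>Bumps and reflections\<close>

text \<open>The simplest element: slope \<open>1\<close> to the left of \<open>c\<close> and slope \<open>p\<close> to the right. Every explicit element
  below is composed of such maps, so that membership in the group has to be checked only once.\<close>
definition kink :: "real \<Rightarrow> real \<Rightarrow> real \<Rightarrow> real" where
  "kink c p t = (if t \<le> c then t else c + p * (t - c))"

lemma kink_left: "t \<le> c \<Longrightarrow> kink c p t = t"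
  and kink_right: "c \<le> t \<Longrightarrow> kink c p t = c + p * (t - c)"
  by (auto simp: kink_def)

lemma kink_in_PLG:
  assumes c: "c \<in> A" and p: "p \<in> P" and J: "{c<..} \<subseteq> J"
  shows "kink c p \<in> PLG J"
proof (rule PLG_I[where S = "{c}"])
  have pos: "0 < p" by (rule P_pos[OF p])
  have inverse: "kink c q (kink c r t) = t" if "0 < q" "0 < r" "q * r = 1" for q r t
  proof (cases "t \<le> c")
    case False
    then have "c \<le> c + r * (t - c)" using that by simp
    then have "kink c q (kink c r t) = c + q * (r * (t - c))"
      using False by (simp add: kink_right)
    also have "q * (r * (t - c)) = t - c" using that(3) by (metis mult.assoc mult_1)
    finally show ?thesis by simp
  qed (simp add: kink_left)
  have inv: "kink c p (kink c (1 / p) t) = t" for t by (rule inverse) (use pos in auto)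
  show "strict_mono (kink c p)"
  proof (rule strict_monoI)
    fix x y :: real assume "x < y"
    show "kink c p x < kink c p y"
    proof (cases "y \<le> c")
      case False
      then have "0 < p * (y - c)" using pos by simp
      moreover have "p * (x - c) < p * (y - c)" using \<open>x < y\<close> pos by simp
      ultimately show ?thesis using False by (auto simp: kink_def)
    qed (use \<open>x < y\<close> in \<open>simp add: kink_def\<close>)
  qed
  show "surj (kink c p)" using inv by (metis surj_def)
  have AA: "kink c q a \<in> A" if "q \<in> P" "a \<in> A" for q a
    using that c by (auto simp: kink_def intro!: A_add PA_mult A_diff)
  show "kink c p ` A = A"
  proof
    show "kink c p ` A \<subseteq> A" using AA[OF p] by auto
    show "A \<subseteq> kink c p ` A" using AA[OF P_inverse[OF p]] inv by (metis imageI subsetI)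
  qed
  show "kink c p t = t" if "t \<notin> J" for t
  proof -
    have "t \<notin> {c<..}" using J that by blast
    then show ?thesis by (simp add: kink_def)
  qed
  show "finite {c}" "{c} \<subseteq> A" using c by auto
  show "\<exists>m\<in>P. affine_on {u<..<v} m (kink c p)" if uv: "u < v" "{u<..<v} \<inter> {c} = {}" for u v
  proof (cases "v \<le> c")
    case True
    then have "affine_on {u<..<v} 1 (kink c p)"
      unfolding affine_on_def by (intro exI[of _ 0]) (auto simp: kink_left)
    then show ?thesis using P_one by blast
  next
    case False
    then have "c \<le> u" using uv by auto
    then have "affine_on {u<..<v} p (kink c p)"
      unfolding affine_on_def by (intro exI[of _ "c - p * c"]) (auto simp: kink_right algebra_simps)
    then show ?thesis using p by blast
  qed
qed

text \<open>From \<open>c\<close> on, this map has slope \<open>p\<close> for a length \<open>a\<close>, then slope \<open>1\<close> for a length \<open>l\<close>, where it is a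
  translation by \<open>(p - 1) * a\<close>, and then slope \<open>1 / p\<close> until it meets the diagonal again. The four
  kinks sit at the images of the break points, as they are applied one after the other.\<close>
definition bump :: "real \<Rightarrow> real \<Rightarrow> real \<Rightarrow> real \<Rightarrow> real \<Rightarrow> real" where
  "bump c p a l = kink (c + p * a + l + a) p \<circ> kink (c + p * a + l) (1 / p) \<circ>
     kink (c + p * a) (1 / p) \<circ> kink c p"

lemma
  assumes "1 < p" "0 < a" "0 \<le> l"
  shows bump_left: "t \<le> c \<Longrightarrow> bump c p a l t = t"
    and bump_expanding: "c \<le> t \<Longrightarrow> t \<le> c + a \<Longrightarrow> bump c p a l t = c + p * (t - c)"
    and bump_translating:
      "c + a \<le> t \<Longrightarrow> t \<le> c + a + l \<Longrightarrow> bump c p a l t = t + (p - 1) * a"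
    and bump_contracting: "c + a + l \<le> t \<Longrightarrow> t \<le> c + a + l + p * a \<Longrightarrow>
      bump c p a l t = c + p * a + l + (t - c - a - l) / p"
    and bump_right: "c + a + l + p * a \<le> t \<Longrightarrow> bump c p a l t = t"
proof -
  have pa: "a < p * a" using assms by simp
  show "bump c p a l t = t" if "t \<le> c"
  proof -
    have "0 < p * a" using assms by simp
    then have "t \<le> c + p * a" "t \<le> c + p * a + l" "t \<le> c + p * a + l + a"
      using that assms by linarith+
    then show ?thesis using that by (simp add: bump_def kink_left)
  qed
  show "bump c p a l t = c + p * (t - c)" if t: "c \<le> t" "t \<le> c + a"
  proof -
    have "p * (t - c) \<le> p * a" using t assms by simp
    then have "c + p * (t - c) \<le> c + p * a" "c + p * (t - c) \<le> c + p * a + l"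
      "c + p * (t - c) \<le> c + p * a + l + a" using assms by linarith+
    then show ?thesis using t by (simp add: bump_def kink_left kink_right)
  qed
  have k2: "kink (c + p * a) (1 / p) (kink c p t) = t + (p - 1) * a" if t: "c + a \<le> t"
  proof -
    have "p * a \<le> p * (t - c)" using t assms by simp
    then have "kink (c + p * a) (1 / p) (kink c p t) = c + p * a + (1 / p) * (p * (t - c) - p * a)"
      using t assms by (simp add: kink_right)
    also have "\<dots> = t + (p - 1) * a" using assms by (simp add: field_simps)
    finally show ?thesis .
  qed
  show "bump c p a l t = t + (p - 1) * a" if t: "c + a \<le> t" "t \<le> c + a + l"
  proof -
    have "t + (p - 1) * a \<le> c + p * a + l" using t by (simp add: algebra_simps)
    then show ?thesis using k2[OF t(1)] assms by (simp add: bump_def kink_left)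
  qed
  have k3: "kink (c + p * a + l) (1 / p) (kink (c + p * a) (1 / p) (kink c p t)) =
      c + p * a + l + (t - c - a - l) / p" if t: "c + a + l \<le> t"
  proof -
    have "c + p * a + l \<le> t + (p - 1) * a" using t by (simp add: algebra_simps)
    then show ?thesis using k2 t assms by (simp add: kink_right field_simps)
  qed
  show "bump c p a l t = c + p * a + l + (t - c - a - l) / p"
    if t: "c + a + l \<le> t" "t \<le> c + a + l + p * a"
  proof -
    have "(t - c - a - l) / p \<le> a" using t assms by (simp add: field_simps)
    then show ?thesis using k3[OF t(1)] by (simp add: bump_def kink_left)
  qed
  show "bump c p a l t = t" if t: "c + a + l + p * a \<le> t"
  proof -
    have "c + a + l \<le> t" using t assms pa by linarith
    moreover have "a \<le> (t - c - a - l) / p" using t assms by (simp add: field_simps)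
    ultimately have "bump c p a l t = c + p * a + l + a + p * ((t - c - a - l) / p - a)"
      using k3 by (simp add: bump_def kink_right)
    then show ?thesis using assms by (simp add: field_simps)
  qed
qed

lemma bump_in_PLG:
  assumes "c \<in> A" "p \<in> P" "1 < p" "a \<in> A" "0 < a" "l \<in> A" "0 \<le> l"
    and J: "{c<..<c + a + l + p * a} \<subseteq> J"
  shows "bump c p a l \<in> PLG J"
proof -
  have pa: "p * a \<in> A" using assms PA_mult by blast
  have "bump c p a l \<in> PLG UNIV"
    unfolding bump_def
    by (intro PLG_comp kink_in_PLG P_inverse assms A_add pa) auto
  moreover have "bump c p a l t = t" if "t \<notin> J" for t
  proof (cases "t \<le> c")
    case False
    then have "c + a + l + p * a \<le> t" using J that by (metis greaterThanLessThan_iff linorder_le_less_linear subsetD)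
    then show ?thesis using assms bump_right by blast
  qed (use assms bump_left in blast)
  ultimately show ?thesis by (auto simp: PLG_def)
qed

lemma bump_moves_up:
  assumes "1 < p" "0 < a" "0 \<le> l" "c < t" "t < c + a + l + p * a"
  shows "t < bump c p a l t"
proof -
  have "0 < (p - 1) * a" using assms by simp
  consider "t \<le> c + a" | "c + a \<le> t" "t \<le> c + a + l" | "c + a + l \<le> t" by linarith
  then show ?thesis
  proof cases
    case 1
    have "0 < (p - 1) * (t - c)" using assms by simp
    then show ?thesis
      using 1 assms bump_expanding[of p a l c t] by (simp add: algebra_simps)
  next
    case 2 then show ?thesis
      using assms bump_translating[of p a l c t] \<open>0 < (p - 1) * a\<close> by simp
  next
    case 3
    have "(t - c - a - l) / p < a" using assms by (simp add: field_simps)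
    then have "0 < (p - 1) * (a - (t - c - a - l) / p)" using assms by simp
    also have "\<dots> = c + p * a + l + (t - c - a - l) / p - t"
      using assms by (simp add: field_simps)
    finally show ?thesis
      using 3 assms bump_contracting[of p a l c t] by simp
  qed
qed

lemma exists_move_up_from:
  assumes "c \<in> A" "c < z" "z < y"
  obtains g where "g \<in> PLG {c<..<y}" "z < g z"
proof -
  obtain p where p: "p \<in> P" "1 < p" by (rule P_gt_one)
  have "(z - c) / (1 + p) < (y - c) / (1 + p)"
    using assms p by (simp add: divide_strict_right_mono)
  then obtain a where a: "a \<in> A" "(z - c) / (1 + p) < a" "a < (y - c) / (1 + p)"
    by (rule A_dense)
  then have az: "z < c + a + 0 + p * a" and ay: "c + a + 0 + p * a < y"
    using p by (simp_all add: field_simps)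
  have "0 < (z - c) / (1 + p)" using assms p by simp
  then have a0: "0 < a" using a(2) by linarith
  have "bump c p a 0 \<in> PLG {c<..<y}"
    using ay by (intro bump_in_PLG assms p a a0 A_zero) auto
  moreover have "z < bump c p a 0 z"
    using assms p a0 az by (intro bump_moves_up) auto
  ultimately show ?thesis using that by blast
qed

lemma exists_move_up:
  assumes "x < z" "z < y"
  obtains g where "g \<in> PLG {x<..<y}" "z < g z"
proof -
  obtain c where c: "c \<in> A" "x < c" "c < z" using A_dense[OF assms(1)] by blast
  obtain g where g: "g \<in> PLG {c<..<y}" "z < g z"
    using exists_move_up_from[OF c(1,3) assms(2)] by blast
  have "{c<..<y} \<subseteq> {x<..<y}" using c by auto
  then show ?thesis using that PLG_mono g by blast
qed

text \<open>If \<open>g\<close> moves \<open>c\<close> upwards and \<open>h\<close> is a bump that starts at \<open>c\<close> and moves \<open>g c\<close>, then \<open>g\<close> does not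
  preserve the fixed point set of \<open>h\<close>.\<close>
lemma exists_noncommuting:
  assumes "x < y"
  obtains g h where "g \<in> PLG {x<..<y}" "h \<in> PLG {x<..<y}" "g \<circ> h \<noteq> h \<circ> g"
proof -
  obtain c where c: "c \<in> A" "x < c" "c < y" using A_dense[OF assms] by blast
  obtain g where g: "g \<in> PLG {x<..<y}" "c < g c" using exists_move_up[OF c(2,3)] by blast
  have "g c < y" using c PLG_mem[OF g(1), of c] by auto
  obtain h where h: "h \<in> PLG {c<..<y}" "g c < h (g c)"
    using exists_move_up_from[OF c(1) g(2) \<open>g c < y\<close>] by blast
  have "{c<..<y} \<subseteq> {x<..<y}" using c by auto
  then have "h \<in> PLG {x<..<y}" using PLG_mono h(1) by blast
  moreover have "h c = c" using PLG_outside[OF h(1)] by simp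
  then have "(g \<circ> h) c \<noteq> (h \<circ> g) c" using h(2) by simp
  then have "g \<circ> h \<noteq> h \<circ> g" by metis
  ultimately show ?thesis using that g(1) by blast
qed

definition reflect :: "real \<Rightarrow> (real \<Rightarrow> real) \<Rightarrow> real \<Rightarrow> real" where
  "reflect e g t = e - g (e - t)"

lemma reflect_reflect [simp]: "reflect e (reflect e g) = g"
  by (simp add: reflect_def fun_eq_iff)

lemma reflect_comp: "reflect e (f \<circ> g) = reflect e f \<circ> reflect e g"
  by (simp add: reflect_def fun_eq_iff)

lemma reflect_in_PLG:
  assumes g: "g \<in> PLG J" and e: "e \<in> A"
  shows "reflect e g \<in> PLG ((-) e ` J)"
proof -
  obtain S where S: "finite S" "S \<subseteq> A"
    "\<And>u v. u < v \<Longrightarrow> {u<..<v} \<inter> S = {} \<Longrightarrow> \<exists>m\<in>P. affine_on {u<..<v} m g"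
    using PLG_pieces[OF g] by blast
  have eA: "(-) e ` A = A"
  proof
    show "(-) e ` A \<subseteq> A" using A_diff[OF e] by auto
    show "A \<subseteq> (-) e ` A"
    proof
      fix a assume "a \<in> A"
      then show "a \<in> (-) e ` A" by (intro image_eqI[of _ _ "e - a"] A_diff e) auto
    qed
  qed
  show ?thesis
  proof (rule PLG_I[where S = "(-) e ` S"])
    show "strict_mono (reflect e g)"
      by (rule strict_monoI) (simp add: reflect_def PLG_less[OF g])
    show "surj (reflect e g)"
    proof (rule surjI)
      show "reflect e g (e - finv g (e - t)) = t" for t
        by (simp add: reflect_def PLG_apply_inv[OF g])
    qed
    have "reflect e g ` A = (-) e ` g ` (-) e ` A"
      by (simp add: image_image reflect_def)
    then show "reflect e g ` A = A" by (simp add: eA PLG_image[OF g])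
    show "reflect e g t = t" if "t \<notin> (-) e ` J" for t
    proof -
      have "e - t \<notin> J" using that by (metis diff_diff_eq2 add_diff_cancel_left' image_eqI)
      then show ?thesis by (simp add: reflect_def PLG_outside[OF g])
    qed
    show "finite ((-) e ` S)" using S(1) by simp
    show "(-) e ` S \<subseteq> A" using image_mono[OF S(2), of "(-) e"] eA by simp
    show "\<exists>m\<in>P. affine_on {u<..<v} m (reflect e g)"
      if uv: "u < v" "{u<..<v} \<inter> (-) e ` S = {}" for u v
    proof -
      have 1: "e - v < e - u" using uv by simp
      have 2: "{e - v<..<e - u} \<inter> S = {}"
      proof (rule ccontr)
        assume "{e - v<..<e - u} \<inter> S \<noteq> {}"
        then obtain s where "s \<in> S" "e - v < s" "s < e - u" by auto
        then have "e - s \<in> {u<..<v} \<inter> (-) e ` S" by auto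
        then show False using uv(2) by blast
      qed
      obtain m c where m: "m \<in> P" "\<forall>t\<in>{e - v<..<e - u}. g t = m * t + c"
        using S(3)[OF 1 2] unfolding affine_on_def by (elim bexE exE) (rule that)
      have "\<forall>t\<in>{u<..<v}. reflect e g t = m * t + (e - m * e - c)"
        using m(2) by (simp add: reflect_def algebra_simps)
      then show ?thesis unfolding affine_on_def using m(1) by blast
    qed
  qed
qed


section \<open>Germs at the left end\<close>

text \<open>The nonempty open intervals each of whose ends is infinite or a point of \<open>A\<close>. This phrasing makes
  finite and infinite ends amenable to the same arguments.\<close>
definition admissible :: "real set \<Rightarrow> bool" where
  "admissible J \<longleftrightarrow> J \<noteq> {} \<and>
     ((\<forall>t\<in>J. {..t} \<subseteq> J) \<or> (\<exists>l\<in>A. \<forall>t\<in>J. l < t \<and> {l<..t} \<subseteq> J)) \<and>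
     ((\<forall>t\<in>J. {t..} \<subseteq> J) \<or> (\<exists>r\<in>A. \<forall>t\<in>J. t < r \<and> {t..<r} \<subseteq> J))"

lemma admissible_between:
  assumes "admissible J" "x \<in> J" "y \<in> J" "x \<le> z" "z \<le> y" shows "z \<in> J"
proof -
  consider "{..y} \<subseteq> J" | l where "l < x" "{l<..y} \<subseteq> J"
    using assms(1-3) unfolding admissible_def by blast
  then show ?thesis using assms(4,5) by cases auto
qed

lemma admissible_min: "admissible J \<Longrightarrow> x \<in> J \<Longrightarrow> y \<in> J \<Longrightarrow> min x y \<in> J"
  and admissible_max: "admissible J \<Longrightarrow> x \<in> J \<Longrightarrow> y \<in> J \<Longrightarrow> max x y \<in> J"
  by (auto simp: min_def max_def)

lemma admissible_left:
  assumes "admissible J" "x \<in> J" obtains y where "y \<in> J" "y < x"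
proof -
  consider "{..x} \<subseteq> J" | l where "l < x" "{l<..x} \<subseteq> J"
    using assms unfolding admissible_def by blast
  then show ?thesis
  proof cases
    case 1
    have "x - 1 \<in> {..x}" by simp
    then show ?thesis using 1 that[of "x - 1"] by (metis subsetD diff_less_eq less_add_one)
  next
    case 2
    then have "(l + x) / 2 \<in> {l<..x}" "(l + x) / 2 < x" by auto
    then show ?thesis using 2 that[of "(l + x) / 2"] by (metis subsetD)
  qed
qed

lemma admissible_right:
  assumes "admissible J" "x \<in> J" obtains y where "y \<in> J" "x < y"
proof -
  consider "{x..} \<subseteq> J" | r where "x < r" "{x..<r} \<subseteq> J"
    using assms unfolding admissible_def by blast
  then show ?thesis
  proof cases
    case 1
    have "x + 1 \<in> {x..}" by simp
    then show ?thesis using 1 that[of "x + 1"] by (metis subsetD less_add_one)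
  next
    case 2
    then have "(x + r) / 2 \<in> {x..<r}" "x < (x + r) / 2" by auto
    then show ?thesis using 2 that[of "(x + r) / 2"] by (metis subsetD)
  qed
qed

lemma admissible_reflect:
  assumes "admissible J" "e \<in> A" shows "admissible ((-) e ` J)"
  unfolding admissible_def
proof (intro conjI)
  show "(-) e ` J \<noteq> {}" using assms(1) by (auto simp: admissible_def)
  have left: "(\<forall>t\<in>J. {t..} \<subseteq> J) \<or> (\<exists>r\<in>A. \<forall>t\<in>J. t < r \<and> {t..<r} \<subseteq> J)"
    and right: "(\<forall>t\<in>J. {..t} \<subseteq> J) \<or> (\<exists>l\<in>A. \<forall>t\<in>J. l < t \<and> {l<..t} \<subseteq> J)"
    using assms(1) unfolding admissible_def by blast+
  have img: "s \<in> (-) e ` J \<longleftrightarrow> e - s \<in> J" for s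
    by (auto simp: image_iff intro!: bexI[of _ "e - s"])
  from left show "(\<forall>t\<in>(-) e ` J. {..t} \<subseteq> (-) e ` J) \<or>
      (\<exists>l\<in>A. \<forall>t\<in>(-) e ` J. l < t \<and> {l<..t} \<subseteq> (-) e ` J)"
  proof
    assume *: "\<forall>t\<in>J. {t..} \<subseteq> J"
    have "s \<in> (-) e ` J" if "t \<in> J" "s \<le> e - t" for s t
    proof -
      have "e - s \<in> {t..}" using that(2) by simp
      then show ?thesis using * that(1) img by blast
    qed
    then have "\<forall>t\<in>(-) e ` J. {..t} \<subseteq> (-) e ` J" by (metis imageE subsetI atMost_iff)
    then show ?thesis ..
  next
    assume "\<exists>r\<in>A. \<forall>t\<in>J. t < r \<and> {t..<r} \<subseteq> J"
    then obtain r where r: "r \<in> A" "\<forall>t\<in>J. t < r \<and> {t..<r} \<subseteq> J" by blast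
    have "s \<in> (-) e ` J" if "t \<in> J" "s \<le> e - t" "e - r < s" for s t
    proof -
      have "e - s \<in> {t..<r}" using that by simp
      then show ?thesis using r that(1) img by blast
    qed
    then have "\<forall>t\<in>(-) e ` J. {e - r<..t} \<subseteq> (-) e ` J"
      by (metis imageE subsetI greaterThanAtMost_iff)
    moreover have "\<forall>t\<in>(-) e ` J. e - r < t" using r(2) by auto
    ultimately have "\<forall>t\<in>(-) e ` J. e - r < t \<and> {e - r<..t} \<subseteq> (-) e ` J" by blast
    then show ?thesis using A_diff[OF assms(2) r(1)] by blast
  qed
  from right show "(\<forall>t\<in>(-) e ` J. {t..} \<subseteq> (-) e ` J) \<or>
      (\<exists>r\<in>A. \<forall>t\<in>(-) e ` J. t < r \<and> {t..<r} \<subseteq> (-) e ` J)"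
  proof
    assume *: "\<forall>t\<in>J. {..t} \<subseteq> J"
    have "s \<in> (-) e ` J" if "t \<in> J" "e - t \<le> s" for s t
    proof -
      have "e - s \<in> {..t}" using that(2) by simp
      then show ?thesis using * that(1) img by blast
    qed
    then have "\<forall>t\<in>(-) e ` J. {t..} \<subseteq> (-) e ` J" by (metis imageE subsetI atLeast_iff)
    then show ?thesis ..
  next
    assume "\<exists>l\<in>A. \<forall>t\<in>J. l < t \<and> {l<..t} \<subseteq> J"
    then obtain l where l: "l \<in> A" "\<forall>t\<in>J. l < t \<and> {l<..t} \<subseteq> J" by blast
    have mem: "s \<in> (-) e ` J" if "t \<in> J" "e - t \<le> s" "s < e - l" for s t
    proof -
      have "e - s \<in> {l<..t}" using that by simp
      then show ?thesis using l that(1) img by blast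
    qed
    then have "\<forall>t\<in>(-) e ` J. {t..<e - l} \<subseteq> (-) e ` J"
    proof (intro ballI subsetI)
      fix t s assume "t \<in> (-) e ` J" "s \<in> {t..<e - l}"
      then show "s \<in> (-) e ` J" using mem[of "e - t" s] img[of t] by simp
    qed
    moreover have "\<forall>t\<in>(-) e ` J. t < e - l" using l(2) by auto
    ultimately have "\<forall>t\<in>(-) e ` J. t < e - l \<and> {t..<e - l} \<subseteq> (-) e ` J" by blast
    then show ?thesis using A_diff[OF assms(2) l(1)] by blast
  qed
qed

text \<open>Near the left end an element is given by \<open>m * t + c\<close>. At a finite end this is the usual right-hand
  germ, and at minus infinity the germ at infinity.\<close>
definition left_germ :: "real set \<Rightarrow> (real \<Rightarrow> real) \<Rightarrow> real \<Rightarrow> real \<Rightarrow> bool" where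
  "left_germ J g m c \<longleftrightarrow> (\<exists>y\<in>J. \<forall>t\<in>J. t < y \<longrightarrow> g t = m * t + c)"

text \<open>To the left of all exceptional points the pieces overlap pairwise, hence they are given by one and
  the same affine map.\<close>
lemma left_germ_exists:
  assumes J: "admissible J" and g: "g \<in> PLG J'"
  obtains m c where "m \<in> P" "left_germ J g m c"
proof -
  obtain S where S: "finite S" "S \<subseteq> A"
    "\<And>u v. u < v \<Longrightarrow> {u<..<v} \<inter> S = {} \<Longrightarrow> \<exists>m\<in>P. affine_on {u<..<v} m g"
    using PLG_pieces[OF g] by blast
  have "\<exists>y\<in>J. \<forall>s\<in>J \<inter> S. y \<le> s"
  proof (cases "J \<inter> S = {}")
    case True then show ?thesis using J unfolding admissible_def by blast
  next
    case False
    have "finite (J \<inter> S)" using S(1) by simp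
    then show ?thesis using False Min_in Min_le by (metis Int_iff)
  qed
  then obtain y where y: "y \<in> J" "\<forall>s\<in>J \<inter> S. y \<le> s" by blast
  have avoid: "{u<..<y} \<inter> S = {}" if "u \<in> J" for u
  proof (rule ccontr)
    assume "{u<..<y} \<inter> S \<noteq> {}"
    then obtain s where s: "s \<in> S" "u < s" "s < y" by auto
    then have "s \<in> J" using admissible_between[OF J that y(1)] by simp
    then show False using y(2) s by force
  qed
  obtain x where x: "x \<in> J" "x < y" using admissible_left[OF J y(1)] by blast
  obtain m c where m: "m \<in> P" "\<forall>t\<in>{x<..<y}. g t = m * t + c"
    using S(3)[OF x(2) avoid[OF x(1)]] unfolding affine_on_def by (elim bexE exE) (rule that)
  have "g t = m * t + c" if t: "t \<in> J" "t < y" for t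
  proof -
    obtain u where u: "u \<in> J" "u < min t x"
      using admissible_left[OF J admissible_min[OF J t(1) x(1)]] by blast
    then have "u < y" using t by simp
    obtain m' c' where m': "m' \<in> P" "\<forall>t\<in>{u<..<y}. g t = m' * t + c'"
      using S(3)[OF \<open>u < y\<close> avoid[OF u(1)]] unfolding affine_on_def by (elim bexE exE) (rule that)
    have "{x<..<y} \<subseteq> {u<..<y}" using u by auto
    from affine_on_interval_unique[OF x(2) \<open>u < y\<close> this m(2) m'(2)]
    show ?thesis using m'(2) t u by simp
  qed
  then show ?thesis using that[OF m(1)] y(1) unfolding left_germ_def by blast
qed

lemma left_germ_unique:
  assumes J: "admissible J" and "left_germ J g m c" "left_germ J g m' c'"
  shows "m = m'" "c = c'"
proof -
  obtain y where y: "y \<in> J" "\<forall>t\<in>J. t < y \<longrightarrow> g t = m * t + c"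
    using assms(2) unfolding left_germ_def by blast
  obtain y' where y': "y' \<in> J" "\<forall>t\<in>J. t < y' \<longrightarrow> g t = m' * t + c'"
    using assms(3) unfolding left_germ_def by blast
  obtain s where s: "s \<in> J" "s < min y y'"
    using admissible_left[OF J admissible_min[OF J y(1) y'(1)]] by blast
  obtain t where t: "t \<in> J" "t < s" using admissible_left[OF J s(1)] by blast
  have e: "m * s + c = m' * s + c'" "m * t + c = m' * t + c'"
    using y(2) y'(2) s t by (metis min_less_iff_conj order_less_trans)+
  then have "(m - m') * (s - t) = 0" by (simp add: algebra_simps)
  then show "m = m'" using t(2) by simp
  then show "c = c'" using e by simp
qed

lemma left_germ_comp:
  assumes J: "admissible J" and f: "f \<in> PLG J" and g: "g \<in> PLG J"
    and "left_germ J f m c" "left_germ J g m' c'"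
  shows "left_germ J (f \<circ> g) (m * m') (m * c' + c)"
proof -
  obtain y where y: "y \<in> J" "\<forall>t\<in>J. t < y \<longrightarrow> f t = m * t + c"
    using assms(4) unfolding left_germ_def by blast
  obtain y' where y': "y' \<in> J" "\<forall>t\<in>J. t < y' \<longrightarrow> g t = m' * t + c'"
    using assms(5) unfolding left_germ_def by blast
  have "finv g y \<in> J" using PLG_mem[OF PLG_inv[OF g]] y(1) by blast
  then have "min y' (finv g y) \<in> J" using admissible_min[OF J y'(1)] by blast
  moreover have "(f \<circ> g) t = m * m' * t + (m * c' + c)" if t: "t \<in> J" "t < min y' (finv g y)" for t
  proof -
    have "g t < y" using t(2) PLG_less[OF g, of t "finv g y"] by (simp add: PLG_apply_inv[OF g])
    moreover have "g t \<in> J" using PLG_mem[OF g] t(1) by blast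
    ultimately show ?thesis using y(2) y'(2) t by (simp add: algebra_simps)
  qed
  ultimately show ?thesis unfolding left_germ_def by blast
qed

lemma left_germ_id: "admissible J \<Longrightarrow> left_germ J id 1 0"
  unfolding left_germ_def admissible_def by auto

definition left_slope :: "real set \<Rightarrow> (real \<Rightarrow> real) \<Rightarrow> real" where
  "left_slope J g = (THE m. \<exists>c. left_germ J g m c)"

lemma left_slope_eq:
  assumes "admissible J" "left_germ J g m c" shows "left_slope J g = m"
  unfolding left_slope_def using assms left_germ_unique(1)[OF assms(1)] by blast

lemma left_slope_in_P:
  assumes "admissible J" "g \<in> PLG J" shows "left_slope J g \<in> P"
proof -
  obtain m c where "m \<in> P" "left_germ J g m c" by (rule left_germ_exists[OF assms])
  then show ?thesis using left_slope_eq[OF assms(1)] by blast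
qed

lemma left_germ_left_slope:
  assumes "admissible J" "g \<in> PLG J" obtains c where "left_germ J g (left_slope J g) c"
proof -
  obtain m c where "left_germ J g m c" by (rule left_germ_exists[OF assms])
  then show ?thesis using left_slope_eq[OF assms(1)] that by blast
qed

lemma left_slope_comp:
  assumes J: "admissible J" and f: "f \<in> PLG J" and g: "g \<in> PLG J"
  shows "left_slope J (f \<circ> g) = left_slope J f * left_slope J g"
proof -
  obtain c where "left_germ J f (left_slope J f) c" by (rule left_germ_left_slope[OF J f])
  moreover obtain d where "left_germ J g (left_slope J g) d" by (rule left_germ_left_slope[OF J g])
  ultimately show ?thesis using left_slope_eq[OF J] left_germ_comp[OF J f g] by blast
qed

section \<open>Elements that are the identity near an end\<close>
definition left_kernel :: "real set \<Rightarrow> (real \<Rightarrow> real) set" where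
  "left_kernel J = {g \<in> PLG J. \<exists>y\<in>J. \<forall>t\<le>y. g t = t}"

definition right_kernel :: "real set \<Rightarrow> (real \<Rightarrow> real) set" where
  "right_kernel J = {g \<in> PLG J. \<exists>y\<in>J. \<forall>t\<ge>y. g t = t}"

lemma left_kernel_PLG: "g \<in> left_kernel J \<Longrightarrow> g \<in> PLG J" and right_kernel_PLG: "g \<in> right_kernel J \<Longrightarrow> g \<in> PLG J"
  by (auto simp: left_kernel_def right_kernel_def)

lemma left_kernel_iff_left_germ:
  assumes J: "admissible J" and g: "g \<in> PLG J"
  shows "g \<in> left_kernel J \<longleftrightarrow> left_germ J g 1 0"
proof
  assume "g \<in> left_kernel J" then show "left_germ J g 1 0" unfolding left_kernel_def left_germ_def by (auto intro: less_imp_le)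
next
  assume "left_germ J g 1 0"
  then obtain y where y: "y \<in> J" "\<forall>t\<in>J. t < y \<longrightarrow> g t = 1 * t + 0"
    unfolding left_germ_def by blast
  obtain x where x: "x \<in> J" "x < y" using admissible_left[OF J y(1)] by blast
  have "g t = t" if "t \<le> x" for t
    using y(2) x PLG_outside[OF g, of t] that by (cases "t \<in> J") auto
  then show "g \<in> left_kernel J" using g x(1) unfolding left_kernel_def by blast
qed

lemma left_kernel_comp:
  assumes J: "admissible J" and "f \<in> left_kernel J" "g \<in> left_kernel J" shows "f \<circ> g \<in> left_kernel J"
proof -
  have "left_germ J (f \<circ> g) (1 * 1) (1 * 0 + 0)"
    using assms by (intro left_germ_comp J) (auto simp: left_kernel_PLG left_kernel_iff_left_germ[symmetric])
  then show ?thesis using left_kernel_iff_left_germ[OF J PLG_comp] assms left_kernel_PLG by simp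
qed

lemma left_kernel_inv:
  assumes "f \<in> left_kernel J" shows "finv f \<in> left_kernel J"
proof -
  obtain y where "y \<in> J" "\<forall>t\<le>y. f t = t" using assms unfolding left_kernel_def by blast
  moreover from this have "\<forall>t\<le>y. finv f t = t"
    using PLG_inv_apply[OF left_kernel_PLG[OF assms]] by metis
  ultimately show ?thesis using PLG_inv[OF left_kernel_PLG[OF assms]] unfolding left_kernel_def by blast
qed

text \<open>Elements with the same germ differ by an element of the left kernel. An automorphism that preserves
  the left kernel therefore acts on germs (see \<open>auto_same_left_germ\<close>).\<close>
lemma same_left_germ:
  assumes J: "admissible J" and f: "f \<in> PLG J" and g: "g \<in> PLG J"
    and "left_germ J f m c" "left_germ J g m c"
  shows "finv g \<circ> f \<in> left_kernel J"
proof -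
  obtain y where y: "y \<in> J" "\<forall>t\<in>J. t < y \<longrightarrow> f t = m * t + c"
    using assms(4) unfolding left_germ_def by blast
  obtain y' where y': "y' \<in> J" "\<forall>t\<in>J. t < y' \<longrightarrow> g t = m * t + c"
    using assms(5) unfolding left_germ_def by blast
  have "(finv g \<circ> f) t = 1 * t + 0" if "t \<in> J" "t < min y y'" for t
  proof -
    have "f t = g t" using that y y' by simp
    then show ?thesis by (simp add: PLG_inv_apply[OF g])
  qed
  then have "left_germ J (finv g \<circ> f) 1 0"
    using admissible_min[OF J y(1) y'(1)] unfolding left_germ_def by blast
  then show ?thesis using left_kernel_iff_left_germ[OF J PLG_comp[OF PLG_inv[OF g] f]] by blast
qed

lemma reflect_PLG_iff:
  assumes "e \<in> A" shows "reflect e g \<in> PLG ((-) e ` J) \<longleftrightarrow> g \<in> PLG J"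
  using reflect_in_PLG[OF _ assms, of g J] reflect_in_PLG[OF _ assms, of "reflect e g" "(-) e ` J"]
  by (auto simp: image_image)

lemma reflect_left_kernel_iff:
  assumes e: "e \<in> A" shows "reflect e g \<in> left_kernel ((-) e ` J) \<longleftrightarrow> g \<in> right_kernel J"
proof -
  have "(\<forall>t\<le>e - x. reflect e g t = t) \<longleftrightarrow> (\<forall>s\<ge>x. g s = s)" for x
  proof
    assume *: "\<forall>t\<le>e - x. reflect e g t = t"
    show "\<forall>s\<ge>x. g s = s"
    proof (intro allI impI)
      fix s assume "x \<le> s"
      then have "reflect e g (e - s) = e - s" using * by simp
      then show "g s = s" by (simp add: reflect_def)
    qed
  qed (simp add: reflect_def)
  then show ?thesis unfolding left_kernel_def right_kernel_def by (simp add: reflect_PLG_iff[OF e])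
qed

lemma reflect_right_kernel_iff:
  assumes "e \<in> A" shows "reflect e g \<in> right_kernel ((-) e ` J) \<longleftrightarrow> g \<in> left_kernel J"
  using reflect_left_kernel_iff[OF assms, of "reflect e g" "(-) e ` J"] by (simp add: image_image)

lemma right_kernel_comp:
  assumes J: "admissible J" and "f \<in> right_kernel J" "g \<in> right_kernel J" shows "f \<circ> g \<in> right_kernel J"
proof -
  obtain x where x: "x \<in> J" "\<forall>t\<ge>x. f t = t" using assms(2) unfolding right_kernel_def by blast
  obtain y where y: "y \<in> J" "\<forall>t\<ge>y. g t = t" using assms(3) unfolding right_kernel_def by blast
  have "max x y \<in> J" by (rule admissible_max[OF J x(1) y(1)])
  moreover have "\<forall>t\<ge>max x y. (f \<circ> g) t = t" using x(2) y(2) by simp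
  ultimately show ?thesis
    unfolding right_kernel_def using PLG_comp[OF right_kernel_PLG[OF assms(2)] right_kernel_PLG[OF assms(3)]] by blast
qed

lemma right_kernel_inv:
  assumes "f \<in> right_kernel J" shows "finv f \<in> right_kernel J"
proof -
  obtain y where "y \<in> J" "\<forall>t\<ge>y. f t = t" using assms unfolding right_kernel_def by blast
  moreover from this have "\<forall>t\<ge>y. finv f t = t"
    using PLG_inv_apply[OF right_kernel_PLG[OF assms]] by metis
  ultimately show ?thesis using PLG_inv[OF right_kernel_PLG[OF assms]] unfolding right_kernel_def by blast
qed

lemma commute_inv:
  assumes "k \<in> PLG J" "f \<circ> k = k \<circ> f" shows "f \<circ> finv k = finv k \<circ> f"
proof
  fix t
  have "f (k (finv k t)) = k (f (finv k t))" using assms(2) by (metis comp_apply)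
  then show "(f \<circ> finv k) t = (finv k \<circ> f) t"
    by (simp add: PLG_apply_inv[OF assms(1)] PLG_inv_apply[OF assms(1)])
qed

lemma commute_comp: "f \<circ> g = g \<circ> f \<Longrightarrow> f \<circ> h = h \<circ> f \<Longrightarrow> f \<circ> (g \<circ> h) = (g \<circ> h) \<circ> f"
  by (simp add: fun_eq_iff)

section \<open>Centralizers near an end\<close>

text \<open>An affine germ other than the identity has at most one fixed point, so \<open>f\<close> has no fixed point to the
  left of some \<open>x\<close>. The support of an element \<open>k\<close> that commutes with \<open>f\<close> is invariant under \<open>f\<close> and its
  inverse. If it met the region left of \<open>x\<close>, its infimum there could be moved further down by \<open>f\<close> or
  by its inverse.\<close>
lemma commuting_left_rigid:
  assumes J: "admissible J" and f: "f \<in> PLG J" "f \<notin> left_kernel J"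
  obtains x where "x \<in> J" "\<forall>k\<in>left_kernel J. f \<circ> k = k \<circ> f \<longrightarrow> (\<forall>t\<le>x. k t = t)"
proof -
  obtain m c where germ: "left_germ J f m c" by (rule left_germ_exists[OF J f(1)])
  then obtain y where y: "y \<in> J" "\<forall>t\<in>J. t < y \<longrightarrow> f t = m * t + c"
    unfolding left_germ_def by blast
  have nontrivial: "\<not> (m = 1 \<and> c = 0)" using f germ left_kernel_iff_left_germ[OF J] by blast
  define s where "s = c / (1 - m)"
  obtain x where x: "x \<in> J" "x < y" "s \<in> J \<Longrightarrow> x < s"
  proof (cases "s \<in> J")
    case True
    then show ?thesis
      using admissible_left[OF J admissible_min[OF J y(1) True]] that by auto
  next
    case False
    then show ?thesis using admissible_left[OF J y(1)] that by blast
  qed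
  have moves: "f t \<noteq> t" if t: "t \<in> J" "t \<le> x" for t
  proof
    assume "f t = t"
    then have "m * t + c = t" using y(2) t x by simp
    then have "c = (1 - m) * t" by (simp add: algebra_simps)
    then have "t = s" using nontrivial by (auto simp: s_def)
    then show False using t x by simp
  qed
  have "k t0 = t0" if k: "k \<in> left_kernel J" "f \<circ> k = k \<circ> f" and t0: "t0 \<le> x" for k t0
  proof (rule ccontr)
    assume "k t0 \<noteq> t0"
    define F where "F = {t. t \<le> x \<and> k t \<noteq> t}"
    define z where "z = Inf F"
    obtain u where u: "u \<in> J" "\<forall>t\<le>u. k t = t" using k(1) unfolding left_kernel_def by blast
    have "t0 \<in> F" using t0 \<open>k t0 \<noteq> t0\<close> by (simp add: F_def)
    have lower: "u \<le> t" if "t \<in> F" for t using that u(2) unfolding F_def mem_Collect_eq by (meson linear)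
    then have bdd: "bdd_below F" by (rule bdd_belowI)
    have "u \<le> z" unfolding z_def using \<open>t0 \<in> F\<close> lower by (intro cInf_greatest) auto
    have "z \<le> t0" unfolding z_def using \<open>t0 \<in> F\<close> bdd by (rule cInf_lower)
    then have "z \<le> x" using t0 by simp
    have "z \<in> J" using admissible_between[OF J u(1) x(1) \<open>u \<le> z\<close> \<open>z \<le> x\<close>] .
    have no_descent: False if g: "g \<in> PLG J" "g \<circ> k = k \<circ> g" "g z < z" for g
    proof -
      have "z < finv g z" using g(3) PLG_less[OF g(1), of z "finv g z"] by (simp add: PLG_apply_inv[OF g(1)])
      then obtain t where t: "t \<in> F" "t < finv g z"
        using cInf_lessD[of F] \<open>t0 \<in> F\<close> unfolding z_def by blast
      have "g t < z" using t(2) PLG_less[OF g(1), of t "finv g z"] by (simp add: PLG_apply_inv[OF g(1)])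
      have "k (g t) = g (k t)" using g(2) by (metis comp_apply)
      then have "k (g t) \<noteq> g t" using t(1) PLG_eq[OF g(1)] by (simp add: F_def)
      then have "g t \<in> F" using \<open>g t < z\<close> \<open>z \<le> x\<close> by (simp add: F_def)
      then have "z \<le> g t" unfolding z_def using bdd by (rule cInf_lower)
      then show False using \<open>g t < z\<close> by simp
    qed
    have "f z \<noteq> z" using moves \<open>z \<in> J\<close> \<open>z \<le> x\<close> by blast
    then consider "f z < z" | "z < f z" by linarith
    then show False
    proof cases
      case 1 then show False using no_descent[OF f(1) k(2)] by blast
    next
      case 2
      have "finv f z < z" using 2 PLG_less[OF f(1), of "finv f z" z] by (simp add: PLG_apply_inv[OF f(1)])
      moreover have "finv f \<circ> k = k \<circ> finv f"
        using commute_inv[OF f(1)] k(2) by simp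
      ultimately show False using no_descent[OF PLG_inv[OF f(1)]] by blast
    qed
  qed
  then show ?thesis using that x(1) by blast
qed

text \<open>Affine maps that commute with a given nontrivial affine map commute with each other. So commutators
  of elements of the centralizer of \<open>f\<close> have trivial germ, and \<open>commuting_left_rigid\<close> applies to them.\<close>
lemma centralizer_commutes_left:
  assumes J: "admissible J" and f: "f \<in> PLG J" "f \<notin> left_kernel J"
  obtains x where "x \<in> J" "\<forall>k\<in>PLG J. \<forall>k'\<in>PLG J. f \<circ> k = k \<circ> f \<longrightarrow> f \<circ> k' = k' \<circ> f \<longrightarrow>
    (\<forall>t\<le>x. k (k' t) = k' (k t))"
proof -
  obtain m c where germ: "left_germ J f m c" by (rule left_germ_exists[OF J f(1)])
  have nontrivial: "\<not> (m = 1 \<and> c = 0)" using f germ left_kernel_iff_left_germ[OF J] by blast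
  have parallel: "(m - 1) * d = (n - 1) * c"
    if k: "k \<in> PLG J" "f \<circ> k = k \<circ> f" "left_germ J k n d" for k n d
  proof -
    have "m * d + c = n * c + d"
      using left_germ_unique(2)[OF J left_germ_comp[OF J f(1) k(1) germ k(3)]]
        left_germ_comp[OF J k(1) f(1) k(3) germ] k(2) by simp
    then show ?thesis by (simp add: algebra_simps)
  qed
  obtain x where x: "x \<in> J" "\<forall>k\<in>left_kernel J. f \<circ> k = k \<circ> f \<longrightarrow> (\<forall>t\<le>x. k t = t)"
    by (rule commuting_left_rigid[OF J f])
  have "k (k' t) = k' (k t)"
    if k: "k \<in> PLG J" "f \<circ> k = k \<circ> f" and k': "k' \<in> PLG J" "f \<circ> k' = k' \<circ> f" and t: "t \<le> x" for k k' t
  proof -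
    obtain n d where germ_k: "left_germ J k n d" by (rule left_germ_exists[OF J k(1)])
    obtain n' d' where germ_k': "left_germ J k' n' d'" by (rule left_germ_exists[OF J k'(1)])
    have 1: "(m - 1) * d = (n - 1) * c" by (rule parallel[OF k germ_k])
    have 2: "(m - 1) * d' = (n' - 1) * c" by (rule parallel[OF k' germ_k'])
    have "(n - 1) * d' = (n' - 1) * d"
    proof (cases "m = 1")
      case True
      then have "n = 1" "n' = 1" using 1 2 nontrivial by auto
      then show ?thesis by simp
    next
      case False
      have "(m - 1) * ((n - 1) * d') = (n - 1) * ((n' - 1) * c)" using 2 by (metis mult.left_commute)
      also have "\<dots> = (m - 1) * ((n' - 1) * d)" using 1 by (metis mult.left_commute)
      finally show ?thesis using False by simp
    qed
    then have e: "n * d' + d = n' * d + d'" by (simp add: algebra_simps)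
    have kk': "k \<circ> k' \<in> PLG J" "k' \<circ> k \<in> PLG J" using PLG_comp k(1) k'(1) by blast+
    have "left_germ J (k \<circ> k') (n * n') (n * d' + d)"
      by (rule left_germ_comp[OF J k(1) k'(1) germ_k germ_k'])
    moreover have "left_germ J (k' \<circ> k) (n * n') (n * d' + d)"
      using left_germ_comp[OF J k'(1) k(1) germ_k' germ_k] unfolding e by (simp add: mult.commute)
    ultimately have q: "finv (k' \<circ> k) \<circ> (k \<circ> k') \<in> left_kernel J"
      using same_left_germ[OF J kk'] by blast
    have "f \<circ> (finv (k' \<circ> k) \<circ> (k \<circ> k')) = finv (k' \<circ> k) \<circ> (k \<circ> k') \<circ> f"
      by (intro commute_comp commute_inv[OF kk'(2)] k(2) k'(2))
    then have "(finv (k' \<circ> k) \<circ> (k \<circ> k')) t = t" using x(2) q t by blast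
    then show ?thesis using PLG_apply_inv[OF kk'(2)] by (metis comp_apply)
  qed
  then show ?thesis using that[OF x(1)] by blast
qed

lemma centralizer_commutes_right:
  assumes J: "admissible J" and f: "f \<in> PLG J" "f \<notin> right_kernel J"
  obtains x where "x \<in> J" "\<forall>k\<in>PLG J. \<forall>k'\<in>PLG J. f \<circ> k = k \<circ> f \<longrightarrow> f \<circ> k' = k' \<circ> f \<longrightarrow>
    (\<forall>t\<ge>x. k (k' t) = k' (k t))"
proof -
  let ?r = "reflect 0" and ?J = "(-) 0 ` J"
  have J': "admissible ?J" by (rule admissible_reflect[OF J A_zero])
  have f': "?r f \<in> PLG ?J" "?r f \<notin> left_kernel ?J"
    using f by (simp_all only: reflect_PLG_iff[OF A_zero] reflect_left_kernel_iff[OF A_zero] not_False_eq_True)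
  obtain x where x: "x \<in> ?J" "\<forall>k\<in>PLG ?J. \<forall>k'\<in>PLG ?J. ?r f \<circ> k = k \<circ> ?r f \<longrightarrow> ?r f \<circ> k' = k' \<circ> ?r f \<longrightarrow>
    (\<forall>t\<le>x. k (k' t) = k' (k t))"
    by (rule centralizer_commutes_left[OF J' f'])
  have "- x \<in> J" using x(1) by auto
  moreover have "k (k' t) = k' (k t)"
    if "k \<in> PLG J" "k' \<in> PLG J" "f \<circ> k = k \<circ> f" "f \<circ> k' = k' \<circ> f" "- x \<le> t" for k k' t
  proof -
    have "?r k (?r k' (- t)) = ?r k' (?r k (- t))"
      using x(2) that reflect_PLG_iff[OF A_zero] by (simp only: reflect_comp[symmetric])
    then show ?thesis by (simp add: reflect_def)
  qed
  ultimately show ?thesis using that by blast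
qed


lemma PLG_window:
  assumes "admissible J" "x \<in> J" "y \<in> J" "g \<in> PLG {x<..<y}" shows "g \<in> PLG J"
proof -
  have "{x<..<y} \<subseteq> J" using admissible_between[OF assms(1-3)] by auto
  then show ?thesis using PLG_mono assms(4) by blast
qed

lemma exists_move_up_in:
  assumes "admissible J" "x \<in> J" obtains g where "g \<in> PLG J" "x < g x"
proof -
  obtain a where a: "a \<in> J" "a < x" using admissible_left[OF assms] by blast
  obtain b where b: "b \<in> J" "x < b" using admissible_right[OF assms] by blast
  obtain g where "g \<in> PLG {a<..<b}" "x < g x" using exists_move_up[OF a(2) b(2)] by blast
  then show ?thesis using that PLG_window[OF assms(1) a(1) b(1)] by blast
qed

section \<open>An algebraic description of the two kernels\<close>

text \<open>The supremum of the orbit of \<open>x\<close> would be a point of \<open>J\<close> that no element moves upwards.\<close>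
lemma exists_move_far:
  assumes J: "admissible J" and x: "x \<in> J" and y: "y \<in> J"
  shows "\<exists>h\<in>PLG J. y \<le> h x"
proof (rule ccontr)
  assume no: "\<not> (\<exists>h\<in>PLG J. y \<le> h x)"
  define Orbit where "Orbit = (\<lambda>h. h x) ` PLG J"
  define z where "z = Sup Orbit"
  have below: "h x < y" if "h \<in> PLG J" for h using no that by force
  have bdd: "bdd_above Orbit" using below by (intro bdd_aboveI[of _ y]) (force simp: Orbit_def)
  have "x \<in> Orbit" unfolding Orbit_def using PLG_id by (intro image_eqI[of _ _ id]) auto
  have "x \<le> z" unfolding z_def using \<open>x \<in> Orbit\<close> bdd by (rule cSup_upper)
  have "z \<le> y" unfolding z_def using \<open>x \<in> Orbit\<close> below by (intro cSup_least) (force simp: Orbit_def)+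
  have "z \<in> J" using admissible_between[OF J x y \<open>x \<le> z\<close> \<open>z \<le> y\<close>] .
  then obtain g where g: "g \<in> PLG J" "z < g z" using exists_move_up_in[OF J] by blast
  have "finv g z < z" using g(2) PLG_less[OF g(1), of "finv g z" z] by (simp add: PLG_apply_inv[OF g(1)])
  then obtain s where "s \<in> Orbit" "finv g z < s"
    using less_cSupD[of Orbit "finv g z"] \<open>x \<in> Orbit\<close> unfolding z_def by blast
  then obtain h where h: "h \<in> PLG J" "finv g z < h x" by (auto simp: Orbit_def)
  have "z < g (h x)" using h(2) PLG_less[OF g(1), of "finv g z" "h x"] by (simp add: PLG_apply_inv[OF g(1)])
  moreover have "g (h x) \<in> Orbit" unfolding Orbit_def using PLG_comp[OF g(1) h(1)] by (intro image_eqI[of _ _ "g \<circ> h"]) auto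
  then have "g (h x) \<le> z" unfolding z_def using bdd by (rule cSup_upper)
  ultimately show False by simp
qed

lemma left_germ_inv:
  assumes J: "admissible J" and f: "f \<in> PLG J" "left_germ J f p c" obtains d where "left_germ J (finv f) (1 / p) d"
proof -
  obtain m d where m: "m \<in> P" "left_germ J (finv f) m d" by (rule left_germ_exists[OF J PLG_inv[OF f(1)]])
  have "left_germ J id (m * p) (m * c + d)"
    using left_germ_comp[OF J PLG_inv[OF f(1)] f(1) m(2) f(2)] by (simp add: PLG_inv_comp[OF f(1)])
  then have "m * p = 1" using left_germ_unique(1)[OF J left_germ_id[OF J]] by metis
  then have "m = 1 / p" by (metis nonzero_eq_divide_eq mult_zero_right zero_neq_one)
  then show ?thesis using that m(2) by blast
qed

text \<open>At an infinite end this is a reflected kink, at a finite end a bump that starts at the end. That the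
  element can be the identity from \<open>y\<close> on makes the slopes at the two ends independent.\<close>
lemma exists_left_slope:
  assumes J: "admissible J" and y: "y \<in> J" and p: "p \<in> P"
  obtains f c where "f \<in> PLG J" "left_germ J f p c" "\<forall>t\<ge>y. f t = t"
proof -
  consider (unbounded) "\<forall>t\<in>J. {..t} \<subseteq> J" | (bounded) l where "l \<in> A" "\<forall>t\<in>J. l < t \<and> {l<..t} \<subseteq> J"
    using J unfolding admissible_def by blast
  then show ?thesis
  proof cases
    case unbounded
    obtain c where c: "c \<in> A" "y - 1 < c" "c < y" using A_dense[of "y - 1" y] by auto
    have "c \<in> {..y}" using c by simp
    then have "c \<in> J" using unbounded y by blast
    have "kink (- c) p \<in> PLG {- c<..}" by (intro kink_in_PLG A_uminus c p) simp
    then have "reflect 0 (kink (- c) p) \<in> PLG ((-) 0 ` {- c<..})" by (intro reflect_in_PLG A_zero)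
    moreover have "(-) 0 ` {- c<..} \<subseteq> J"
    proof
      fix t assume "t \<in> (-) 0 ` {- c<..}"
      then have "t \<in> {..c}" by auto
      then show "t \<in> J" using unbounded \<open>c \<in> J\<close> by blast
    qed
    ultimately have f: "reflect 0 (kink (- c) p) \<in> PLG J" using PLG_mono by blast
    have "\<forall>t\<in>J. t < c \<longrightarrow> reflect 0 (kink (- c) p) t = p * t + (c - p * c)"
      by (auto simp: reflect_def kink_right algebra_simps)
    then have germ: "left_germ J (reflect 0 (kink (- c) p)) p (c - p * c)"
      using \<open>c \<in> J\<close> unfolding left_germ_def by blast
    have "\<forall>t\<ge>y. reflect 0 (kink (- c) p) t = t"
      using c by (auto simp: reflect_def kink_left)
    then show ?thesis using that f germ by blast
  next
    case bounded
    have large: thesis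
      if q: "q \<in> P" "1 < q" and use: "\<And>f c. f \<in> PLG J \<Longrightarrow> left_germ J f q c \<Longrightarrow> \<forall>t\<ge>y. f t = t \<Longrightarrow> thesis" for q
    proof -
      have "0 < (y - l) / (1 + q)" using bounded(2) y q by simp
      then obtain a where a: "a \<in> A" "0 < a" "a < (y - l) / (1 + q)" by (rule A_dense)
      then have *: "l + a + 0 + q * a < y" using q by (simp add: field_simps)
      moreover have "0 < q * a" using a q by simp
      ultimately have "l + a < y" by linarith
      have "{l<..y} \<subseteq> J" using bounded(2) y by blast
      have win: "{l<..<l + a + 0 + q * a} \<subseteq> J" using * \<open>{l<..y} \<subseteq> J\<close> by (meson greaterThanAtMost_iff greaterThanLessThan_iff less_imp_le order_less_trans subset_iff)
      have f: "bump l q a 0 \<in> PLG J"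
        by (rule bump_in_PLG[OF bounded(1) q a(1,2) A_zero _ win]) simp
      have "l + a \<in> {l<..y}" using a \<open>l + a < y\<close> by simp
      then have "l + a \<in> J" using \<open>{l<..y} \<subseteq> J\<close> by blast
      have "bump l q a 0 t = q * t + (l - q * l)" if "t \<in> J" "t < l + a" for t
      proof -
        have "l < t" using bounded(2) that(1) by blast
        then show ?thesis using bump_expanding[OF q(2) a(2), of 0 l t] that(2) by (simp add: algebra_simps)
      qed
      then have "left_germ J (bump l q a 0) q (l - q * l)"
        using \<open>l + a \<in> J\<close> unfolding left_germ_def by blast
      moreover have "\<forall>t\<ge>y. bump l q a 0 t = t" using bump_right[OF q(2) a(2), of 0 l] * by simp
      ultimately show thesis using use f by blast
    qed
    consider "1 < p" | "p = 1" | "p < 1" by linarith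
    then show ?thesis
    proof cases
      case 1 then show ?thesis using large[OF p] that by blast
    next
      case 2 then show ?thesis using that[of id 0] PLG_id left_germ_id[OF J] by simp
    next
      case 3
      then have q: "1 < 1 / p" using P_pos[OF p] by (simp add: field_simps)
      show ?thesis
      proof (rule large[OF P_inverse[OF p] q])
        fix f c assume f: "f \<in> PLG J" "left_germ J f (1 / p) c" "\<forall>t\<ge>y. f t = t"
        obtain d where "left_germ J (finv f) (1 / (1 / p)) d" by (rule left_germ_inv[OF J f(1,2)])
        then have "left_germ J (finv f) p d" by simp
        moreover have "\<forall>t\<ge>y. finv f t = t" using f(3) PLG_inv_apply[OF f(1)] by metis
        ultimately show thesis using that PLG_inv[OF f(1)] by blast
      qed
    qed
  qed
qed

lemma exists_moving_left_end:
  assumes J: "admissible J" and y: "y \<in> J"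
  obtains f where "f \<in> PLG J" "f \<notin> left_kernel J" "\<forall>t\<ge>y. f t = t"
proof -
  obtain p where p: "p \<in> P" "1 < p" by (rule P_gt_one)
  obtain f c where f: "f \<in> PLG J" "left_germ J f p c" "\<forall>t\<ge>y. f t = t"
    by (rule exists_left_slope[OF J y p(1)])
  have "f \<notin> left_kernel J" using left_kernel_iff_left_germ[OF J f(1)] left_germ_unique(1)[OF J f(2)] p(2) by force
  then show ?thesis using that f by blast
qed

lemma right_kernel_not_subset_left_kernel:
  assumes J: "admissible J" shows "\<not> right_kernel J \<subseteq> left_kernel J"
proof -
  obtain y where y: "y \<in> J" using J unfolding admissible_def by blast
  obtain f where "f \<in> PLG J" "f \<notin> left_kernel J" "\<forall>t\<ge>y. f t = t" by (rule exists_moving_left_end[OF J y])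
  then show ?thesis using y unfolding right_kernel_def by blast
qed

lemma left_kernel_not_subset_right_kernel:
  assumes J: "admissible J" shows "\<not> left_kernel J \<subseteq> right_kernel J"
proof
  assume sub: "left_kernel J \<subseteq> right_kernel J"
  have "right_kernel ((-) 0 ` J) \<subseteq> left_kernel ((-) 0 ` J)"
  proof
    fix f assume "f \<in> right_kernel ((-) 0 ` J)"
    then have "reflect 0 f \<in> left_kernel J"
      using reflect_right_kernel_iff[OF A_zero, of "reflect 0 f" J] by simp
    then have "reflect 0 f \<in> right_kernel J" using sub by blast
    then show "f \<in> left_kernel ((-) 0 ` J)" using reflect_left_kernel_iff[OF A_zero, of "reflect 0 f" J] by simp
  qed
  then show False using right_kernel_not_subset_left_kernel[OF admissible_reflect[OF J A_zero]] by blast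
qed

lemma commute_disjoint:
  assumes k: "k \<in> PLG {x<..<y}" and f: "f \<in> PLG J" "\<forall>t\<in>{x<..<y}. f t = t"
  shows "f \<circ> k = k \<circ> f"
proof
  fix t
  show "(f \<circ> k) t = (k \<circ> f) t"
  proof (cases "t \<in> {x<..<y}")
    case True
    then have "k t \<in> {x<..<y}" using PLG_mem[OF k] by blast
    then show ?thesis using True f(2) by simp
  next
    case False
    have "f t \<notin> {x<..<y}"
    proof
      assume "f t \<in> {x<..<y}"
      then have "f (f t) = f t" using f(2) by blast
      then have "f t = t" using PLG_eq[OF f(1)] by blast
      then show False using \<open>f t \<in> {x<..<y}\<close> False by simp
    qed
    then show ?thesis using False PLG_outside[OF k] by simp
  qed
qed

text \<open>If \<open>f\<close> is the identity near an end, then so is every conjugate \<open>f'\<close>, and two noncommuting elements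
  with support close enough to that end commute with both \<open>f\<close> and \<open>f'\<close>. Otherwise the centralizer of
  \<open>f\<close> is commutative to the left of some \<open>x\<close> and to the right of some \<open>y\<close>. Conjugation by an \<open>h\<close> with
  \<open>y \<le> h x\<close> makes the centralizer of \<open>f'\<close> commutative to the left of \<open>y\<close>, and nothing is left over.
  The right-hand side speaks of multiplication only, which makes it invariant under automorphisms.\<close>
lemma fixes_end_iff:
  assumes J: "admissible J" and f: "f \<in> PLG J"
  shows "f \<in> left_kernel J \<union> right_kernel J \<longleftrightarrow>
    (\<forall>h\<in>PLG J. \<forall>f'\<in>PLG J. f' \<circ> h = h \<circ> f \<longrightarrow>
      (\<exists>k\<in>PLG J. \<exists>k'\<in>PLG J. f \<circ> k = k \<circ> f \<and> f \<circ> k' = k' \<circ> f \<and>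
         f' \<circ> k = k \<circ> f' \<and> f' \<circ> k' = k' \<circ> f' \<and> k \<circ> k' \<noteq> k' \<circ> k))" (is "_ \<longleftrightarrow> ?R")
proof
  assume fixes_end: "f \<in> left_kernel J \<union> right_kernel J"
  show ?R
  proof (intro ballI impI)
    fix h f' assume h: "h \<in> PLG J" and f': "f' \<in> PLG J" and conj: "f' \<circ> h = h \<circ> f"
    have moved: "f' (h t) = h t" if "f t = t" for t using conj that by (metis comp_apply)
    have "\<exists>x\<in>J. \<exists>y\<in>J. x < y \<and> (\<forall>t\<in>{x<..<y}. f t = t \<and> f' t = t)"
    proof (cases "f \<in> left_kernel J")
      case True
      then obtain y where y: "y \<in> J" "\<forall>t\<le>y. f t = t" unfolding left_kernel_def by blast
      have "f' t = t" if "t \<le> h y" for t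
      proof -
        have "finv h t \<le> y" using that PLG_le[OF h, of "finv h t" y] by (simp add: PLG_apply_inv[OF h])
        then show ?thesis using moved[of "finv h t"] y(2) by (simp add: PLG_apply_inv[OF h])
      qed
      moreover have m: "min y (h y) \<in> J" using admissible_min[OF J y(1)] PLG_mem[OF h] y(1) by blast
      moreover obtain x where "x \<in> J" "x < min y (h y)" using admissible_left[OF J m] by blast
      ultimately show ?thesis
        using y(2) by (intro bexI[of _ x] bexI[of _ "min y (h y)"]) auto
    next
      case False
      then obtain y where y: "y \<in> J" "\<forall>t\<ge>y. f t = t" using fixes_end unfolding right_kernel_def by blast
      have "f' t = t" if "h y \<le> t" for t
      proof -
        have "y \<le> finv h t" using that PLG_le[OF h, of y "finv h t"] by (simp add: PLG_apply_inv[OF h])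
        then show ?thesis using moved[of "finv h t"] y(2) by (simp add: PLG_apply_inv[OF h])
      qed
      moreover have m: "max y (h y) \<in> J" using admissible_max[OF J y(1)] PLG_mem[OF h] y(1) by blast
      moreover obtain x where "x \<in> J" "max y (h y) < x" using admissible_right[OF J m] by blast
      ultimately show ?thesis
        using y(2) by (intro bexI[of _ "max y (h y)"] bexI[of _ x]) auto
    qed
    then obtain x y where xy: "x \<in> J" "y \<in> J" "x < y"
      "\<forall>t\<in>{x<..<y}. f t = t" "\<forall>t\<in>{x<..<y}. f' t = t" by blast
    obtain k k' where k: "k \<in> PLG {x<..<y}" "k' \<in> PLG {x<..<y}" "k \<circ> k' \<noteq> k' \<circ> k"
      by (rule exists_noncommuting[OF xy(3)])
    show "\<exists>k\<in>PLG J. \<exists>k'\<in>PLG J. f \<circ> k = k \<circ> f \<and> f \<circ> k' = k' \<circ> f \<and>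
         f' \<circ> k = k \<circ> f' \<and> f' \<circ> k' = k' \<circ> f' \<and> k \<circ> k' \<noteq> k' \<circ> k"
      using PLG_window[OF J xy(1,2)] k commute_disjoint[OF _ f xy(4)] commute_disjoint[OF _ f' xy(5)]
      by (intro bexI[of _ k] bexI[of _ k']) auto
  qed
next
  assume R: ?R
  show "f \<in> left_kernel J \<union> right_kernel J"
  proof (rule ccontr)
    assume "f \<notin> left_kernel J \<union> right_kernel J"
    then have not: "f \<notin> left_kernel J" "f \<notin> right_kernel J" by auto
    obtain x where x: "x \<in> J" "\<forall>k\<in>PLG J. \<forall>k'\<in>PLG J. f \<circ> k = k \<circ> f \<longrightarrow> f \<circ> k' = k' \<circ> f \<longrightarrow>
        (\<forall>t\<le>x. k (k' t) = k' (k t))"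
      by (rule centralizer_commutes_left[OF J f not(1)])
    obtain y where y: "y \<in> J" "\<forall>k\<in>PLG J. \<forall>k'\<in>PLG J. f \<circ> k = k \<circ> f \<longrightarrow> f \<circ> k' = k' \<circ> f \<longrightarrow>
        (\<forall>t\<ge>y. k (k' t) = k' (k t))"
      by (rule centralizer_commutes_right[OF J f not(2)])
    obtain h where h: "h \<in> PLG J" "y \<le> h x" using exists_move_far[OF J x(1) y(1)] by blast
    define f' where "f' = h \<circ> f \<circ> finv h"
    have f': "f' \<in> PLG J" unfolding f'_def by (intro PLG_comp PLG_inv h f)
    have conj: "f' \<circ> h = h \<circ> f" by (simp add: f'_def fun_eq_iff PLG_inv_apply[OF h(1)])
    obtain k k' where k: "k \<in> PLG J" "f \<circ> k = k \<circ> f" "f' \<circ> k = k \<circ> f'"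
      and k': "k' \<in> PLG J" "f \<circ> k' = k' \<circ> f" "f' \<circ> k' = k' \<circ> f'" and noncomm: "k \<circ> k' \<noteq> k' \<circ> k"
      using R h(1) f' conj by blast
    have pullback: "f \<circ> (finv h \<circ> g \<circ> h) = (finv h \<circ> g \<circ> h) \<circ> f" if "f' \<circ> g = g \<circ> f'" for g
    proof
      fix t
      have "h (f (finv h (g (h t)))) = g (h (f t))"
        using fun_cong[OF that, of "h t"] by (simp add: f'_def PLG_inv_apply[OF h(1)])
      then have "f (finv h (g (h t))) = finv h (g (h (f t)))" by (metis PLG_inv_apply[OF h(1)])
      then show "(f \<circ> (finv h \<circ> g \<circ> h)) t = ((finv h \<circ> g \<circ> h) \<circ> f) t" by simp
    qed
    have "k (k' t) = k' (k t)" for t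
    proof (cases "y \<le> t")
      case True then show ?thesis using y(2) k k' by blast
    next
      case False
      then have "finv h t \<le> x" using h(2) PLG_le[OF h(1), of "finv h t" x] by (simp add: PLG_apply_inv[OF h(1)])
      moreover have "finv h \<circ> k \<circ> h \<in> PLG J" "finv h \<circ> k' \<circ> h \<in> PLG J"
        by (intro PLG_comp PLG_inv h(1) k(1) k'(1))+
      ultimately have "(finv h \<circ> k \<circ> h) ((finv h \<circ> k' \<circ> h) (finv h t)) = (finv h \<circ> k' \<circ> h) ((finv h \<circ> k \<circ> h) (finv h t))"
        using x(2) pullback[OF k(3)] pullback[OF k'(3)] by blast
      then have "finv h (k (k' t)) = finv h (k' (k t))" by (simp add: PLG_apply_inv[OF h(1)])
      then show ?thesis by (metis PLG_apply_inv[OF h(1)])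
    qed
    then have "k \<circ> k' = k' \<circ> k" by (simp add: fun_eq_iff)
    then show False using noncomm by simp
  qed
qed


section \<open>Automorphisms permute the two kernels\<close>
definition PLG_auto :: "real set \<Rightarrow> ((real \<Rightarrow> real) \<Rightarrow> real \<Rightarrow> real) \<Rightarrow> bool" where
  "PLG_auto J \<alpha> \<longleftrightarrow> bij_betw \<alpha> (PLG J) (PLG J) \<and>
     (\<forall>f\<in>PLG J. \<forall>g\<in>PLG J. \<alpha> (f \<circ> g) = \<alpha> f \<circ> \<alpha> g)"

lemma auto_mem: "PLG_auto J \<alpha> \<Longrightarrow> f \<in> PLG J \<Longrightarrow> \<alpha> f \<in> PLG J"
  and auto_comp: "PLG_auto J \<alpha> \<Longrightarrow> f \<in> PLG J \<Longrightarrow> g \<in> PLG J \<Longrightarrow> \<alpha> (f \<circ> g) = \<alpha> f \<circ> \<alpha> g"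
  and auto_eq: "PLG_auto J \<alpha> \<Longrightarrow> f \<in> PLG J \<Longrightarrow> g \<in> PLG J \<Longrightarrow> \<alpha> f = \<alpha> g \<longleftrightarrow> f = g"
  by (auto simp: PLG_auto_def bij_betw_def inj_on_eq_iff)

lemma auto_surj:
  assumes "PLG_auto J \<alpha>" "g \<in> PLG J" obtains f where "f \<in> PLG J" "g = \<alpha> f"
  using assms unfolding PLG_auto_def bij_betw_def by blast

lemma auto_inverse:
  assumes \<alpha>: "PLG_auto J \<alpha>" shows "PLG_auto J (inv_into (PLG J) \<alpha>)"
proof -
  let ?\<beta> = "inv_into (PLG J) \<alpha>"
  have bij: "bij_betw \<alpha> (PLG J) (PLG J)" using \<alpha> by (simp add: PLG_auto_def)
  have mem: "?\<beta> f \<in> PLG J" and right: "\<alpha> (?\<beta> f) = f" if "f \<in> PLG J" for f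
    using bij that by (auto simp: bij_betw_def inv_into_into f_inv_into_f)
  have "?\<beta> (f \<circ> g) = ?\<beta> f \<circ> ?\<beta> g" if "f \<in> PLG J" "g \<in> PLG J" for f g
  proof -
    have "\<alpha> (?\<beta> (f \<circ> g)) = \<alpha> (?\<beta> f \<circ> ?\<beta> g)"
      using that by (simp add: right PLG_comp auto_comp[OF \<alpha>] mem)
    then show ?thesis using that by (simp add: auto_eq[OF \<alpha>] mem PLG_comp)
  qed
  then show ?thesis using bij_betw_inv_into[OF bij] by (simp add: PLG_auto_def)
qed

lemma auto_compose:
  assumes "PLG_auto J \<alpha>" "PLG_auto J \<beta>" shows "PLG_auto J (\<alpha> \<circ> \<beta>)"
  using assms bij_betw_trans[of \<beta> "PLG J" "PLG J" \<alpha> "PLG J"]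
  by (auto simp: PLG_auto_def dest: bij_betwE)

lemma auto_reflect:
  assumes e: "e \<in> A" and J: "(-) e ` J = J" shows "PLG_auto J (reflect e)"
proof -
  have "reflect e g \<in> PLG J" if "g \<in> PLG J" for g
    using reflect_in_PLG[OF that e] J by simp
  then have "bij_betw (reflect e) (PLG J) (PLG J)"
    by (intro bij_betwI[where g = "reflect e"]) auto
  then show ?thesis by (simp add: PLG_auto_def reflect_comp)
qed

lemma auto_id:
  assumes \<alpha>: "PLG_auto J \<alpha>" shows "\<alpha> id = id"
proof
  fix t
  have m: "\<alpha> id \<in> PLG J" by (rule auto_mem[OF \<alpha> PLG_id])
  have "\<alpha> id (\<alpha> id t) = \<alpha> id t"
    using auto_comp[OF \<alpha> PLG_id PLG_id] by (metis comp_apply comp_id)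
  then show "\<alpha> id t = id t" using PLG_eq[OF m] by simp
qed

lemma auto_inv:
  assumes \<alpha>: "PLG_auto J \<alpha>" and f: "f \<in> PLG J" shows "\<alpha> (finv f) = finv (\<alpha> f)"
proof
  fix t
  have "\<alpha> f \<circ> \<alpha> (finv f) = id"
    using auto_comp[OF \<alpha> f PLG_inv[OF f]] auto_id[OF \<alpha>] by (simp add: PLG_comp_inv[OF f])
  then have "\<alpha> f (\<alpha> (finv f) t) = t" by (metis comp_apply id_apply)
  then show "\<alpha> (finv f) t = finv (\<alpha> f) t" by (metis PLG_inv_apply[OF auto_mem[OF \<alpha> f]])
qed

lemma auto_commute:
  assumes \<alpha>: "PLG_auto J \<alpha>" and "f \<in> PLG J" "g \<in> PLG J" "f \<circ> g = g \<circ> f"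
  shows "\<alpha> f \<circ> \<alpha> g = \<alpha> g \<circ> \<alpha> f"
  using assms auto_comp[OF \<alpha>] by metis

lemma auto_fixes_end:
  assumes J: "admissible J" and \<alpha>: "PLG_auto J \<alpha>" and f: "f \<in> left_kernel J \<union> right_kernel J"
  shows "\<alpha> f \<in> left_kernel J \<union> right_kernel J"
proof -
  have fG: "f \<in> PLG J" using f left_kernel_PLG right_kernel_PLG by blast
  have "\<exists>k\<in>PLG J. \<exists>k'\<in>PLG J. \<alpha> f \<circ> k = k \<circ> \<alpha> f \<and> \<alpha> f \<circ> k' = k' \<circ> \<alpha> f \<and>
         f' \<circ> k = k \<circ> f' \<and> f' \<circ> k' = k' \<circ> f' \<and> k \<circ> k' \<noteq> k' \<circ> k"
    if h: "h \<in> PLG J" and f': "f' \<in> PLG J" and conj: "f' \<circ> h = h \<circ> \<alpha> f" for h f'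
  proof -
    obtain h0 where h0: "h0 \<in> PLG J" "h = \<alpha> h0" by (rule auto_surj[OF \<alpha> h])
    obtain f0 where f0: "f0 \<in> PLG J" "f' = \<alpha> f0" by (rule auto_surj[OF \<alpha> f'])
    have "\<alpha> (f0 \<circ> h0) = \<alpha> (h0 \<circ> f)"
      using conj by (simp add: auto_comp[OF \<alpha>] h0 f0 fG)
    then have "f0 \<circ> h0 = h0 \<circ> f" by (simp add: auto_eq[OF \<alpha>] PLG_comp h0 f0 fG)
    then obtain k k' where k: "k \<in> PLG J" "k' \<in> PLG J" "f \<circ> k = k \<circ> f" "f \<circ> k' = k' \<circ> f"
      "f0 \<circ> k = k \<circ> f0" "f0 \<circ> k' = k' \<circ> f0" "k \<circ> k' \<noteq> k' \<circ> k"
      using fixes_end_iff[OF J fG] f h0(1) f0(1) by meson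
    have "\<alpha> k \<circ> \<alpha> k' \<noteq> \<alpha> k' \<circ> \<alpha> k"
      using k(7) auto_eq[OF \<alpha> PLG_comp[OF k(1,2)] PLG_comp[OF k(2,1)]] by (simp add: auto_comp[OF \<alpha>] k(1,2))
    then show ?thesis
      using auto_mem[OF \<alpha> k(1)] auto_mem[OF \<alpha> k(2)] auto_commute[OF \<alpha> fG k(1,3)]
        auto_commute[OF \<alpha> fG k(2,4)] auto_commute[OF \<alpha> f0(1) k(1,5)] auto_commute[OF \<alpha> f0(1) k(2,6)]
        f0(2) by blast
  qed
  then show ?thesis using fixes_end_iff[OF J auto_mem[OF \<alpha> fG]] by blast
qed

text \<open>The image of \<open>U\<close> is a subgroup contained in the union of two subgroups, hence it lies in one of them.\<close>
lemma auto_maps_end_into_end: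
  assumes J: "admissible J" and \<alpha>: "PLG_auto J \<alpha>" and U: "U = left_kernel J \<or> U = right_kernel J"
  shows "\<alpha> ` U \<subseteq> left_kernel J \<or> \<alpha> ` U \<subseteq> right_kernel J"
proof (rule ccontr)
  assume "\<not> ?thesis"
  then obtain a b where a: "a \<in> U" "\<alpha> a \<notin> left_kernel J" and b: "b \<in> U" "\<alpha> b \<notin> right_kernel J" by blast
  have UG: "a \<in> PLG J" "b \<in> PLG J" using U a(1) b(1) left_kernel_PLG right_kernel_PLG by blast+
  have a': "\<alpha> a \<in> right_kernel J" and b': "\<alpha> b \<in> left_kernel J"
    using auto_fixes_end[OF J \<alpha>] U a b by blast+
  have "a \<circ> b \<in> U" using U a(1) b(1) left_kernel_comp[OF J] right_kernel_comp[OF J] by blast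
  then have "\<alpha> (a \<circ> b) \<in> left_kernel J \<union> right_kernel J" using auto_fixes_end[OF J \<alpha>] U by blast
  then have "\<alpha> a \<circ> \<alpha> b \<in> left_kernel J \<union> right_kernel J" by (simp add: auto_comp[OF \<alpha> UG])
  then show False
  proof
    assume "\<alpha> a \<circ> \<alpha> b \<in> left_kernel J"
    then have "(\<alpha> a \<circ> \<alpha> b) \<circ> finv (\<alpha> b) \<in> left_kernel J" using left_kernel_comp[OF J] left_kernel_inv[OF b'] by blast
    then show False using a(2) by (simp add: comp_assoc PLG_comp_inv[OF left_kernel_PLG[OF b']])
  next
    assume "\<alpha> a \<circ> \<alpha> b \<in> right_kernel J"
    then have "finv (\<alpha> a) \<circ> (\<alpha> a \<circ> \<alpha> b) \<in> right_kernel J" using right_kernel_comp[OF J right_kernel_inv[OF a']] by blast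
    then show False using b(2) by (simp add: comp_assoc[symmetric] PLG_inv_comp[OF right_kernel_PLG[OF a']])
  qed
qed

lemma auto_permutes_ends:
  assumes J: "admissible J" and \<alpha>: "PLG_auto J \<alpha>"
  shows "(\<alpha> ` left_kernel J = left_kernel J \<and> \<alpha> ` right_kernel J = right_kernel J) \<or> (\<alpha> ` left_kernel J = right_kernel J \<and> \<alpha> ` right_kernel J = left_kernel J)"
proof -
  let ?\<beta> = "inv_into (PLG J) \<alpha>"
  have \<beta>: "PLG_auto J ?\<beta>" by (rule auto_inverse[OF \<alpha>])
  have bij: "bij_betw \<alpha> (PLG J) (PLG J)" using \<alpha> by (simp add: PLG_auto_def)
  have right: "\<alpha> (?\<beta> f) = f" and left: "?\<beta> (\<alpha> f) = f" if "f \<in> PLG J" for f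
    using bij that by (auto simp: bij_betw_def f_inv_into_f inv_into_f_f)
  have trichotomy: "(\<gamma> ` left_kernel J \<subseteq> left_kernel J \<and> \<gamma> ` right_kernel J \<subseteq> right_kernel J) \<or> (\<gamma> ` left_kernel J \<subseteq> right_kernel J \<and> \<gamma> ` right_kernel J \<subseteq> left_kernel J)"
    if \<gamma>: "PLG_auto J \<gamma>" and \<delta>: "PLG_auto J \<delta>" and inv: "\<And>f. f \<in> PLG J \<Longrightarrow> \<gamma> (\<delta> f) = f" for \<gamma> \<delta>
  proof -
    have cover: "left_kernel J \<union> right_kernel J \<subseteq> \<gamma> ` left_kernel J \<union> \<gamma> ` right_kernel J"
    proof
      fix f assume f: "f \<in> left_kernel J \<union> right_kernel J"
      then have "f \<in> PLG J" using left_kernel_PLG right_kernel_PLG by blast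
      then have "f = \<gamma> (\<delta> f)" by (simp add: inv)
      then have "f \<in> \<gamma> ` (left_kernel J \<union> right_kernel J)" using auto_fixes_end[OF J \<delta> f] by (rule image_eqI)
      then show "f \<in> \<gamma> ` left_kernel J \<union> \<gamma> ` right_kernel J" by (simp only: image_Un)
    qed
    have "\<not> (\<gamma> ` left_kernel J \<subseteq> left_kernel J \<and> \<gamma> ` right_kernel J \<subseteq> left_kernel J)"
    proof
      assume "\<gamma> ` left_kernel J \<subseteq> left_kernel J \<and> \<gamma> ` right_kernel J \<subseteq> left_kernel J"
      then have "right_kernel J \<subseteq> left_kernel J" using cover by blast
      then show False using right_kernel_not_subset_left_kernel[OF J] by contradiction
    qed
    moreover have "\<not> (\<gamma> ` left_kernel J \<subseteq> right_kernel J \<and> \<gamma> ` right_kernel J \<subseteq> right_kernel J)"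
    proof
      assume "\<gamma> ` left_kernel J \<subseteq> right_kernel J \<and> \<gamma> ` right_kernel J \<subseteq> right_kernel J"
      then have "left_kernel J \<subseteq> right_kernel J" using cover by blast
      then show False using left_kernel_not_subset_right_kernel[OF J] by contradiction
    qed
    ultimately show ?thesis
      using auto_maps_end_into_end[OF J \<gamma>, of "left_kernel J"] auto_maps_end_into_end[OF J \<gamma>, of "right_kernel J"]
      by argo
  qed
  have back_image: "U \<subseteq> \<alpha> ` V" if "?\<beta> ` U \<subseteq> V" "U \<subseteq> PLG J" for U V
  proof
    fix f assume "f \<in> U"
    then have "?\<beta> f \<in> V" "f = \<alpha> (?\<beta> f)" using that right by auto
    then show "f \<in> \<alpha> ` V" by (intro image_eqI)
  qed
  have sub: "left_kernel J \<subseteq> PLG J" "right_kernel J \<subseteq> PLG J" using left_kernel_PLG right_kernel_PLG by blast+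
  have \<alpha>3: "(\<alpha> ` left_kernel J \<subseteq> left_kernel J \<and> \<alpha> ` right_kernel J \<subseteq> right_kernel J) \<or> (\<alpha> ` left_kernel J \<subseteq> right_kernel J \<and> \<alpha> ` right_kernel J \<subseteq> left_kernel J)"
    by (rule trichotomy[of \<alpha> ?\<beta>, OF \<alpha> \<beta>]) (rule right)
  have \<beta>3: "(?\<beta> ` left_kernel J \<subseteq> left_kernel J \<and> ?\<beta> ` right_kernel J \<subseteq> right_kernel J) \<or> (?\<beta> ` left_kernel J \<subseteq> right_kernel J \<and> ?\<beta> ` right_kernel J \<subseteq> left_kernel J)"
    by (rule trichotomy[of ?\<beta> \<alpha>, OF \<beta> \<alpha>]) (rule left)
  have \<beta>4: "(left_kernel J \<subseteq> \<alpha> ` left_kernel J \<and> right_kernel J \<subseteq> \<alpha> ` right_kernel J) \<or> (left_kernel J \<subseteq> \<alpha> ` right_kernel J \<and> right_kernel J \<subseteq> \<alpha> ` left_kernel J)"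
    using \<beta>3
  proof
    assume "?\<beta> ` left_kernel J \<subseteq> left_kernel J \<and> ?\<beta> ` right_kernel J \<subseteq> right_kernel J"
    then show ?thesis using back_image sub by simp
  next
    assume "?\<beta> ` left_kernel J \<subseteq> right_kernel J \<and> ?\<beta> ` right_kernel J \<subseteq> left_kernel J"
    then show ?thesis using back_image sub by simp
  qed
  have "\<not> (\<alpha> ` left_kernel J \<subseteq> left_kernel J \<and> right_kernel J \<subseteq> \<alpha> ` left_kernel J)" "\<not> (\<alpha> ` left_kernel J \<subseteq> right_kernel J \<and> left_kernel J \<subseteq> \<alpha> ` left_kernel J)"
    using left_kernel_not_subset_right_kernel[OF J] right_kernel_not_subset_left_kernel[OF J] by (meson subset_trans)+
  with \<alpha>3 \<beta>4 show ?thesis unfolding set_eq_subset by argo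
qed

section \<open>Automorphisms act on points\<close>
lemma Inf_image_PLG:
  assumes g: "g \<in> PLG J" and D: "D \<noteq> {}" "bdd_below D"
  shows "Inf (g ` D) = g (Inf D)"
proof (rule antisym)
  have bdd: "bdd_below (g ` D)"
    using D(2) unfolding bdd_below_def by (metis PLG_le[OF g] imageE)
  show "g (Inf D) \<le> Inf (g ` D)"
    using D by (intro cInf_greatest) (auto simp: PLG_le[OF g] intro: cInf_lower)
  have "finv g (Inf (g ` D)) \<le> d" if "d \<in> D" for d
  proof -
    have "Inf (g ` D) \<le> g d" using that bdd by (intro cInf_lower) auto
    then show ?thesis using PLG_le[OF g, of "finv g (Inf (g ` D))" d] by (simp add: PLG_apply_inv[OF g])
  qed
  then have "finv g (Inf (g ` D)) \<le> Inf D" using D(1) by (intro cInf_greatest) auto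
  then show "Inf (g ` D) \<le> g (Inf D)"
    using PLG_le[OF g, of "finv g (Inf (g ` D))" "Inf D"] by (simp add: PLG_apply_inv[OF g])
qed

text \<open>The subgroup \<open>N y\<close> of elements that are the identity to the left of \<open>y\<close> satisfies
  \<open>f N(y) f\<^sup>-\<^sup>1 = N(f y)\<close>, so the infimum \<open>\<phi> y\<close> of the supports of its image is equivariant and weakly
  increasing for formal reasons. It does not fall to the left end, because \<open>N y\<close> commutes with an
  element that moves points near the left end and whose image does the same. It is strictly
  increasing and has no lower bound in \<open>J\<close>, because the group fixes no point of \<open>J\<close>.\<close>
lemma increasing_semiconjugacy:
  assumes J: "admissible J" and \<alpha>: "PLG_auto J \<alpha>" and ends: "\<alpha> ` left_kernel J = left_kernel J"
  obtains \<phi> where "\<And>t. t \<in> J \<Longrightarrow> \<phi> t \<in> J"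
    and "\<And>s t. s \<in> J \<Longrightarrow> t \<in> J \<Longrightarrow> s < t \<Longrightarrow> \<phi> s < \<phi> t"
    and "\<And>f t. f \<in> PLG J \<Longrightarrow> t \<in> J \<Longrightarrow> \<phi> (f t) = \<alpha> f (\<phi> t)"
    and "\<And>x. x \<in> J \<Longrightarrow> \<exists>t\<in>J. \<phi> t < x"
proof -
  define N where "N y = {u \<in> PLG J. \<forall>t\<le>y. u t = t}" for y
  define D where "D y = {s. \<exists>u\<in>N y. \<alpha> u s \<noteq> s}" for y
  define \<phi> where "\<phi> y = Inf (D y)" for y
  have lower: "\<exists>x\<in>J. \<forall>s\<in>D y. x \<le> s" if y: "y \<in> J" for y
  proof -
    obtain k where k: "k \<in> PLG J" "k \<notin> left_kernel J" "\<forall>t\<ge>y. k t = t"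
      by (rule exists_moving_left_end[OF J y])
    have "\<alpha> k \<notin> left_kernel J"
    proof
      assume "\<alpha> k \<in> left_kernel J"
      then obtain k0 where "k0 \<in> left_kernel J" "\<alpha> k = \<alpha> k0" using ends by blast
      then show False using k auto_eq[OF \<alpha>] left_kernel_PLG by metis
    qed
    then obtain x where x: "x \<in> J" "\<forall>k'\<in>left_kernel J. \<alpha> k \<circ> k' = k' \<circ> \<alpha> k \<longrightarrow> (\<forall>t\<le>x. k' t = t)"
      using commuting_left_rigid[OF J auto_mem[OF \<alpha> k(1)]] by blast
    have "x \<le> s" if s: "s \<in> D y" for s
    proof -
      obtain u where u: "u \<in> PLG J" "\<forall>t\<le>y. u t = t" "\<alpha> u s \<noteq> s"
        using s unfolding D_def N_def by blast
      have "u \<in> left_kernel J" using u y unfolding left_kernel_def by blast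
      then have "\<alpha> u \<in> left_kernel J" using ends by blast
      have "k \<circ> u = u \<circ> k"
      proof
        fix t
        show "(k \<circ> u) t = (u \<circ> k) t"
        proof (cases "t \<le> y")
          case True
          then have "k t \<le> k y" by (simp add: PLG_le[OF k(1)])
          then show ?thesis using True u(2) k(3) by simp
        next
          case False
          then have "u y \<le> u t" by (simp add: PLG_le[OF u(1)])
          then show ?thesis using False u(2) k(3) by simp
        qed
      qed
      then have "\<alpha> k \<circ> \<alpha> u = \<alpha> u \<circ> \<alpha> k" by (rule auto_commute[OF \<alpha> k(1) u(1)])
      then have "\<forall>t\<le>x. \<alpha> u t = t" using x(2) \<open>\<alpha> u \<in> left_kernel J\<close> by blast
      then show ?thesis using u(3) by (meson linear)
    qed
    then show ?thesis using x(1) by blast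
  qed
  have D_J: "D y \<subseteq> J" for y
  proof
    fix s assume "s \<in> D y"
    then obtain u where "u \<in> PLG J" "\<alpha> u s \<noteq> s" unfolding D_def N_def by blast
    then show "s \<in> J" using PLG_outside[OF auto_mem[OF \<alpha>]] by blast
  qed
  have D_ne: "D y \<noteq> {}" if y: "y \<in> J" for y
  proof -
    obtain z where z: "z \<in> J" "y < z" by (rule admissible_right[OF J y])
    obtain z' where z': "z' \<in> J" "z < z'" by (rule admissible_right[OF J z(1)])
    obtain u where u: "u \<in> PLG {y<..<z'}" "z < u z" by (rule exists_move_up[OF z(2) z'(2)])
    have uJ: "u \<in> PLG J" by (rule PLG_window[OF J y z'(1) u(1)])
    have "\<forall>t\<le>y. u t = t" using PLG_outside[OF u(1)] by simp
    then have "u \<in> N y" using uJ by (simp add: N_def)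
    have "u \<noteq> id" using u(2) by auto
    then have "\<alpha> u \<noteq> id" using auto_eq[OF \<alpha> uJ PLG_id] auto_id[OF \<alpha>] by simp
    then obtain s where "\<alpha> u s \<noteq> s" by (auto simp: fun_eq_iff)
    then show ?thesis using \<open>u \<in> N y\<close> unfolding D_def by blast
  qed
  have D_bdd: "bdd_below (D y)" if "y \<in> J" for y
    using lower[OF that] unfolding bdd_below_def by blast
  have \<phi>_J: "\<phi> y \<in> J" if y: "y \<in> J" for y
  proof -
    obtain x where x: "x \<in> J" "\<forall>s\<in>D y. x \<le> s" using lower[OF y] by blast
    obtain s where s: "s \<in> D y" using D_ne[OF y] by blast
    have "x \<le> \<phi> y" unfolding \<phi>_def using D_ne[OF y] x(2) by (intro cInf_greatest) auto
    moreover have "\<phi> y \<le> s" unfolding \<phi>_def by (rule cInf_lower[OF s D_bdd[OF y]])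
    ultimately show ?thesis using admissible_between[OF J x(1)] s D_J by blast
  qed
  have D_sub: "D (f y) \<subseteq> \<alpha> f ` D y" if f: "f \<in> PLG J" for f y
  proof
    fix s assume "s \<in> D (f y)"
    then obtain u where u: "u \<in> PLG J" "\<forall>t\<le>f y. u t = t" "\<alpha> u s \<noteq> s"
      unfolding D_def N_def by blast
    define u' where "u' = finv f \<circ> u \<circ> f"
    have "u' \<in> PLG J" unfolding u'_def by (intro PLG_comp PLG_inv f u(1))
    moreover have "\<forall>t\<le>y. u' t = t" using u(2) by (simp add: u'_def PLG_le[OF f] PLG_inv_apply[OF f])
    ultimately have "u' \<in> N y" by (simp add: N_def)
    have \<alpha>f: "\<alpha> f \<in> PLG J" by (rule auto_mem[OF \<alpha> f])
    have "\<alpha> u' = finv (\<alpha> f) \<circ> \<alpha> u \<circ> \<alpha> f"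
      unfolding u'_def by (simp add: auto_comp[OF \<alpha>] auto_inv[OF \<alpha>] PLG_comp PLG_inv f u(1))
    then have "\<alpha> u' (finv (\<alpha> f) s) = finv (\<alpha> f) (\<alpha> u s)" by (simp add: PLG_apply_inv[OF \<alpha>f])
    also have "\<dots> \<noteq> finv (\<alpha> f) s" using u(3) PLG_eq[OF PLG_inv[OF \<alpha>f]] by simp
    finally have "finv (\<alpha> f) s \<in> D y" using \<open>u' \<in> N y\<close> unfolding D_def by blast
    then show "s \<in> \<alpha> f ` D y" by (rule image_eqI[rotated]) (simp add: PLG_apply_inv[OF \<alpha>f])
  qed
  have \<phi>_equiv: "\<phi> (f y) = \<alpha> f (\<phi> y)" if f: "f \<in> PLG J" and y: "y \<in> J" for f y
  proof -
    have \<alpha>f: "\<alpha> f \<in> PLG J" by (rule auto_mem[OF \<alpha> f])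
    have "D y \<subseteq> finv (\<alpha> f) ` D (f y)"
      using D_sub[OF PLG_inv[OF f], of "f y"] by (simp add: PLG_inv_apply[OF f] auto_inv[OF \<alpha> f])
    then have "\<alpha> f ` D y \<subseteq> \<alpha> f ` finv (\<alpha> f) ` D (f y)" by (rule image_mono)
    then have "\<alpha> f ` D y \<subseteq> D (f y)" by (simp add: image_image PLG_apply_inv[OF \<alpha>f])
    then have "D (f y) = \<alpha> f ` D y" using D_sub[OF f] by blast
    then show ?thesis
      unfolding \<phi>_def using Inf_image_PLG[OF \<alpha>f D_ne[OF y] D_bdd[OF y]] by simp
  qed
  have \<phi>_mono: "\<phi> y \<le> \<phi> y'" if "y \<in> J" "y' \<in> J" "y \<le> y'" for y y'
  proof -
    have "D y' \<subseteq> D y" using that(3) unfolding D_def N_def by fastforce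
    then show ?thesis unfolding \<phi>_def by (intro cInf_superset_mono D_ne D_bdd that)
  qed
  have no_fixed: "\<exists>f\<in>PLG J. z < \<alpha> f z" if z: "z \<in> J" for z
  proof -
    obtain g where g: "g \<in> PLG J" "z < g z" by (rule exists_move_up_in[OF J z])
    obtain f where "f \<in> PLG J" "g = \<alpha> f" by (rule auto_surj[OF \<alpha> g(1)])
    then show ?thesis using g(2) by blast
  qed
  have \<phi>_strict: "\<phi> y < \<phi> y'" if y: "y \<in> J" and y': "y' \<in> J" and less: "y < y'" for y y'
  proof (rule ccontr)
    assume "\<not> \<phi> y < \<phi> y'"
    then have eq: "\<phi> y' = \<phi> y" using \<phi>_mono[OF y y'] less by simp
    \<comment> \<open>A bump around the right end \<open>w\<close> of the level set \<open>\<Lambda>\<close> that fixes \<open>y\<close> would push \<open>\<Lambda>\<close> beyond \<open>w\<close>.\<close>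
    have const: "\<phi> t = \<phi> y" if t: "t \<in> J" "y \<le> t" for t
    proof (rule ccontr)
      assume neq: "\<phi> t \<noteq> \<phi> y"
      define \<Lambda> where "\<Lambda> = {s\<in>J. y \<le> s \<and> \<phi> s = \<phi> y}"
      define w where "w = Sup \<Lambda>"
      have "y' \<in> \<Lambda>" using y' less eq by (simp add: \<Lambda>_def)
      have ub: "s \<le> t" if "s \<in> \<Lambda>" for s
      proof (rule ccontr)
        assume "\<not> s \<le> t"
        then have "\<phi> y \<le> \<phi> t" "\<phi> t \<le> \<phi> s"
          using \<phi>_mono[OF y t(1)] \<phi>_mono[OF t(1), of s] t(2) that by (auto simp: \<Lambda>_def)
        then show False using neq that by (simp add: \<Lambda>_def)
      qed
      then have bdd: "bdd_above \<Lambda>" by (rule bdd_aboveI)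
      have "y' \<le> w" unfolding w_def by (rule cSup_upper[OF \<open>y' \<in> \<Lambda>\<close> bdd])
      have "w \<le> t" unfolding w_def using \<open>y' \<in> \<Lambda>\<close> ub by (intro cSup_least) auto
      have "w \<in> J" by (rule admissible_between[OF J y' t(1) \<open>y' \<le> w\<close> \<open>w \<le> t\<close>])
      have "y < w" using less \<open>y' \<le> w\<close> by simp
      obtain b where b: "b \<in> J" "w < b" by (rule admissible_right[OF J \<open>w \<in> J\<close>])
      obtain g where g: "g \<in> PLG {y<..<b}" "w < g w" by (rule exists_move_up[OF \<open>y < w\<close> b(2)])
      have gJ: "g \<in> PLG J" by (rule PLG_window[OF J y b(1) g(1)])
      have "g y = y" using PLG_outside[OF g(1)] by simp
      then have fixed: "\<alpha> g (\<phi> y) = \<phi> y" using \<phi>_equiv[OF gJ y] by simp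
      have "finv g w < w" using g(2) PLG_less[OF gJ, of "finv g w" w] by (simp add: PLG_apply_inv[OF gJ])
      then obtain s where s: "s \<in> \<Lambda>" "finv g w < s"
        using less_cSupD[of \<Lambda> "finv g w"] \<open>y' \<in> \<Lambda>\<close> unfolding w_def by blast
      have "w < g s" using s(2) PLG_less[OF gJ, of "finv g w" s] by (simp add: PLG_apply_inv[OF gJ])
      have "s \<in> J" "y \<le> s" "\<phi> s = \<phi> y" using s(1) by (auto simp: \<Lambda>_def)
      then have "g s \<in> \<Lambda>"
        using \<phi>_equiv[OF gJ \<open>s \<in> J\<close>] fixed PLG_mem[OF gJ] PLG_le[OF gJ, of y s] \<open>g y = y\<close>
        by (simp add: \<Lambda>_def)
      then have "g s \<le> w" unfolding w_def by (rule cSup_upper[OF _ bdd])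
      then show False using \<open>w < g s\<close> by simp
    qed
    \<comment> \<open>If \<open>\<phi>\<close> is constant from \<open>y\<close> on, its value is fixed by the whole group.\<close>
    obtain f where f: "f \<in> PLG J" "\<phi> y < \<alpha> f (\<phi> y)" using no_fixed[OF \<phi>_J[OF y]] by blast
    define t where "t = max y (finv f y)"
    have "t \<in> J" unfolding t_def using PLG_mem[OF PLG_inv[OF f(1)]] y by (intro admissible_max[OF J]) auto
    have "f (finv f y) \<le> f t" unfolding PLG_le[OF f(1)] t_def by simp
    then have "y \<le> f t" by (simp add: PLG_apply_inv[OF f(1)])
    then have "\<phi> (f t) = \<phi> y" using const PLG_mem[OF f(1)] \<open>t \<in> J\<close> by blast
    moreover have "\<phi> t = \<phi> y" using const \<open>t \<in> J\<close> by (simp add: t_def)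
    ultimately show False using f(2) \<phi>_equiv[OF f(1) \<open>t \<in> J\<close>] by simp
  qed
  have \<phi>_inf: "\<exists>t\<in>J. \<phi> t < x" if x: "x \<in> J" for x
  proof (rule ccontr)
    assume "\<not> (\<exists>t\<in>J. \<phi> t < x)"
    then have x_le: "\<And>t. t \<in> J \<Longrightarrow> x \<le> \<phi> t" by force
    define z where "z = Inf (\<phi> ` J)"
    have bdd: "bdd_below (\<phi> ` J)" using x_le by (intro bdd_belowI2)
    have "x \<le> z" unfolding z_def using x x_le by (intro cInf_greatest) auto
    have z_le: "z \<le> \<phi> t" if "t \<in> J" for t unfolding z_def using that bdd by (intro cInf_lower) auto
    have "z \<in> J" by (rule admissible_between[OF J x \<phi>_J[OF x] \<open>x \<le> z\<close> z_le[OF x]])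
    then obtain f where f: "f \<in> PLG J" "z < \<alpha> f z" using no_fixed by blast
    have \<alpha>f: "\<alpha> f \<in> PLG J" by (rule auto_mem[OF \<alpha> f(1)])
    obtain t where t: "t \<in> J" "\<phi> t < \<alpha> f z"
      using cInf_lessD[of "\<phi> ` J" "\<alpha> f z"] f(2) x unfolding z_def by blast
    have "finv f t \<in> J" using PLG_mem[OF PLG_inv[OF f(1)]] t(1) by blast
    have "\<alpha> f (\<phi> (finv f t)) = \<phi> t"
      using \<phi>_equiv[OF f(1) \<open>finv f t \<in> J\<close>] by (simp add: PLG_apply_inv[OF f(1)])
    then have "\<phi> (finv f t) < z" using t(2) PLG_less[OF \<alpha>f] by metis
    then show False using z_le[OF \<open>finv f t \<in> J\<close>] by simp
  qed
  show ?thesis using that[of \<phi>] \<phi>_J \<phi>_strict \<phi>_equiv \<phi>_inf by blast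
qed

end

section \<open>Rigidity of local scalings\<close>
lemma eq_if_same_rational_bounds:
  fixes q q' :: real
  assumes "0 < q" "0 < q'"
    and upper: "\<And>m n. real n * q < real m \<Longrightarrow> real n * q' \<le> real m"
    and lower: "\<And>m n. real m < real n * q \<Longrightarrow> real m \<le> real n * q'"
  shows "q = q'"
proof (rule ccontr)
  assume "q \<noteq> q'"
  then have "min q q' < max q q'" by (auto simp: min_def max_def)
  from Rats_dense_in_real[OF this] obtain r where r: "r \<in> \<rat>" "min q q' < r" "r < max q q'" by blast
  obtain m n :: nat where mn: "n \<noteq> 0" "\<bar>r\<bar> = real m / real n"
    using Rats_abs_nat_div_natE[OF r(1)] by metis
  have "0 < r" using r(2) assms(1,2) by linarith
  then have nr: "real n * r = real m" using mn by (simp add: field_simps)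
  have n: "0 < real n" using mn(1) by simp
  consider "q < r" "r < q'" | "q' < r" "r < q" using r by linarith
  then show False
  proof cases
    case 1
    have "real n * q < real n * r" "real n * r < real n * q'" using 1 n by simp_all
    then show False using upper[of n m] nr by simp
  next
    case 2
    have "real n * q' < real n * r" "real n * r < real n * q" using 2 n by simp_all
    then show False using lower[of m n] nr by simp
  qed
qed

lemma iterated_translation:
  fixes \<phi> :: "real \<Rightarrow> real"
  assumes step: "\<And>s. l < s \<Longrightarrow> s + x < r \<Longrightarrow> \<phi> (s + x) = \<phi> s + k"
    and "l < s0" "0 \<le> x"
  shows "s0 + real n * x < r \<Longrightarrow> \<phi> (s0 + real n * x) = \<phi> s0 + real n * k"
proof (induction n)
  case (Suc n)
  have "s0 + real n * x < r" using Suc.prems assms(3) by (simp add: algebra_simps)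
  moreover have "0 \<le> real n * x" using assms(3) by simp
  then have "l < s0 + real n * x" using assms(2) by linarith
  ultimately show ?case
    using step[of "s0 + real n * x"] Suc.prems Suc.IH by (simp add: algebra_simps)
qed simp

text \<open>Suppose that \<open>\<phi>\<close> carries the scaling by \<open>p\<close> to the scaling by \<open>\<tau> p\<close>, and a translation by \<open>a\<close> on some
  interval to the affine map \<open>s \<mapsto> m * s + d\<close>. Conjugation by the scaling turns these into the
  translation by \<open>p * a\<close> and the affine map \<open>s \<mapsto> m * s + \<tau> p * d\<close>, which has the same slope \<open>m\<close>. Hence
  the translation by \<open>(p - 1) * a\<close> goes to the translation by \<open>(\<tau> p - 1) * d\<close>, whatever \<open>m\<close> is. Since
  \<open>p\<close> may be taken close to \<open>1\<close>, these steps are as short as desired, and the comparison of \<open>n\<close>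
  steps scaled by \<open>q\<close> with \<open>j\<close> unscaled ones stays inside the interval.\<close>
lemma scaling_rigid_if_translation:
  fixes \<phi> \<tau> :: "real \<Rightarrow> real"
  assumes dense: "\<And>e. 0 < e \<Longrightarrow> \<exists>p\<in>P. 1 < p \<and> p < 1 + e"
    and mono: "\<And>s t. 0 < s \<Longrightarrow> s < t \<Longrightarrow> t < \<delta> \<Longrightarrow> \<phi> s < \<phi> t"
    and scale: "\<And>p t. p \<in> P \<Longrightarrow> 0 < t \<Longrightarrow> t < \<delta> \<Longrightarrow> p * t < \<delta> \<Longrightarrow> \<phi> (p * t) = \<tau> p * \<phi> t"
    and \<tau>_pos: "\<And>p. p \<in> P \<Longrightarrow> 0 < \<tau> p"
    and uv: "0 < u" "u < v" and a: "0 < a" "v + a < \<delta>"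
    and trans: "\<And>t. u < t \<Longrightarrow> t < v \<Longrightarrow> \<phi> (t + a) = m * \<phi> t + d"
  shows "\<exists>e>0. \<forall>q\<in>P. 1 < q \<and> q < 1 + e \<longrightarrow> \<tau> q = q"
proof -
  define w where "w = (u + v) / 2"
  have w: "u < w" "w < v" using uv by (auto simp: w_def)
  \<comment> \<open>For \<open>p < 1 + e1\<close> the intervals \<open>(u, v)\<close> and \<open>p * (u, v)\<close> still share the points between \<open>w\<close> and \<open>v\<close>, and \<open>v + p * a\<close> stays below \<open>\<delta>\<close>.\<close>
  define e1 where "e1 = min ((w - u) / (2 * u)) ((\<delta> - v - a) / (2 * a))"
  have e1: "0 < e1" using w uv a by (simp add: e1_def)
  have e1u: "(1 + e1) * u < w"
  proof -
    have "e1 * u \<le> (w - u) / (2 * u) * u" using uv by (intro mult_right_mono) (auto simp: e1_def)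
    also have "\<dots> = (w - u) / 2" using uv by simp
    finally show ?thesis using w by (simp add: distrib_right)
  qed
  have e1a: "v + (1 + e1) * a < \<delta>"
  proof -
    have "e1 * a \<le> (\<delta> - v - a) / (2 * a) * a" using a by (intro mult_right_mono) (auto simp: e1_def)
    also have "\<dots> = (\<delta> - v - a) / 2" using a by simp
    finally show ?thesis using a by (simp add: distrib_right)
  qed
  define w1 where "w1 = w + a"
  define w2 where "w2 = v + a"
  have w12: "0 < w1" "w1 < w2" "w2 < \<delta>" using w uv a by (auto simp: w1_def w2_def)
  have translate: "\<phi> (s + (p - 1) * a) = \<phi> s + (\<tau> p - 1) * d"
    if p: "p \<in> P" "1 < p" "p < 1 + e1" and s: "w1 < s" "s < w2" for p s
  proof -
    define t where "t = s - a"
    have t: "w < t" "t < v" using s by (auto simp: t_def w1_def w2_def)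
    have "p * u < (1 + e1) * u" using p uv by simp
    then have "p * u < t" using e1u t by simp
    then have tp: "u < t / p" using p by (simp add: field_simps)
    have "0 < t" using t w uv by simp
    then have "t / p < t" using p by (simp add: field_simps)
    then have tp': "t / p < v" using t by simp
    have pa: "p * a < (1 + e1) * a" using p a by simp
    have 1: "\<phi> (p * (t / p + a)) = \<tau> p * \<phi> (t / p + a)"
    proof (rule scale[OF p(1)])
      show "0 < t / p + a" using tp uv a by simp
      show "t / p + a < \<delta>" using tp' a by simp
      have "p * (t / p + a) = t + p * a" using p by (simp add: distrib_left)
      then show "p * (t / p + a) < \<delta>" using pa t e1a by linarith
    qed
    have 2: "\<phi> (p * (t / p)) = \<tau> p * \<phi> (t / p)"
    proof (rule scale[OF p(1)])
      show "0 < t / p" using tp uv by simp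
      show "t / p < \<delta>" using tp' a by simp
      show "p * (t / p) < \<delta>" using p t a by simp
    qed
    have 3: "\<phi> (t / p + a) = m * \<phi> (t / p) + d" by (rule trans[OF tp tp'])
    have 4: "\<phi> (t + a) = m * \<phi> t + d" using t w by (intro trans) auto
    have "p * (t / p + a) = s + (p - 1) * a" "p * (t / p) = t" using p by (simp_all add: t_def field_simps)
    then have "\<phi> (s + (p - 1) * a) = \<tau> p * (m * \<phi> (t / p) + d)" "\<phi> t = \<tau> p * \<phi> (t / p)"
      using 1 2 3 by simp_all
    then show ?thesis using 4 by (simp add: t_def algebra_simps)
  qed
  \<comment> \<open>For \<open>q < 1 + e2\<close> the interval \<open>(w1, w2)\<close> and its multiple by \<open>q\<close> overlap, and \<open>s0\<close> lies in the overlap.\<close>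
  define e2 where "e2 = (w2 - w1) / (2 * w1)"
  have e2: "0 < e2" using w12 by (simp add: e2_def)
  have e2w: "(1 + e2) * w1 < w2" using w12 by (simp add: e2_def field_simps)
  have "\<tau> q = q" if q: "q \<in> P" "1 < q" "q < 1 + e2" for q
  proof -
    have "q * w1 < (1 + e2) * w1" using q w12 by simp
    then have qw: "q * w1 < w2" using e2w by simp
    have "w1 < q * w1" using q w12 by simp
    define s0 where "s0 = (q * w1 + w2) / 2"
    have s0: "q * w1 < s0" "s0 < w2" using qw by (auto simp: s0_def)
    have compare: "\<exists>x>0. \<exists>k>0. \<phi> (s0 + real n * (q * x)) = \<phi> s0 + real n * (\<tau> q * k) \<and>
        \<phi> (s0 + real j * x) = \<phi> s0 + real j * k \<and>
        s0 + real n * (q * x) < \<delta> \<and> s0 + real j * x < \<delta>" for n j :: nat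
    proof -
      define N where "N = real n * q + real j + 1"
      have N: "0 < N" using q by (simp add: N_def add_nonneg_pos)
      have "0 < min e1 ((w2 - s0) / (a * N))" using e1 s0 a N by simp
      then obtain p where p: "p \<in> P" "1 < p" "p < 1 + min e1 ((w2 - s0) / (a * N))"
        using dense by blast
      define x where "x = (p - 1) * a"
      define k where "k = (\<tau> p - 1) * d"
      have x: "0 < x" using p a by (simp add: x_def)
      have "p - 1 < (w2 - s0) / (a * N)" using p by simp
      then have xN: "x * N < w2 - s0" using a N by (simp add: x_def field_simps)
      have "x * N = real n * (q * x) + real j * x + x" by (simp add: N_def algebra_simps)
      moreover have "0 \<le> real n * (q * x)" "0 \<le> real j * x" using q x by simp_all
      ultimately have bounds: "s0 + real n * (q * x) < w2" "s0 + real j * x < w2" "s0 + 1 * x < w2"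
        using xN x by linarith+
      have step: "\<phi> (s + x) = \<phi> s + k" if "w1 < s" "s + x < w2" for s
        unfolding x_def k_def using that x p by (intro translate) (auto simp: x_def)
      have step_q: "\<phi> (s + q * x) = \<phi> s + \<tau> q * k" if s: "q * w1 < s" "s + q * x < w2" for s
      proof -
        have "w1 < s / q" using s q by (simp add: field_simps)
        have "0 < s" using s(1) q w12 by (meson less_trans mult_pos_pos zero_less_one)
        have "s / q < s" using \<open>0 < s\<close> q by (simp add: field_simps)
        moreover have "x < q * x" using q x by simp
        ultimately have sx: "s / q + x < w2" using s(2) by linarith
        have "\<phi> (q * (s / q + x)) = \<tau> q * \<phi> (s / q + x)"
        proof (rule scale[OF q(1)])
          show "0 < s / q + x" using \<open>w1 < s / q\<close> w12 x by linarith
          show "s / q + x < \<delta>" using sx w12 by linarith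
          have "q * (s / q + x) = s + q * x" using q by (simp add: distrib_left)
          then show "q * (s / q + x) < \<delta>" using s(2) w12 by linarith
        qed
        moreover have "\<phi> (q * (s / q)) = \<tau> q * \<phi> (s / q)"
        proof (rule scale[OF q(1)])
          show "0 < s / q" using \<open>w1 < s / q\<close> w12 by simp
          show "s / q < \<delta>" using sx x w12 by simp
          have "0 < q * x" using q x by simp
          then show "q * (s / q) < \<delta>" using q s(2) w12 by simp
        qed
        moreover have "\<phi> (s / q + x) = \<phi> (s / q) + k" by (rule step[OF \<open>w1 < s / q\<close> sx])
        moreover have "q * (s / q + x) = s + q * x" "q * (s / q) = s" using q by (simp_all add: field_simps)
        ultimately show ?thesis by (simp add: algebra_simps)
      qed
      have "w1 < s0" using \<open>w1 < q * w1\<close> s0 by simp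
      have "\<phi> s0 < \<phi> (s0 + x)" using x bounds w12 \<open>w1 < s0\<close> by (intro mono) auto
      then have "0 < k" using step[of s0] \<open>w1 < s0\<close> bounds by simp
      moreover have "\<phi> (s0 + real n * (q * x)) = \<phi> s0 + real n * (\<tau> q * k)"
      proof (rule iterated_translation[where l = "q * w1" and r = w2])
        show "\<phi> (s + q * x) = \<phi> s + \<tau> q * k" if "q * w1 < s" "s + q * x < w2" for s
          by (rule step_q[OF that])
      qed (use s0 q x bounds in auto)
      moreover have "\<phi> (s0 + real j * x) = \<phi> s0 + real j * k"
      proof (rule iterated_translation[where l = w1 and r = w2])
        show "\<phi> (s + x) = \<phi> s + k" if "w1 < s" "s + x < w2" for s
          by (rule step[OF that])
      qed (use \<open>w1 < s0\<close> x bounds in auto)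
      ultimately show ?thesis using x bounds w12 by (intro exI[of _ x] exI[of _ k] conjI) auto
    qed
    have "0 < q * w1" using q w12 by simp
    then have "0 < s0" using s0 by linarith
    have "q = \<tau> q"
    proof (rule eq_if_same_rational_bounds)
      show "0 < q" "0 < \<tau> q" using q \<tau>_pos by auto
    next
      fix j n :: nat assume less: "real n * q < real j"
      obtain x k where xk: "0 < x" "0 < k" "\<phi> (s0 + real n * (q * x)) = \<phi> s0 + real n * (\<tau> q * k)"
        "\<phi> (s0 + real j * x) = \<phi> s0 + real j * k" "s0 + real n * (q * x) < \<delta>" "s0 + real j * x < \<delta>"
        using compare[of n j] by blast
      have "(real n * q) * x < real j * x" using less xk(1) by (rule mult_strict_right_mono)
      then have "s0 + real n * (q * x) < s0 + real j * x" by (simp add: mult.assoc)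
      moreover have "0 < s0 + real n * (q * x)" using \<open>0 < s0\<close> q xk(1) by (simp add: add_pos_nonneg)
      ultimately have "\<phi> (s0 + real n * (q * x)) < \<phi> (s0 + real j * x)" using mono xk(6) by blast
      then have "(real n * \<tau> q) * k < real j * k" using xk(3,4) by (simp add: mult.assoc)
      then show "real n * \<tau> q \<le> real j" using xk(2) by simp
    next
      fix j n :: nat assume less: "real j < real n * q"
      obtain x k where xk: "0 < x" "0 < k" "\<phi> (s0 + real n * (q * x)) = \<phi> s0 + real n * (\<tau> q * k)"
        "\<phi> (s0 + real j * x) = \<phi> s0 + real j * k" "s0 + real n * (q * x) < \<delta>" "s0 + real j * x < \<delta>"
        using compare[of n j] by blast
      have "real j * x < (real n * q) * x" using less xk(1) by (rule mult_strict_right_mono)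
      then have "s0 + real j * x < s0 + real n * (q * x)" by (simp add: mult.assoc)
      moreover have "0 < s0 + real j * x" using \<open>0 < s0\<close> xk(1) by (simp add: add_pos_nonneg)
      ultimately have "\<phi> (s0 + real j * x) < \<phi> (s0 + real n * (q * x))" using mono xk(5) by blast
      then have "real j * k < (real n * \<tau> q) * k" using xk(3,4) by (simp add: mult.assoc)
      then show "real j \<le> real n * \<tau> q" using xk(2) by simp
    qed
    then show ?thesis by simp
  qed
  then show ?thesis using e2 by blast
qed

context pl_setting begin

lemma auto_same_left_germ:
  assumes J: "admissible J" and \<alpha>: "PLG_auto J \<alpha>" and ends: "\<alpha> ` left_kernel J = left_kernel J"
    and f: "f \<in> PLG J" "left_germ J f m c" and g: "g \<in> PLG J" "left_germ J g m c"
    and germ: "left_germ J (\<alpha> g) n d"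
  shows "left_germ J (\<alpha> f) n d"
proof -
  define k where "k = finv g \<circ> f"
  have k: "k \<in> left_kernel J" unfolding k_def by (rule same_left_germ[OF J f(1) g(1) f(2) g(2)])
  then have \<alpha>k: "\<alpha> k \<in> left_kernel J" using ends by blast
  have "f = g \<circ> k" by (simp add: k_def fun_eq_iff PLG_apply_inv[OF g(1)])
  then have "\<alpha> f = \<alpha> g \<circ> \<alpha> k" using auto_comp[OF \<alpha> g(1) left_kernel_PLG[OF k]] by simp
  moreover have "left_germ J (\<alpha> g \<circ> \<alpha> k) (n * 1) (n * 0 + d)"
    using left_kernel_iff_left_germ[OF J left_kernel_PLG[OF \<alpha>k]] \<alpha>k
    by (intro left_germ_comp[OF J auto_mem[OF \<alpha> g(1)] left_kernel_PLG[OF \<alpha>k] germ]) blast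
  ultimately show ?thesis by simp
qed

lemma affine_in_PLG:
  assumes p: "p \<in> P" and c: "c \<in> A" shows "(\<lambda>t. p * t + c) \<in> PLG UNIV"
proof (rule PLG_I[where S = "{}"])
  have pos: "0 < p" by (rule P_pos[OF p])
  show "strict_mono (\<lambda>t. p * t + c)" using pos by (intro strict_monoI) simp
  have inv: "p * ((1 / p) * (t - c)) + c = t" for t using pos by simp
  show "surj (\<lambda>t. p * t + c)" by (rule surjI[of _ "\<lambda>t. (1 / p) * (t - c)"]) (rule inv)
  show "(\<lambda>t. p * t + c) ` A = A"
  proof
    show "(\<lambda>t. p * t + c) ` A \<subseteq> A" using A_add[OF PA_mult[OF p] c] by blast
    show "A \<subseteq> (\<lambda>t. p * t + c) ` A"
    proof
      fix a assume "a \<in> A"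
      then have "(1 / p) * (a - c) \<in> A" by (intro PA_mult P_inverse p A_diff c)
      then show "a \<in> (\<lambda>t. p * t + c) ` A" by (rule image_eqI[rotated]) (rule inv[symmetric])
    qed
  qed
  show "\<exists>m\<in>P. affine_on {u<..<v} m (\<lambda>t. p * t + c)" for u v
    unfolding affine_on_def using p by blast
qed auto

lemma admissible_UNIV: "admissible UNIV"
  by (simp add: admissible_def)

section \<open>Rigidity of the slope at minus infinity\<close>

text \<open>The translation by \<open>(p - 1) * b\<close> is the commutator of the scaling by \<open>p\<close> and the translation by \<open>b\<close>, so
  its image has slope \<open>1\<close> near minus infinity and is a translation there by some \<open>d\<close>, which is an
  additive and increasing function of the translation length. Conjugation by \<open>f\<close> multiplies
  translation lengths by the slope of \<open>f\<close> on one side and by the slope of \<open>\<alpha> f\<close> on the other.\<close>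
lemma left_slope_rigid_UNIV:
  assumes \<alpha>: "PLG_auto UNIV \<alpha>" and ends: "\<alpha> ` left_kernel UNIV = left_kernel UNIV" and f: "f \<in> PLG UNIV"
  shows "left_slope UNIV (\<alpha> f) = left_slope UNIV f"
proof -
  note J = admissible_UNIV
  obtain \<phi> where mono: "\<And>s t. s < t \<Longrightarrow> \<phi> s < \<phi> t"
    and equiv: "\<And>f t. f \<in> PLG UNIV \<Longrightarrow> \<phi> (f t) = \<alpha> f (\<phi> t)"
    and unbounded: "\<And>x. \<exists>t. \<phi> t < x"
    using increasing_semiconjugacy[OF J \<alpha> ends] by (metis UNIV_I)
  define T where "T x = (\<lambda>t::real. t + x)" for x
  have T: "T x \<in> PLG UNIV" if "x \<in> A" for x
    using affine_in_PLG[OF P_one that] by (simp add: T_def)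
  have T_germ: "left_germ UNIV (T x) 1 x" for x by (auto simp: left_germ_def T_def)
  have \<alpha>T: "\<alpha> (T x) \<in> PLG UNIV" if "x \<in> A" for x by (rule auto_mem[OF \<alpha> T[OF that]])
  obtain p where p: "p \<in> P" "1 < p" by (rule P_gt_one)
  have commutator_germ: "\<exists>d. left_germ UNIV (\<alpha> (T ((p - 1) * b))) 1 d" if b: "b \<in> A" for b
  proof -
    define H where "H = (\<lambda>t. p * t + 0)"
    have H: "H \<in> PLG UNIV" unfolding H_def by (rule affine_in_PLG[OF p(1) A_zero])
    have x: "(p - 1) * b \<in> A" using A_diff[OF PA_mult[OF p(1) b] b] by (simp add: algebra_simps)
    have "H \<circ> T b = T ((p - 1) * b) \<circ> (T b \<circ> H)" by (simp add: fun_eq_iff H_def T_def algebra_simps)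
    then have "\<alpha> H \<circ> \<alpha> (T b) = \<alpha> (T ((p - 1) * b)) \<circ> (\<alpha> (T b) \<circ> \<alpha> H)"
      using auto_comp[OF \<alpha> H T[OF b]] auto_comp[OF \<alpha> T[OF x] PLG_comp[OF T[OF b] H]]
        auto_comp[OF \<alpha> T[OF b] H] by simp
    then have "left_slope UNIV (\<alpha> H) * left_slope UNIV (\<alpha> (T b)) =
        left_slope UNIV (\<alpha> (T ((p - 1) * b))) * (left_slope UNIV (\<alpha> (T b)) * left_slope UNIV (\<alpha> H))"
      using left_slope_comp[OF J] \<alpha>T b x auto_mem[OF \<alpha> H] PLG_comp by metis
    moreover have "0 < left_slope UNIV (\<alpha> H)" "0 < left_slope UNIV (\<alpha> (T b))"
      using P_pos left_slope_in_P[OF J] auto_mem[OF \<alpha> H] \<alpha>T[OF b] by blast+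
    ultimately have "left_slope UNIV (\<alpha> (T ((p - 1) * b))) = 1" by simp
    then show ?thesis using left_germ_left_slope[OF J \<alpha>T[OF x]] by metis
  qed
  have germ_mono: "d < d'"
    if x: "x \<in> A" "left_germ UNIV (\<alpha> (T x)) 1 d" and x': "x' \<in> A" "left_germ UNIV (\<alpha> (T x')) 1 d'"
      and less: "x < x'" for x x' d d'
  proof -
    obtain y where y: "\<forall>t<y. \<alpha> (T x) t = 1 * t + d" using x(2) unfolding left_germ_def by auto
    obtain y' where y': "\<forall>t<y'. \<alpha> (T x') t = 1 * t + d'" using x'(2) unfolding left_germ_def by auto
    obtain t where t: "\<phi> t < min y y'" using unbounded by blast
    have "\<phi> (t + x) = \<phi> t + d" "\<phi> (t + x') = \<phi> t + d'"
      using equiv[OF T[OF x(1)], of t] equiv[OF T[OF x'(1)], of t] y y' t by (simp_all add: T_def)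
    then show ?thesis using mono[of "t + x" "t + x'"] less by simp
  qed
  have germ_mult: "left_germ UNIV (\<alpha> (T (real n * x))) 1 (real n * d)"
    if x: "x \<in> A" and d: "left_germ UNIV (\<alpha> (T x)) 1 d" for x d n
  proof (induction n)
    case 0
    have "T (real 0 * x) = id" "real 0 * d = 0" by (simp_all add: T_def fun_eq_iff)
    then show ?case by (simp only: auto_id[OF \<alpha>] left_germ_id[OF J])
  next
    case (Suc n)
    have nx: "real n * x \<in> A" by (rule A_of_nat_mult[OF x])
    have "T (real (Suc n) * x) = T x \<circ> T (real n * x)" by (simp add: T_def fun_eq_iff algebra_simps)
    then have "\<alpha> (T (real (Suc n) * x)) = \<alpha> (T x) \<circ> \<alpha> (T (real n * x))"
      by (simp only: auto_comp[OF \<alpha> T[OF x] T[OF nx]])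
    moreover have "1 * (real n * d) + d = real (Suc n) * d" by (simp add: algebra_simps)
    ultimately show ?case
      using left_germ_comp[OF J \<alpha>T[OF x] \<alpha>T[OF nx] d Suc.IH] by (simp only: mult_1)
  qed
  obtain a where a: "a \<in> A" "0 < a" using A_dense[of 0 1] by auto
  define q where "q = left_slope UNIV f"
  define q' where "q' = left_slope UNIV (\<alpha> f)"
  have q: "q \<in> P" unfolding q_def by (rule left_slope_in_P[OF J f])
  have q': "q' \<in> P" unfolding q'_def by (rule left_slope_in_P[OF J auto_mem[OF \<alpha> f]])
  define x where "x = (p - 1) * a"
  have x: "x \<in> A" "0 < x"
    using A_diff[OF PA_mult[OF p(1) a(1)] a(1)] p a by (auto simp: x_def algebra_simps)
  have qx: "q * x \<in> A" by (rule PA_mult[OF q x(1)])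
  obtain d where d: "left_germ UNIV (\<alpha> (T x)) 1 d" using commutator_germ[OF a(1)] by (auto simp: x_def)
  have "q * x = (p - 1) * (q * a)" by (simp add: x_def)
  then obtain d' where d': "left_germ UNIV (\<alpha> (T (q * x))) 1 d'"
    using commutator_germ[OF PA_mult[OF q a(1)]] by auto
  have "T 0 = id" by (simp add: T_def fun_eq_iff)
  then have "left_germ UNIV (\<alpha> (T 0)) 1 0" by (simp only: auto_id[OF \<alpha>] left_germ_id[OF J])
  then have "0 < d" by (rule germ_mono[OF A_zero _ x(1) d x(2)])
  obtain c where c: "left_germ UNIV f q c" unfolding q_def by (rule left_germ_left_slope[OF J f])
  obtain c' where c': "left_germ UNIV (\<alpha> f) q' c'"
    unfolding q'_def by (rule left_germ_left_slope[OF J auto_mem[OF \<alpha> f]])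
  have "d' = q' * d"
  proof -
    have 1: "left_germ UNIV (f \<circ> T x) (q * 1) (q * x + c)" by (rule left_germ_comp[OF J f T[OF x(1)] c T_germ])
    have 2: "left_germ UNIV (T (q * x) \<circ> f) (1 * q) (1 * c + q * x)"
      by (rule left_germ_comp[OF J T[OF qx] f T_germ c])
    have "left_germ UNIV (\<alpha> (T (q * x)) \<circ> \<alpha> f) (1 * q') (1 * c' + d')"
      by (rule left_germ_comp[OF J \<alpha>T[OF qx] auto_mem[OF \<alpha> f] d' c'])
    then have "left_germ UNIV (\<alpha> (T (q * x) \<circ> f)) q' (c' + d')" by (simp add: auto_comp[OF \<alpha> T[OF qx] f])
    then have "left_germ UNIV (\<alpha> (f \<circ> T x)) q' (c' + d')"
      using auto_same_left_germ[OF J \<alpha> ends PLG_comp[OF f T[OF x(1)]] _ PLG_comp[OF T[OF qx] f]] 1 2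
      by (simp add: add.commute)
    moreover have "left_germ UNIV (\<alpha> (f \<circ> T x)) (q' * 1) (q' * d + c')"
      using left_germ_comp[OF J auto_mem[OF \<alpha> f] \<alpha>T[OF x(1)] c' d] by (simp add: auto_comp[OF \<alpha> f T[OF x(1)]])
    ultimately show ?thesis using left_germ_unique(2)[OF J] by force
  qed
  have "q = q'"
  proof (rule eq_if_same_rational_bounds)
    show "0 < q" "0 < q'" using P_pos q q' by auto
  next
    fix m n assume "real n * q < real m"
    then have "(real n * q) * x < real m * x" using x(2) by (rule mult_strict_right_mono)
    then have "real n * (q * x) < real m * x" by (simp add: mult.assoc)
    then have "real n * d' < real m * d"
      by (rule germ_mono[OF A_of_nat_mult[OF qx] germ_mult[OF qx d'] A_of_nat_mult[OF x(1)] germ_mult[OF x(1) d]])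
    then have "(real n * q') * d < real m * d" by (simp add: \<open>d' = q' * d\<close> mult.assoc)
    then show "real n * q' \<le> real m" using \<open>0 < d\<close> by simp
  next
    fix m n assume "real m < real n * q"
    then have "real m * x < (real n * q) * x" using x(2) by (rule mult_strict_right_mono)
    then have "real m * x < real n * (q * x)" by (simp add: mult.assoc)
    then have "real m * d < real n * d'"
      by (rule germ_mono[OF A_of_nat_mult[OF x(1)] germ_mult[OF x(1) d] A_of_nat_mult[OF qx] germ_mult[OF qx d']])
    then have "real m * d < (real n * q') * d" by (simp add: \<open>d' = q' * d\<close> mult.assoc)
    then show "real m \<le> real n * q'" using \<open>0 < d\<close> by simp
  qed
  then show ?thesis by (simp add: q_def q'_def)
qed


section \<open>Rigidity of the slope at zero\<close>
lemma left_germ_at_zero: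
  assumes J: "admissible J" and zero: "\<forall>t\<in>J. 0 < t \<and> {0<..t} \<subseteq> J"
    and g: "g \<in> PLG J" "left_germ J g m c"
  shows "c = 0"
proof -
  obtain y where y: "y \<in> J" "\<forall>t\<in>J. t < y \<longrightarrow> g t = m * t + c"
    using g(2) unfolding left_germ_def by blast
  have "\<forall>t\<in>{0<..<y}. g t = m * t + c"
  proof
    fix t assume "t \<in> {0<..<y}"
    then have "t \<in> {0<..y}" "t < y" by auto
    then show "g t = m * t + c" using y zero by blast
  qed
  moreover have "isCont g 0" using PLG_continuous[OF g(1)] by (simp add: continuous_on_eq_continuous_at)
  ultimately have "g 0 = m * 0 + c"
    using affine_right_of_point(1)[of 0 y g m c] y(1) zero by blast
  moreover have "g 0 = 0" using PLG_outside[OF g(1)] zero by blast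
  ultimately show ?thesis by simp
qed

text \<open>Every element of \<open>P\<close> is a power of \<open>p\<close> times an element of \<open>P\<close> between \<open>1\<close> and \<open>p\<close>.\<close>
lemma multiplicative_rigid:
  assumes p: "p \<in> P" "1 < p"
    and mult: "\<And>q r. q \<in> P \<Longrightarrow> r \<in> P \<Longrightarrow> \<tau> (q * r) = \<tau> q * (\<tau> r :: real)"
    and fixed: "\<And>q. q \<in> P \<Longrightarrow> 1 \<le> q \<Longrightarrow> q \<le> p \<Longrightarrow> \<tau> q = q"
    and q: "q \<in> P"
  shows "\<tau> q = q"
proof -
  have power: "\<tau> (p ^ n) = p ^ n" for n
  proof (induction n)
    case (Suc n) then show ?case using mult[OF p(1) P_power[OF p(1), of n]] fixed[OF p(1)] p(2) by simp
  qed (use fixed[OF P_one] p in simp)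
  have large: "\<tau> r = r" if r: "r \<in> P" "1 \<le> r" for r
  proof -
    define N where "N = (LEAST n. r < p ^ n)"
    have ex: "\<exists>n. r < p ^ n" using real_arch_pow[OF p(2)] by blast
    then have N: "r < p ^ N" unfolding N_def by (rule LeastI_ex)
    have "N \<noteq> 0" using N r by (intro notI) simp
    then obtain M where M: "N = Suc M" using not0_implies_Suc by blast
    have "M < N" using M by simp
    then have "p ^ M \<le> r" using not_less_Least[of M "\<lambda>n. r < p ^ n"] unfolding N_def by simp
    define s where "s = r * (1 / p ^ M)"
    have pM: "0 < p ^ M" using p by simp
    have s: "s \<in> P" unfolding s_def by (intro P_mult r P_inverse P_power p)
    have "1 \<le> s" using \<open>p ^ M \<le> r\<close> pM by (simp add: s_def field_simps)
    have "s \<le> p" using N M pM by (simp add: s_def field_simps)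
    have "r = p ^ M * s" using p(2) by (simp add: s_def)
    then show ?thesis using mult[OF P_power[OF p(1), of M] s] power fixed[OF s \<open>1 \<le> s\<close> \<open>s \<le> p\<close>] by simp
  qed
  show ?thesis
  proof (cases "1 \<le> q")
    case True then show ?thesis using large q by blast
  next
    case False
    have "0 < q" by (rule P_pos[OF q])
    then have inv: "1 / q \<in> P" "1 \<le> 1 / q" using False P_inverse[OF q] by (auto simp: field_simps)
    have "\<tau> (q * (1 / q)) = \<tau> q * (1 / q)" using mult[OF q inv(1)] large[OF inv] by simp
    then have "1 = \<tau> q * (1 / q)" using fixed[OF P_one] p(2) \<open>0 < q\<close> by simp
    then show ?thesis using \<open>0 < q\<close> by (simp add: field_simps)
  qed
qed

text \<open>If the elements of \<open>P\<close> above \<open>1\<close> stay away from \<open>1\<close>, then quotients of two of them that are close to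
  their infimum must be \<open>1\<close>, so the infimum is attained.\<close>
lemma discrete_or_dense:
  obtains p where "p \<in> P" "1 < p" "\<And>q. q \<in> P \<Longrightarrow> 1 < q \<Longrightarrow> p \<le> q"
  | "\<And>e. 0 < e \<Longrightarrow> \<exists>p\<in>P. 1 < p \<and> p < 1 + e"
proof (cases "\<forall>e>0. \<exists>p\<in>P. 1 < p \<and> p < 1 + e")
  case False
  then obtain e where e: "0 < e" "\<And>p. p \<in> P \<Longrightarrow> 1 < p \<Longrightarrow> 1 + e \<le> p" by force
  define Q where "Q = {p\<in>P. 1 < p}"
  define p where "p = Inf Q"
  have ne: "Q \<noteq> {}" using P_gt_one unfolding Q_def by blast
  have bdd: "bdd_below Q" by (rule bdd_belowI[of _ 1]) (simp add: Q_def)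
  have lower: "p \<le> q" if "q \<in> Q" for q unfolding p_def by (rule cInf_lower[OF that bdd])
  have "1 + e \<le> p" unfolding p_def using ne e by (intro cInf_greatest) (auto simp: Q_def)
  then have "p < p * (1 + e)" using e by simp
  then obtain q where q: "q \<in> Q" "q < p * (1 + e)" using cInf_lessD[OF ne] unfolding p_def by blast
  have "q \<le> r" if r: "r \<in> Q" for r
  proof (rule ccontr)
    assume "\<not> q \<le> r"
    then have "r < q" by simp
    have r1: "0 < r" "r \<in> P" using r by (auto simp: Q_def)
    have "1 < q * (1 / r)" using \<open>r < q\<close> r1 by (simp add: field_simps)
    moreover have "q * (1 / r) \<in> P" using q r by (intro P_mult P_inverse) (auto simp: Q_def)
    ultimately have "1 + e \<le> q * (1 / r)" using e(2) by blast
    then have "r * (1 + e) \<le> q" using r1 by (simp add: field_simps)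
    moreover have "p * (1 + e) \<le> r * (1 + e)" using lower[OF r] e by simp
    ultimately show False using q(2) by linarith
  qed
  then show ?thesis using that(1)[of q] q(1) by (simp add: Q_def)
qed (use that(2) in blast)

text \<open>At the end \<open>0\<close> the germ is determined by the slope, so \<open>\<alpha>\<close> induces an automorphism \<open>\<tau>\<close> of \<open>P\<close>, and \<open>\<phi>\<close>
  shows that \<open>\<tau>\<close> preserves the order. If \<open>P\<close> has a least element above \<open>1\<close>, this element is fixed by
  \<open>\<tau>\<close>. Otherwise a bump with a translating middle part near \<open>0\<close> provides the translation that
  \<open>scaling_rigid_if_translation\<close> asks for.\<close>
lemma left_slope_rigid_zero:
  assumes J: "admissible J" and zero: "\<forall>t\<in>J. 0 < t \<and> {0<..t} \<subseteq> J"
    and \<alpha>: "PLG_auto J \<alpha>" and ends: "\<alpha> ` left_kernel J = left_kernel J" and f: "f \<in> PLG J"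
  shows "left_slope J (\<alpha> f) = left_slope J f"
proof -
  obtain \<phi> where \<phi>_J: "\<And>t. t \<in> J \<Longrightarrow> \<phi> t \<in> J"
    and \<phi>_mono: "\<And>s t. s \<in> J \<Longrightarrow> t \<in> J \<Longrightarrow> s < t \<Longrightarrow> \<phi> s < \<phi> t"
    and \<phi>_equiv: "\<And>f t. f \<in> PLG J \<Longrightarrow> t \<in> J \<Longrightarrow> \<phi> (f t) = \<alpha> f (\<phi> t)"
    and \<phi>_small: "\<And>x. x \<in> J \<Longrightarrow> \<exists>t\<in>J. \<phi> t < x"
    by (rule increasing_semiconjugacy[OF J \<alpha> ends]) blast
  have pos: "0 < t" if "t \<in> J" for t using zero that by blast
  have down: "s \<in> J" if "t \<in> J" "0 < s" "s \<le> t" for s t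
  proof -
    have "s \<in> {0<..t}" using that by simp
    then show ?thesis using zero that(1) by blast
  qed
  have germ: "left_germ J g (left_slope J g) 0" if g: "g \<in> PLG J" for g
    using left_germ_left_slope[OF J g] left_germ_at_zero[OF J zero g] by metis
  obtain y0 where y0: "y0 \<in> J" using J unfolding admissible_def by blast
  have ex_slope: "\<exists>g\<in>PLG J. left_slope J g = p" if p: "p \<in> P" for p
    by (rule exists_left_slope[OF J y0 p]) (use left_slope_eq[OF J] in blast)
  define \<tau> where "\<tau> p = left_slope J (\<alpha> (SOME g. g \<in> PLG J \<and> left_slope J g = p))" for p
  have \<tau>: "left_slope J (\<alpha> g) = \<tau> (left_slope J g)" if g: "g \<in> PLG J" for g
  proof -
    define h where "h = (SOME h. h \<in> PLG J \<and> left_slope J h = left_slope J g)"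
    have "h \<in> PLG J \<and> left_slope J h = left_slope J g" unfolding h_def by (rule someI[of _ g]) (use g in simp)
    then have h: "h \<in> PLG J" "left_slope J h = left_slope J g" by auto
    have "left_germ J (\<alpha> g) (left_slope J (\<alpha> h)) 0"
    proof (rule auto_same_left_germ[of J \<alpha> g "left_slope J g" 0 h])
      show "left_germ J h (left_slope J g) 0" using germ[OF h(1)] h(2) by simp
    qed (rule J \<alpha> ends g h(1) germ[OF g] germ[OF auto_mem[OF \<alpha> h(1)]])+
    then have "left_slope J (\<alpha> g) = left_slope J (\<alpha> h)" by (rule left_slope_eq[OF J])
    then show ?thesis unfolding \<tau>_def h_def .
  qed
  have \<tau>_P: "\<tau> p \<in> P" if p: "p \<in> P" for p
  proof -
    obtain g where g: "g \<in> PLG J" "left_slope J g = p" using ex_slope[OF p] by blast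
    then show ?thesis using \<tau>[OF g(1)] left_slope_in_P[OF J auto_mem[OF \<alpha> g(1)]] by simp
  qed
  have \<tau>_pos: "0 < \<tau> p" if "p \<in> P" for p using P_pos[OF \<tau>_P[OF that]] .
  have \<tau>_mult: "\<tau> (p * q) = \<tau> p * \<tau> q" if pq: "p \<in> P" "q \<in> P" for p q
  proof -
    obtain g where g: "g \<in> PLG J" "left_slope J g = p" using ex_slope[OF pq(1)] by blast
    obtain h where h: "h \<in> PLG J" "left_slope J h = q" using ex_slope[OF pq(2)] by blast
    have "\<tau> (p * q) = left_slope J (\<alpha> (g \<circ> h))"
      using \<tau>[OF PLG_comp[OF g(1) h(1)]] left_slope_comp[OF J g(1) h(1)] g(2) h(2) by simp
    also have "\<dots> = left_slope J (\<alpha> g) * left_slope J (\<alpha> h)"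
      by (simp only: auto_comp[OF \<alpha> g(1) h(1)] left_slope_comp[OF J auto_mem[OF \<alpha> g(1)] auto_mem[OF \<alpha> h(1)]])
    also have "\<dots> = \<tau> p * \<tau> q" using \<tau>[OF g(1)] \<tau>[OF h(1)] g(2) h(2) by simp
    finally show ?thesis .
  qed
  have \<tau>_one: "\<tau> 1 = 1" using \<tau>_mult[OF P_one P_one] \<tau>_pos[OF P_one] by simp
  have \<tau>_surj: "\<exists>p\<in>P. \<tau> p = r" if r: "r \<in> P" for r
  proof -
    obtain g where g: "g \<in> PLG J" "left_slope J g = r" using ex_slope[OF r] by blast
    obtain h where h: "h \<in> PLG J" "g = \<alpha> h" by (rule auto_surj[OF \<alpha> g(1)])
    have "\<tau> (left_slope J h) = r" using \<tau>[OF h(1)] h(2) g(2) by simp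
    then show ?thesis using left_slope_in_P[OF J h(1)] by blast
  qed
  \<comment> \<open>The relation \<open>\<phi> (p * t) = \<tau> p * \<phi> t\<close> holds near \<open>0\<close>, but how near depends on \<open>p\<close>.\<close>
  have local_scale: "\<exists>y\<in>J. \<forall>t. 0 < t \<and> t < y \<longrightarrow> p * t \<in> J \<and> \<phi> (p * t) = \<tau> p * \<phi> t" if p: "p \<in> P" for p
  proof -
    obtain g where g: "g \<in> PLG J" "left_slope J g = p" using ex_slope[OF p] by blast
    obtain y where y: "y \<in> J" "\<forall>t\<in>J. t < y \<longrightarrow> g t = p * t + 0"
      using germ[OF g(1)] g(2) unfolding left_germ_def by blast
    have "left_germ J (\<alpha> g) (\<tau> p) 0"
      using germ[OF auto_mem[OF \<alpha> g(1)]] \<tau>[OF g(1)] g(2) by simp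
    then obtain y' where y': "y' \<in> J" "\<forall>t\<in>J. t < y' \<longrightarrow> \<alpha> g t = \<tau> p * t + 0"
      unfolding left_germ_def by blast
    obtain x where x: "x \<in> J" "\<phi> x < y'" using \<phi>_small[OF y'(1)] by blast
    have "p * t \<in> J \<and> \<phi> (p * t) = \<tau> p * \<phi> t" if t: "0 < t" "t < min x y" for t
    proof -
      have tJ: "t \<in> J" using down[OF y(1)] t by simp
      have gt: "g t = p * t" using y(2) tJ t by simp
      have "\<phi> t < y'" using \<phi>_mono[OF tJ x(1)] x(2) t by simp
      then have "\<alpha> g (\<phi> t) = \<tau> p * \<phi> t" using y'(2) \<phi>_J[OF tJ] by simp
      then show ?thesis using \<phi>_equiv[OF g(1) tJ] PLG_mem[OF g(1), of t] tJ gt by simp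
    qed
    then show ?thesis using admissible_min[OF J x(1) y(1)] by blast
  qed
  obtain p1 where p1: "p1 \<in> P" "1 < p1" by (rule P_gt_one)
  define p0 where "p0 = 1 / p1"
  have p0: "p0 \<in> P" "0 < p0" "p0 < 1" using P_inverse[OF p1(1)] p1(2) by (auto simp: p0_def)
  obtain \<delta> where \<delta>: "\<delta> \<in> J" "\<forall>t. 0 < t \<and> t < \<delta> \<longrightarrow> p0 * t \<in> J \<and> \<phi> (p0 * t) = \<tau> p0 * \<phi> t"
    using local_scale[OF p0(1)] by blast
  have below_\<delta>: "t \<in> J" if "0 < t" "t < \<delta>" for t using down[OF \<delta>(1)] that by simp
  have contract: "p0 ^ n * t < \<delta> \<and> 0 < p0 ^ n * t \<and> \<phi> (p0 ^ n * t) = \<tau> p0 ^ n * \<phi> t"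
    if t: "0 < t" "t < \<delta>" for t n
  proof (induction n)
    case (Suc n)
    define s where "s = p0 ^ n * t"
    have s: "s < \<delta>" "0 < s" "\<phi> s = \<tau> p0 ^ n * \<phi> t" using Suc.IH by (simp_all add: s_def)
    have "p0 * s < s" "0 < p0 * s" using s(2) p0 by simp_all
    moreover have "\<phi> (p0 * s) = \<tau> p0 ^ Suc n * \<phi> t" using \<delta>(2) s by (simp add: mult.assoc)
    moreover have eq: "p0 ^ Suc n * t = p0 * s" by (simp add: s_def)
    ultimately show ?case unfolding eq using s(1) by linarith
  qed (use t in simp)
  \<comment> \<open>A bound \<open>\<delta>\<close> independent of \<open>p\<close> results from pulling \<open>t\<close> towards \<open>0\<close> with the single scaling \<open>p0\<close>.\<close>
  have scale: "\<phi> (p * t) = \<tau> p * \<phi> t" if p: "p \<in> P" and t: "0 < t" "t < \<delta>" "p * t < \<delta>" for p t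
  proof -
    obtain y where y: "y \<in> J" "\<forall>t. 0 < t \<and> t < y \<longrightarrow> p * t \<in> J \<and> \<phi> (p * t) = \<tau> p * \<phi> t"
      using local_scale[OF p] by blast
    have "0 < y / t" using pos[OF y(1)] t by simp
    then obtain n where n: "p0 ^ n < y / t" using real_arch_pow_inv[OF _ p0(3)] by blast
    then have small: "p0 ^ n * t < y" using t by (simp add: field_simps)
    have pt: "0 < p * t" using P_pos[OF p] t by simp
    have "\<tau> p0 ^ n * \<phi> (p * t) = \<phi> (p0 ^ n * (p * t))" using contract[OF pt t(3), of n] by simp
    also have "\<dots> = \<phi> (p * (p0 ^ n * t))" by (simp add: mult.left_commute)
    also have "\<dots> = \<tau> p * \<phi> (p0 ^ n * t)" using y(2) small contract[OF t(1,2), of n] by blast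
    also have "\<dots> = \<tau> p0 ^ n * (\<tau> p * \<phi> t)" using contract[OF t(1,2), of n] by simp
    finally have "\<tau> p0 ^ n * \<phi> (p * t) = \<tau> p0 ^ n * (\<tau> p * \<phi> t)" .
    moreover have "\<tau> p0 ^ n \<noteq> 0" using \<tau>_pos[OF p0(1)] by simp
    ultimately show ?thesis by (metis mult_left_cancel)
  qed
  have \<tau>_gt: "1 < \<tau> p" if p: "p \<in> P" "1 < p" for p
  proof -
    have "0 < \<delta>" using pos[OF \<delta>(1)] .
    define t where "t = \<delta> / (2 * p)"
    have t: "0 < t" "t < \<delta>" "p * t < \<delta>" "t < p * t"
      using \<open>0 < \<delta>\<close> p by (auto simp: t_def field_simps)
    have pt: "0 < p * t" using t by linarith
    have "\<phi> t < \<tau> p * \<phi> t"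
      using \<phi>_mono[OF below_\<delta>[OF t(1,2)] below_\<delta>[OF pt t(3)] t(4)] scale[OF p(1) t(1-3)] by simp
    then have "0 < (\<tau> p - 1) * \<phi> t" by (simp add: algebra_simps)
    then show ?thesis using pos[OF \<phi>_J[OF below_\<delta>[OF t(1,2)]]] by (simp add: zero_less_mult_iff)
  qed
  have \<tau>_mono: "\<tau> p \<le> \<tau> q" if pq: "p \<in> P" "q \<in> P" "p \<le> q" for p q
  proof (cases "p = q")
    case False
    have "0 < p" by (rule P_pos[OF pq(1)])
    then have r: "q * (1 / p) \<in> P" "1 < q * (1 / p)"
      using False pq P_mult[OF pq(2) P_inverse[OF pq(1)]] by (auto simp: field_simps)
    have "q = p * (q * (1 / p))" using \<open>0 < p\<close> by simp
    then have "\<tau> q = \<tau> p * \<tau> (q * (1 / p))" using \<tau>_mult[OF pq(1) r(1)] by simp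
    then show ?thesis using \<tau>_gt[OF r] \<tau>_pos[OF pq(1)] by simp
  qed simp
  have "\<exists>p\<in>P. 1 < p \<and> (\<forall>q\<in>P. 1 < q \<and> q \<le> p \<longrightarrow> \<tau> q = q)"
  proof (rule discrete_or_dense)
    fix p assume p: "p \<in> P" "1 < p" "\<And>q. q \<in> P \<Longrightarrow> 1 < q \<Longrightarrow> p \<le> q"
    obtain r where r: "r \<in> P" "\<tau> r = p" using \<tau>_surj[OF p(1)] by blast
    have "1 < r"
    proof (rule ccontr)
      assume "\<not> 1 < r"
      then have "\<tau> r \<le> 1" using \<tau>_mono[OF r(1) P_one] \<tau>_one by simp
      then show False using r p by simp
    qed
    then have "\<tau> p \<le> p" using \<tau>_mono[OF p(1) r(1) p(3)[OF r(1)]] r(2) by simp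
    moreover have "p \<le> \<tau> p" by (rule p(3)[OF \<tau>_P[OF p(1)] \<tau>_gt[OF p(1,2)]])
    ultimately have "\<tau> p = p" by simp
    then show ?thesis using p by (metis order_antisym)
  next
    assume dense: "\<And>e. 0 < e \<Longrightarrow> \<exists>p\<in>P. 1 < p \<and> p < 1 + e"
    obtain c where c: "c \<in> A" "0 < c" "c < \<delta>" using A_dense pos[OF \<delta>(1)] by blast
    have "0 < (\<delta> - c) / (2 + p1)" using c p1 by simp
    then obtain b where b: "b \<in> A" "0 < b" "b < (\<delta> - c) / (2 + p1)" by (rule A_dense)
    have room: "c + b + b + p1 * b < \<delta>" using b(3) p1 by (simp add: field_simps)
    define h where "h = bump c p1 b b"
    have "{c<..<c + b + b + p1 * b} \<subseteq> J"
    proof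
      fix t assume "t \<in> {c<..<c + b + b + p1 * b}"
      then show "t \<in> J" using below_\<delta> c room by simp
    qed
    then have h: "h \<in> PLG J" unfolding h_def using b by (intro bump_in_PLG c p1 b) auto
    define u where "u = c + b"
    define v where "v = c + b + b"
    define a where "a = (p1 - 1) * b"
    have a: "0 < a" using p1 b by (simp add: a_def)
    have u: "0 < u" "u < v" using b c by (auto simp: u_def v_def)
    have va: "v + a < \<delta>" using room b by (simp add: v_def a_def algebra_simps)
    have h_trans: "h t = t + a" if "u < t" "t < v" for t
      unfolding h_def a_def using that b p1 by (intro bump_translating) (auto simp: u_def v_def)
    have uvJ: "t \<in> J" if "u \<le> t" "t \<le> v" for t using below_\<delta>[of t] that u va a by simp
    \<comment> \<open>The values of \<open>\<phi>\<close> just to the right of \<open>u\<close> accumulate at \<open>z\<close>, and \<open>\<alpha> h\<close> is affine on some interval \<open>(z, w)\<close>.\<close>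
    define z where "z = Inf (\<phi> ` {u<..<v})"
    have bdd: "bdd_below (\<phi> ` {u<..<v})"
      using \<phi>_mono[OF uvJ uvJ, of u] u by (intro bdd_belowI2[of _ "\<phi> u"]) (simp add: less_imp_le)
    have ne: "\<phi> ` {u<..<v} \<noteq> {}" using u by simp
    obtain S where S: "finite S" "S \<subseteq> A"
      "\<And>u v. u < v \<Longrightarrow> {u<..<v} \<inter> S = {} \<Longrightarrow> \<exists>m\<in>P. affine_on {u<..<v} m (\<alpha> h)"
      using PLG_pieces[OF auto_mem[OF \<alpha> h]] by blast
    obtain w where w: "z < w" "w \<le> z + 1" "{z<..<w} \<inter> S = {}"
      by (rule subinterval_avoiding_finite[OF S(1), of z "z + 1"]) simp_all
    obtain m d where md: "m \<in> P" "\<forall>t\<in>{z<..<w}. \<alpha> h t = m * t + d"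
      using S(3)[OF w(1,3)] unfolding affine_on_def by (elim bexE exE) (rule that)
    obtain v' where v': "u < v'" "v' < v" "\<phi> v' < w"
      using cInf_lessD[OF ne w(1)[unfolded z_def]] by auto
    have trans: "\<phi> (t + a) = m * \<phi> t + d" if t: "u < t" "t < v'" for t
    proof -
      have tJ: "t \<in> J" using t v' by (intro uvJ) auto
      define s where "s = (u + t) / 2"
      have s: "u < s" "s < t" "s < v" using t v' by (auto simp: s_def)
      have "z \<le> \<phi> s" unfolding z_def using s bdd by (intro cInf_lower) auto
      moreover have "\<phi> s < \<phi> t" using \<phi>_mono[OF uvJ tJ] s by simp
      moreover have "\<phi> t < \<phi> v'" using \<phi>_mono[OF tJ uvJ] t v' by simp
      ultimately have "\<phi> t \<in> {z<..<w}" using v'(3) by simp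
      then have "\<alpha> h (\<phi> t) = m * \<phi> t + d" using md(2) by blast
      then show ?thesis using \<phi>_equiv[OF h tJ] h_trans[of t] t v' by simp
    qed
    have "\<exists>e>0. \<forall>q\<in>P. 1 < q \<and> q < 1 + e \<longrightarrow> \<tau> q = q"
    proof (rule scaling_rigid_if_translation[of P \<delta> \<phi> \<tau> u v' a m d])
      show "\<phi> s < \<phi> t" if "0 < s" "s < t" "t < \<delta>" for s t
        using that by (intro \<phi>_mono below_\<delta>) auto
      show "v' + a < \<delta>" using va v' by simp
    qed (use dense scale \<tau>_pos u v' a trans in blast)+
    then obtain e where e: "0 < e" "\<forall>q\<in>P. 1 < q \<and> q < 1 + e \<longrightarrow> \<tau> q = q" by blast
    obtain p where "p \<in> P" "1 < p" "p < 1 + e" using dense[OF e(1)] by blast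
    then show ?thesis using e(2) by (meson le_less_trans)
  qed
  then obtain p where p: "p \<in> P" "1 < p" "\<forall>q\<in>P. 1 < q \<and> q \<le> p \<longrightarrow> \<tau> q = q" by blast
  have "\<tau> q = q" if "q \<in> P" "1 \<le> q" "q \<le> p" for q
    using p(3) that \<tau>_one by (cases "q = 1") auto
  then have "\<tau> (left_slope J f) = left_slope J f"
    using multiplicative_rigid[OF p(1,2) \<tau>_mult] left_slope_in_P[OF J f] by blast
  then show ?thesis using \<tau>[OF f] by simp
qed


section \<open>The invariant character\<close>
lemma infinite_P: "infinite P"
proof
  assume fin: "finite P"
  obtain p where p: "p \<in> P" "1 < p" by (rule P_gt_one)
  obtain n where "Max P < p ^ n" using real_arch_pow[OF p(2)] by blast
  then show False using Max_ge[OF fin P_power[OF p(1), of n]] by simp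
qed

lemma G_PL_mult: "f \<otimes>\<^bsub>G_PL I A P\<^esub> g = f \<circ> g"
  and G_PL_one: "\<one>\<^bsub>G_PL I A P\<^esub> = id"
  by (simp_all add: G_PL_def PL_o_group_def)

lemma group_G_PL: "group (G_PL I A P)"
proof (rule groupI)
  fix g assume "g \<in> carrier (G_PL I A P)"
  then have "g \<in> PLG (interior I)" by (simp add: carrier_G_PL)
  then show "\<exists>h\<in>carrier (G_PL I A P). h \<otimes>\<^bsub>G_PL I A P\<^esub> g = \<one>\<^bsub>G_PL I A P\<^esub>"
    unfolding carrier_G_PL G_PL_mult G_PL_one
    by (intro bexI[of _ "finv g"] PLG_inv PLG_inv_comp)
qed (simp_all add: carrier_G_PL PLG_id PLG_comp G_PL_mult G_PL_one comp_assoc)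

lemma iso_PLG_auto:
  assumes "\<alpha> \<in> iso (G_PL I A P) (G_PL I A P)" shows "PLG_auto (interior I) \<alpha>"
  using assms unfolding iso_def hom_def PLG_auto_def by (simp add: carrier_G_PL G_PL_mult)

definition invariant_slope :: "real set \<Rightarrow> ((real \<Rightarrow> real) \<Rightarrow> real) \<Rightarrow> bool" where
  "invariant_slope J \<psi> \<longleftrightarrow> \<psi> ` PLG J = P \<and>
     (\<forall>f\<in>PLG J. \<forall>g\<in>PLG J. \<psi> (f \<circ> g) = \<psi> f * \<psi> g) \<and>
     (\<forall>\<alpha>. PLG_auto J \<alpha> \<longrightarrow> (\<forall>g\<in>PLG J. \<psi> (\<alpha> g) = \<psi> g))"

lemma exists_left_slope_fixing_right:
  assumes J: "admissible J" and p: "p \<in> P"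
  obtains f where "f \<in> right_kernel J" "left_slope J f = p"
proof -
  obtain y where y: "y \<in> J" using J unfolding admissible_def by blast
  obtain f c where f: "f \<in> PLG J" "left_germ J f p c" "\<forall>t\<ge>y. f t = t"
    by (rule exists_left_slope[OF J y p])
  then have "f \<in> right_kernel J" using y unfolding right_kernel_def by blast
  then show ?thesis using that left_slope_eq[OF J f(2)] by blast
qed

lemma left_slope_left_kernel:
  assumes "admissible J" "f \<in> left_kernel J" shows "left_slope J f = 1"
  using assms left_kernel_iff_left_germ[OF assms(1) left_kernel_PLG] left_slope_eq by blast

text \<open>The slope at the right end is the left slope of the reflected map, and the reflection is itself an
  automorphism that swaps the two kernels. If \<open>\<alpha>\<close> preserves the kernels, then rigidity applies to \<open>\<alpha>\<close>
  and to its conjugate by the reflection, and both factors are preserved. If \<open>\<alpha>\<close> swaps the kernels,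
  rigidity applies to \<open>\<alpha>\<close> preceded and to \<open>\<alpha>\<close> followed by the reflection, and the factors are
  exchanged. The character is onto because elements can have any slope at the left end and be the
  identity near the right end.\<close>
lemma invariant_slope_symmetric:
  assumes J: "admissible J" and e: "e \<in> A" and sym: "(-) e ` J = J"
    and rigid: "\<And>\<alpha> f. PLG_auto J \<alpha> \<Longrightarrow> \<alpha> ` left_kernel J = left_kernel J \<Longrightarrow> f \<in> PLG J \<Longrightarrow> left_slope J (\<alpha> f) = left_slope J f"
  shows "invariant_slope J (\<lambda>g. left_slope J g * left_slope J (reflect e g))"
  unfolding invariant_slope_def
proof (intro conjI ballI allI impI)
  let ?r = "reflect e"
  have r: "PLG_auto J ?r" by (rule auto_reflect[OF e sym])
  have rG: "?r g \<in> PLG J" if "g \<in> PLG J" for g by (rule auto_mem[OF r that])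
  show "(\<lambda>g. left_slope J g * left_slope J (?r g)) ` PLG J = P"
  proof
    show "(\<lambda>g. left_slope J g * left_slope J (?r g)) ` PLG J \<subseteq> P"
      using P_mult left_slope_in_P[OF J] rG by blast
    show "P \<subseteq> (\<lambda>g. left_slope J g * left_slope J (?r g)) ` PLG J"
    proof
      fix p assume "p \<in> P"
      obtain f where f: "f \<in> right_kernel J" "left_slope J f = p"
        by (rule exists_left_slope_fixing_right[OF J \<open>p \<in> P\<close>])
      have "?r f \<in> left_kernel J" using reflect_left_kernel_iff[OF e, of f J] f(1) sym by simp
      then have "p = left_slope J f * left_slope J (?r f)" using left_slope_left_kernel[OF J] f(2) by simp
      then show "p \<in> (\<lambda>g. left_slope J g * left_slope J (?r g)) ` PLG J"
        using right_kernel_PLG[OF f(1)] by (rule image_eqI)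
    qed
  qed
  show "left_slope J (f \<circ> g) * left_slope J (?r (f \<circ> g)) = left_slope J f * left_slope J (?r f) * (left_slope J g * left_slope J (?r g))"
    if "f \<in> PLG J" "g \<in> PLG J" for f g
    using that by (simp add: reflect_comp left_slope_comp[OF J] rG)
  have left_kernel_right_kernel: "?r ` right_kernel J = left_kernel J" "?r ` left_kernel J = right_kernel J"
  proof -
    have "?r g \<in> left_kernel J \<longleftrightarrow> g \<in> right_kernel J" "?r g \<in> right_kernel J \<longleftrightarrow> g \<in> left_kernel J" for g
      using reflect_left_kernel_iff[OF e, of g J] reflect_right_kernel_iff[OF e, of g J] sym by simp_all
    then show "?r ` right_kernel J = left_kernel J" "?r ` left_kernel J = right_kernel J"
      by (metis (no_types, lifting) image_eqI image_subsetI reflect_reflect subsetI subset_antisym)+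
  qed
  show "left_slope J (\<alpha> g) * left_slope J (?r (\<alpha> g)) = left_slope J g * left_slope J (?r g)"
    if \<alpha>: "PLG_auto J \<alpha>" and g: "g \<in> PLG J" for \<alpha> g
    using auto_permutes_ends[OF J \<alpha>]
  proof
    assume fix_ends: "\<alpha> ` left_kernel J = left_kernel J \<and> \<alpha> ` right_kernel J = right_kernel J"
    have "(?r \<circ> \<alpha> \<circ> ?r) ` left_kernel J = left_kernel J" by (simp only: image_comp[symmetric] left_kernel_right_kernel fix_ends)
    then have "left_slope J ((?r \<circ> \<alpha> \<circ> ?r) (?r g)) = left_slope J (?r g)"
      using rigid[of "?r \<circ> \<alpha> \<circ> ?r" "?r g"] auto_compose[OF auto_compose[OF r \<alpha>] r] rG[OF g] by blast
    then show ?thesis using rigid[OF \<alpha> _ g] fix_ends by simp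
  next
    assume swap: "\<alpha> ` left_kernel J = right_kernel J \<and> \<alpha> ` right_kernel J = left_kernel J"
    have "(?r \<circ> \<alpha>) ` left_kernel J = left_kernel J" by (simp only: image_comp[symmetric] left_kernel_right_kernel swap)
    then have 1: "left_slope J ((?r \<circ> \<alpha>) g) = left_slope J g"
      using rigid[of "?r \<circ> \<alpha>" g] auto_compose[OF r \<alpha>] g by blast
    have "(\<alpha> \<circ> ?r) ` left_kernel J = left_kernel J" by (simp only: image_comp[symmetric] left_kernel_right_kernel swap)
    then have "left_slope J ((\<alpha> \<circ> ?r) (?r g)) = left_slope J (?r g)"
      using rigid[of "\<alpha> \<circ> ?r" "?r g"] auto_compose[OF \<alpha> r] rG[OF g] by blast
    then show ?thesis using 1 by simp
  qed
qed

text \<open>Germs at \<open>0\<close> are determined by slopes, so all commutators are the identity near \<open>0\<close>. Near infinity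
  germs form a group of affine maps in which two expansions about different points do not commute.\<close>
lemma half_line_ends_not_swapped:
  assumes \<alpha>: "PLG_auto {0<..} \<alpha>" and J: "admissible {0<..}"
  shows "\<alpha> ` left_kernel {0<..} \<noteq> right_kernel {0<..}"
proof
  let ?J = "{0<..}" and ?c = "\<lambda>f g. finv (g \<circ> f) \<circ> (f \<circ> g)"
  assume swap: "\<alpha> ` left_kernel ?J = right_kernel ?J"
  have zero: "\<forall>t\<in>?J. 0 < t \<and> {0<..t} \<subseteq> ?J" by auto
  have commutator_left_kernel: "?c f g \<in> left_kernel ?J" if fg: "f \<in> PLG ?J" "g \<in> PLG ?J" for f g
  proof -
    have germ: "left_germ ?J h (left_slope ?J h) 0" if h: "h \<in> PLG ?J" for h
      using left_germ_left_slope[OF J h] left_germ_at_zero[OF J zero h] by metis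
    have "left_slope ?J (g \<circ> f) = left_slope ?J (f \<circ> g)"
      by (simp add: left_slope_comp[OF J fg] left_slope_comp[OF J fg(2,1)])
    then show ?thesis
      using same_left_germ[OF J PLG_comp[OF fg] PLG_comp[OF fg(2,1)]]
        germ[OF PLG_comp[OF fg]] germ[OF PLG_comp[OF fg(2,1)]] by simp
  qed
  have commutator_right_kernel: "?c k l \<in> right_kernel ?J" if k: "k \<in> PLG ?J" and l: "l \<in> PLG ?J" for k l
  proof -
    obtain f where f: "f \<in> PLG ?J" "k = \<alpha> f" by (rule auto_surj[OF \<alpha> k])
    obtain g where g: "g \<in> PLG ?J" "l = \<alpha> g" by (rule auto_surj[OF \<alpha> l])
    have "?c k l = \<alpha> (?c f g)"
      by (simp only: f(2) g(2) auto_comp[OF \<alpha>] auto_inv[OF \<alpha>] PLG_comp PLG_inv f(1) g(1))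
    then show ?thesis using commutator_left_kernel[OF f(1) g(1)] swap by blast
  qed
  obtain p where p: "p \<in> P" "1 < p" by (rule P_gt_one)
  obtain a where a: "a \<in> A" "0 < a" using A_dense[of 0 1] by auto
  define k where "k = kink a p"
  define l where "l = kink (a + a) p"
  have k: "k \<in> PLG ?J" unfolding k_def using a by (intro kink_in_PLG p) auto
  have l: "l \<in> PLG ?J" unfolding l_def using a by (intro kink_in_PLG p A_add) auto
  obtain y where y: "\<forall>t\<ge>y. ?c k l t = t" using commutator_right_kernel[OF k l] unfolding right_kernel_def by blast
  define t where "t = max y (a + a)"
  have t: "a + a \<le> t" "y \<le> t" by (auto simp: t_def)
  have "k (l t) = l (k t)"
  proof -
    have "?c k l t = t" using y t by blast
    then have "finv (l \<circ> k) ((k \<circ> l) t) = t" by (simp only: comp_apply)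
    then have "(k \<circ> l) t = (l \<circ> k) t"
      using PLG_apply_inv[OF PLG_comp[OF l k], of "(k \<circ> l) t"] by (simp only:)
    then show ?thesis by (simp only: comp_apply)
  qed
  moreover have "k t = a + p * (t - a)" "l t = a + a + p * (t - (a + a))"
    using t a by (simp_all add: k_def l_def kink_right)
  moreover have "a + a \<le> a + p * (t - a)"
  proof -
    have "1 * (t - a) \<le> p * (t - a)" using p t a by (intro mult_right_mono) auto
    then show ?thesis using t by simp
  qed
  moreover have "a \<le> a + a + p * (t - (a + a))" using t a p by (simp add: add_increasing2)
  ultimately have "a + p * (a + a + p * (t - (a + a)) - a) = a + a + p * (a + p * (t - a) - (a + a))"
    by (simp add: k_def l_def kink_right)
  then have "(p - 1) * (p - 1) * a = 0" by (simp add: algebra_simps)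
  then show False using p a by simp
qed

lemma exists_invariant_slope:
  assumes I: "(\<exists>b\<in>A. 0 < b \<and> I = {0..b}) \<or> I = {0..} \<or> I = UNIV"
  obtains \<psi> where "invariant_slope (interior I) \<psi>"
proof -
  consider (segment) b where "b \<in> A" "0 < b" "I = {0..b}" | (half) "I = {0..}" | (line) "I = UNIV"
    using I by blast
  then show ?thesis
  proof cases
    case segment
    have zero: "\<forall>t\<in>{0<..<b}. 0 < t \<and> {0<..t} \<subseteq> {0<..<b}" by auto
    have "\<forall>t\<in>{0<..<b}. t < b \<and> {t..<b} \<subseteq> {0<..<b}" by auto
    then have J: "admissible {0<..<b}"
      unfolding admissible_def using zero segment(1,2) A_zero dense by (metis greaterThanLessThan_iff empty_iff)
    have "(-) b ` {0<..<b} = {0<..<b}"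
    proof
      show "{0<..<b} \<subseteq> (-) b ` {0<..<b}"
      proof
        fix t assume "t \<in> {0<..<b}"
        then show "t \<in> (-) b ` {0<..<b}" by (intro image_eqI[of _ _ "b - t"]) auto
      qed
    qed auto
    then have "invariant_slope {0<..<b} (\<lambda>g. left_slope {0<..<b} g * left_slope {0<..<b} (reflect b g))"
      using segment by (intro invariant_slope_symmetric J left_slope_rigid_zero[OF J zero])
    then show ?thesis using that segment by simp
  next
    case half
    have zero: "\<forall>t\<in>{0<..}. 0 < t \<and> {0<..t} \<subseteq> {0::real<..}" by auto
    have "\<forall>t\<in>{0<..}. {t..} \<subseteq> {0::real<..}" by auto
    moreover have "(1 :: real) \<in> {0<..}" by simp
    ultimately have J: "admissible {0<..}" unfolding admissible_def using zero A_zero by blast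
    have "invariant_slope {0<..} (left_slope {0<..})"
      unfolding invariant_slope_def
    proof (intro conjI ballI allI impI)
      have "p \<in> left_slope {0<..} ` PLG {0<..}" if p: "p \<in> P" for p
      proof -
        obtain f where "f \<in> right_kernel {0<..}" "left_slope {0<..} f = p"
          by (rule exists_left_slope_fixing_right[OF J p])
        then show ?thesis using right_kernel_PLG by blast
      qed
      then show "left_slope {0<..} ` PLG {0<..} = P" using left_slope_in_P[OF J] by blast
      show "left_slope {0<..} (\<alpha> g) = left_slope {0<..} g" if \<alpha>: "PLG_auto {0<..} \<alpha>" and g: "g \<in> PLG {0<..}" for \<alpha> g
        using auto_permutes_ends[OF J \<alpha>] half_line_ends_not_swapped[OF \<alpha> J]
        by (intro left_slope_rigid_zero[OF J zero \<alpha> _ g]) blast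
    qed (rule left_slope_comp[OF J])
    then show ?thesis using that half by (simp add: interior_real_atLeast)
  next
    case line
    have "(-) 0 ` UNIV = (UNIV :: real set)" by (auto intro: image_eqI[of _ _ "- x" for x])
    then have "invariant_slope UNIV (\<lambda>g. left_slope UNIV g * left_slope UNIV (reflect 0 g))"
      by (intro invariant_slope_symmetric admissible_UNIV A_zero left_slope_rigid_UNIV)
    then show ?thesis using that line by simp
  qed
qed

end

text \<open>In an abelian target group the contributions of \<open>g\<close> and of \<open>\<alpha> g\<close> to the value of \<open>\<psi>\<close> on a twisted
  conjugate cancel, so \<open>\<psi>\<close> separates infinitely many twisted conjugacy classes.\<close>
lemma property_R_infinity_if_invariant_hom:
  assumes G: "group G" and H: "comm_group H" and \<psi>: "\<psi> \<in> hom G H"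
    and inf: "infinite (\<psi> ` carrier G)"
    and inv: "\<And>\<alpha> g. \<alpha> \<in> iso G G \<Longrightarrow> g \<in> carrier G \<Longrightarrow> \<psi> (\<alpha> g) = \<psi> g"
  shows "property_R_infinity G"
  unfolding property_R_infinity_def
proof (intro conjI G ballI notI)
  fix \<alpha> assume \<alpha>: "\<alpha> \<in> iso G G"
  assume fin: "finite (twisted_conjugacy_class G \<alpha> ` carrier G)"
  interpret G: group G by (rule G)
  interpret H: comm_group H by (rule H)
  interpret \<psi>: group_hom G H \<psi> by (intro group_hom.intro group_hom_axioms.intro G H.is_group \<psi>)
  have \<alpha>G: "\<alpha> g \<in> carrier G" if "g \<in> carrier G" for g using \<alpha> that unfolding iso_def hom_def by blast
  have "\<psi> ` twisted_conjugacy_class G \<alpha> x = {\<psi> x}" if x: "x \<in> carrier G" for x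
  proof -
    have const: "\<psi> (g \<otimes>\<^bsub>G\<^esub> x \<otimes>\<^bsub>G\<^esub> inv\<^bsub>G\<^esub> (\<alpha> g)) = \<psi> x" if g: "g \<in> carrier G" for g
    proof -
      have "\<psi> (g \<otimes>\<^bsub>G\<^esub> x \<otimes>\<^bsub>G\<^esub> inv\<^bsub>G\<^esub> (\<alpha> g)) = \<psi> g \<otimes>\<^bsub>H\<^esub> \<psi> x \<otimes>\<^bsub>H\<^esub> inv\<^bsub>H\<^esub> (\<psi> g)"
        using g x \<alpha>G by (simp add: inv[OF \<alpha> g])
      also have "\<dots> = \<psi> x" using g x by (simp add: H.m_comm[of "\<psi> g" "\<psi> x"] H.m_assoc)
      finally show ?thesis .
    qed
    show ?thesis
    proof
      show "\<psi> ` twisted_conjugacy_class G \<alpha> x \<subseteq> {\<psi> x}"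
        unfolding twisted_conjugacy_class_def using const by auto
      have "\<one>\<^bsub>G\<^esub> \<otimes>\<^bsub>G\<^esub> x \<otimes>\<^bsub>G\<^esub> inv\<^bsub>G\<^esub> (\<alpha> \<one>\<^bsub>G\<^esub>) \<in> twisted_conjugacy_class G \<alpha> x"
        unfolding twisted_conjugacy_class_def
        by (intro CollectI exI[of _ "\<one>\<^bsub>G\<^esub>"] conjI refl G.one_closed)
      from imageI[OF this, of \<psi>] show "{\<psi> x} \<subseteq> \<psi> ` twisted_conjugacy_class G \<alpha> x"
        unfolding const[OF G.one_closed] by simp
    qed
  qed
  then have "(`) \<psi> ` twisted_conjugacy_class G \<alpha> ` carrier G = (\<lambda>y. {y}) ` \<psi> ` carrier G"
    by (simp add: image_image)
  then have "finite ((\<lambda>y. {y}) ` \<psi> ` carrier G)" using finite_imageI[OF fin, of "(`) \<psi>"] by simp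
  then show False using inf by (simp add: finite_image_iff)
qed

theorem theorem1p4:
  fixes P A I :: "real set"
  assumes "subgroup P positive_real_group" and "P \<noteq> {1}"
    and "subgroup A additive_real_group" and "A \<noteq> {0}"
    and "\<And>p. p \<in> P \<Longrightarrow> (\<lambda>a. p * a) ` A \<subseteq> A"
    and "(\<exists>b\<in>A. 0 < b \<and> I = {0..b}) \<or> I = {0..} \<or> I = UNIV"
  shows "(\<exists>\<psi> \<in> epi (G_PL I A P) (positive_real_group\<lparr>carrier := P\<rparr>).
            \<forall>\<alpha> \<in> iso (G_PL I A P) (G_PL I A P).
              \<forall>g \<in> carrier (G_PL I A P). \<psi> (\<alpha> g) = \<psi> g)
         \<and> property_R_infinity (G_PL I A P)"
proof -
  interpret pl_setting A P by (rule pl_setting.intro) (fact assms)+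
  let ?G = "G_PL I A P" and ?P = "positive_real_group\<lparr>carrier := P\<rparr>"
  obtain \<psi> where \<psi>: "invariant_slope (interior I) \<psi>" by (rule exists_invariant_slope[OF assms(6)])
  have image: "\<psi> ` carrier ?G = P" using \<psi> by (simp add: invariant_slope_def carrier_G_PL)
  have hom: "\<psi> \<in> hom ?G ?P"
    using \<psi> image by (auto simp: hom_def invariant_slope_def carrier_G_PL G_PL_mult positive_real_group_def)
  have inv: "\<psi> (\<alpha> g) = \<psi> g" if "\<alpha> \<in> iso ?G ?G" "g \<in> carrier ?G" for \<alpha> g
    using \<psi> iso_PLG_auto[OF that(1)] that(2) by (simp add: invariant_slope_def carrier_G_PL)
  have "group ?P" by (rule subgroup.subgroup_is_group[OF assms(1) group_positive_real])
  then have "comm_group ?P" by (rule group.group_comm_groupI) (simp add: positive_real_group_def)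
  then have "property_R_infinity ?G"
    using image infinite_P by (intro property_R_infinity_if_invariant_hom[OF group_G_PL _ hom] inv) simp_all
  moreover have "\<psi> \<in> epi ?G ?P" using hom image by (simp add: epi_def)
  ultimately show ?thesis using inv by blast
qed

end
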